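(* Let $g:[1,\infty)\to[1,\infty)$ be a function such that (i) $g$ is non-decreasing on $[1,\infty)$, (ii) $\lim_{\rho\to\infty}\rho^{-1/3}g(\rho)=0$, and (iii) for all $a\ge 1$, $\int_a^\infty \frac{1}{g(\rho)}\frac{d\rho}{\rho}=\infty$. Suppose $\mathbf{u}$ is a smooth solution (together with a smooth pressure $\pi$) of the three-dimensional stationary Navier--Stokes equations $$-\Delta\mathbf{u}+(\mathbf{u}\cdot\nabla)\mathbf{u}+\nabla\pi=0,\qquad \nabla\cdot\mathbf{u}=0\quad\text{in }\mathbb{R}^3,$$ such that (1) $\nabla\mathbf{u}\in L^2(\mathbb{R}^3)$, and (2) there exist $0<\theta<1$ and $1\le p<3$ satisfying $$\limsup_{\rho\to\infty}\frac{\|\mathbf{u}\|_{L^p(A(\theta\rho,\theta^{-1}\rho))}}{\rho^{\frac{2}{p}-\frac13}\,g(\rho)^{\frac3p-1}}<\infty.$$ Then $\mathbf{u}=0$.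
   Context: For $0<\rho_1<\rho_2<\infty$, $A(\rho_1,\rho_2)=\{x\in\mathbb{R}^3:\rho_1\le|x|<\rho_2\}$. *)

theory Defs
  imports "HOL-Analysis.Analysis"
begin

definition partial :: "(real^3 \<Rightarrow> 'b::real_normed_vector) \<Rightarrow> 3 \<Rightarrow> real^3 \<Rightarrow> 'b" where
  "partial f j x = frechet_derivative f (at x) (axis j 1)"

fun Ck :: "nat \<Rightarrow> (real^3 \<Rightarrow> 'b::real_normed_vector) \<Rightarrow> bool" where
  "Ck 0 f = continuous_on UNIV f"
| "Ck (Suc k) f = (continuous_on UNIV f \<and> f differentiable_on UNIV \<and> (\<forall>j. Ck k (partial f j)))"

definition smooth :: "(real^3 \<Rightarrow> 'b::real_normed_vector) \<Rightarrow> bool" where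
  "smooth f = (\<forall>k. Ck k f)"

definition annulus :: "real \<Rightarrow> real \<Rightarrow> (real^3) set" where
  "annulus r1 r2 = {x. r1 \<le> norm x \<and> norm x < r2}"

definition Lp_norm_on :: "(real^3) set \<Rightarrow> real \<Rightarrow> (real^3 \<Rightarrow> real^3) \<Rightarrow> real" where
  "Lp_norm_on A p f = (LINT x:A|lborel. norm (f x) powr p) powr (1 / p)"

definition laplacian :: "(real^3 \<Rightarrow> real^3) \<Rightarrow> real^3 \<Rightarrow> real^3" where
  "laplacian u x = (\<Sum>j\<in>UNIV. partial (partial u j) j x)"

definition convective :: "(real^3 \<Rightarrow> real^3) \<Rightarrow> real^3 \<Rightarrow> real^3" where
  "convective u x = (\<Sum>j\<in>UNIV. (u x $ j) *\<^sub>R partial u j x)"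

definition grad :: "(real^3 \<Rightarrow> real) \<Rightarrow> real^3 \<Rightarrow> real^3" where
  "grad f x = (\<chi> j. partial f j x)"

definition divergence :: "(real^3 \<Rightarrow> real^3) \<Rightarrow> real^3 \<Rightarrow> real" where
  "divergence u x = (\<Sum>j\<in>UNIV. partial u j x $ j)"

definition grad_norm_sq :: "(real^3 \<Rightarrow> real^3) \<Rightarrow> real^3 \<Rightarrow> real" where
  "grad_norm_sq u x = (\<Sum>j\<in>UNIV. (norm (partial u j x))\<^sup>2)"

end

theory Submission
  imports Defs
begin

text \<open>Rescaling the annulus at distance \<open>\<rho>\<close> to unit size turns the equations into a Navier-Stokes
  system with viscosity \<open>1/\<rho>\<close>. There the energy inside is bounded by cubic quantities on the
  shell, provided the pressure flux through the shell is controlled. Instead of Calderon-Zygmund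
  theory or a Bogovskii corrector, the pressure is compared with its mollifications at
  scales \<open>s\<close>: by the pressure equation its \<open>s\<close>-derivative, paired with \<open>f = v \<bullet> \<nabla>\<phi>\<close>, is a
  trilinear form in \<open>v, v, f\<close> with a smooth kernel of size \<open>s\<close>, which is bounded either by
  \<open>\<nabla>f\<close> in \<open>L\<^sup>2\<close> (integrable at \<open>s = 0\<close>) or by \<open>f\<close> in \<open>L\<^sup>p\<close> (integrable at large \<open>s\<close>
  because \<open>p < 3\<close>). The mollification at unit scale oscillates little over the shell, and \<open>f\<close> has
  mean zero. Splitting at the scale \<open>s = \<kappa> \<rho>\<^sup>2\<^sup>/\<^sup>3 g(\<rho>)\<close> (before rescaling) bounds the total energy
  by powers of \<open>\<kappa>\<^sup>1\<^sup>-\<^sup>3\<^sup>/\<^sup>p\<close> and \<open>\<kappa> g(\<rho>) D(\<rho>)\<close> with \<open>D\<close> the annular energy; divergence of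
  \<open>\<integral> d\<rho>/(\<rho> g)\<close> against \<open>\<nabla>u \<in> L\<^sup>2\<close> gives radii with \<open>g D \<rightarrow> 0\<close>, and then \<open>\<kappa> \<rightarrow> \<infinity>\<close>.\<close>

section \<open>Bounded functions with bounded support\<close>

text \<open>The obstacle is that a cubic flux has to be paid for by an \<open>L^p\<close> norm with
  \<open>p < 3\<close> and a gradient, both on the same annulus. Two quantities resist: the
  \<open>L^3\<close> norm on the shell and the pressure flux. Both are values at
  \<open>s = 0\<close> of a pairing that depends on a scale \<open>s\<close>, and one inequality
  (\<open>pairing_le\<close>) serves both: a factor quadratic in \<open>v\<close> is paired with
  means over balls of radius \<open>s\<close>, and such means map \<open>L^q\<close> to
  \<open>L^3\<close> with norm of order \<open>s powr (1 - 3 / q)\<close>. With \<open>q = 2\<close>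
  this is \<open>s powr (-1/2)\<close>; with \<open>q = p\<close> it decays in \<open>s\<close>.
  Either way the outcome is a bound by
  \<open>Y = s powr (1 - 3 / p) * \<Lambda> + sqrt s * \<Delta>\<close>, where \<open>s\<close> is
  now the splitting scale. In the original variables the energy is at most a multiple of
  \<open>D + \<rho> Y^2 + \<rho>^2 Y^3\<close>, so \<open>Y\<close> has to be small compared with
  \<open>\<rho> powr (-2/3)\<close>. This dictates the splitting scale: it is the one at which all
  powers of \<open>\<rho>\<close> and \<open>g\<close> outside \<open>g * D\<close> cancel against
  this requirement. Its rescaled size tends to 0 by the growth condition on \<open>g\<close>, so it
  fits inside the shell. Since \<open>\<kappa>\<close> multiplies \<open>g * D\<close>, it is fixed
  before the radius is chosen.\<close>

text \<open>\<open>lbb\<close>: locally bounded Borel; \<open>bbs\<close>: bounded Borel with bounded support.\<close>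

definition lbb :: "('a::euclidean_space \<Rightarrow> real) \<Rightarrow> bool" where
  "lbb h \<longleftrightarrow> h \<in> borel_measurable borel \<and> (\<forall>R. \<exists>B. \<forall>x. norm x \<le> R \<longrightarrow> \<bar>h x\<bar> \<le> B)"

definition bbs :: "('a::euclidean_space \<Rightarrow> real) \<Rightarrow> bool" where
  "bbs h \<longleftrightarrow> h \<in> borel_measurable borel \<and> (\<exists>B. \<forall>x. \<bar>h x\<bar> \<le> B) \<and> (\<exists>R. \<forall>x. norm x > R \<longrightarrow> h x = 0)"

lemma bbsE:
  assumes "bbs h"
  obtains B R where "h \<in> borel_measurable borel" "B > 0" "R > 0"
    "\<And>x. \<bar>h x\<bar> \<le> B" "\<And>x. norm x > R \<Longrightarrow> h x = 0"
proof -
  from assms obtain B R where *: "h \<in> borel_measurable borel"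
    "\<And>x. \<bar>h x\<bar> \<le> B" "\<And>x. norm x > R \<Longrightarrow> h x = 0"
    unfolding bbs_def by blast
  show ?thesis
  proof (rule that[of "max B 1" "max R 1"])
    show "\<bar>h x\<bar> \<le> max B 1" for x using *(2)[of x] by linarith
    show "max R 1 < norm x \<Longrightarrow> h x = 0" for x using *(3)[of x] by linarith
  qed (use * in auto)
qed

lemma bbs_measurable [measurable_dest]: "bbs h \<Longrightarrow> h \<in> borel_measurable borel"
  by (simp add: bbs_def)

lemma lbb_measurable [measurable_dest]: "lbb h \<Longrightarrow> h \<in> borel_measurable borel"
  by (simp add: lbb_def)

lemma bbs_imp_lbb: "bbs h \<Longrightarrow> lbb h"
  unfolding bbs_def lbb_def by blast

lemma bbs_integrable:
  assumes "bbs h" shows "integrable lborel h"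
proof -
  obtain B R where *: "h \<in> borel_measurable borel"
    "\<And>x. \<bar>h x\<bar> \<le> B" "\<And>x. norm x > R \<Longrightarrow> h x = 0" by (rule bbsE[OF assms]) blast
  show ?thesis
  proof (rule integrableI_bounded_set[where A = "cball 0 R" and B = B])
    show "emeasure lborel (cball 0 R :: 'a set) < \<infinity>"
      using emeasure_lborel_cball_finite by (auto simp: top.not_eq_extremum)
    show "AE x in lborel. x \<in> cball 0 R \<longrightarrow> norm (h x) \<le> B" using *(2) by auto
    show "AE x in lborel. x \<notin> cball 0 R \<longrightarrow> h x = 0" using *(3) by auto
  qed (use * in auto)
qed

lemma lbb_mult: assumes "lbb f" "lbb g" shows "lbb (\<lambda>x. f x * g x)"
  unfolding lbb_def
proof (intro conjI allI)
  show "(\<lambda>x. f x * g x) \<in> borel_measurable borel"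
    using assms[THEN lbb_measurable] by measurable
  fix R
  from assms obtain B C where "\<And>x. norm x \<le> R \<Longrightarrow> \<bar>f x\<bar> \<le> B" "\<And>x. norm x \<le> R \<Longrightarrow> \<bar>g x\<bar> \<le> C"
    unfolding lbb_def by meson
  then have "\<bar>f x * g x\<bar> \<le> B * C" if "norm x \<le> R" for x
    using that unfolding abs_mult by (meson abs_ge_zero mult_mono order_trans)
  then show "\<exists>B. \<forall>x. norm x \<le> R \<longrightarrow> \<bar>f x * g x\<bar> \<le> B" by blast
qed

lemma lbb_add: assumes "lbb f" "lbb g" shows "lbb (\<lambda>x. f x + g x)"
  unfolding lbb_def
proof (intro conjI allI)
  show "(\<lambda>x. f x + g x) \<in> borel_measurable borel"
    using assms[THEN lbb_measurable] by measurable
  fix R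
  from assms obtain B C where "\<And>x. norm x \<le> R \<Longrightarrow> \<bar>f x\<bar> \<le> B" "\<And>x. norm x \<le> R \<Longrightarrow> \<bar>g x\<bar> \<le> C"
    unfolding lbb_def by meson
  then show "\<exists>B. \<forall>x. norm x \<le> R \<longrightarrow> \<bar>f x + g x\<bar> \<le> B"
    by (intro exI[of _ "B + C"]) (meson abs_triangle_ineq add_mono order_trans)
qed

lemma lbb_const: "lbb (\<lambda>x. c)"
  unfolding lbb_def by auto

lemma lbb_sum: "(\<And>i. i \<in> I \<Longrightarrow> lbb (f i)) \<Longrightarrow> lbb (\<lambda>x. \<Sum>i\<in>I. f i x)"
  by (induction I rule: infinite_finite_induct) (auto intro: lbb_const lbb_add)

lemma lbb_continuous:
  assumes "continuous_on UNIV h" shows "lbb h"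
  unfolding lbb_def
proof (intro conjI allI)
  show "h \<in> borel_measurable borel" using assms by (rule borel_measurable_continuous_onI)
  fix R
  have "compact (h ` cball 0 R)"
    using assms by (intro compact_continuous_image) (auto intro: continuous_on_subset)
  then obtain B where "\<forall>y\<in>h ` cball 0 R. norm y \<le> B"
    using compact_imp_bounded bounded_iff by metis
  then show "\<exists>B. \<forall>x. norm x \<le> R \<longrightarrow> \<bar>h x\<bar> \<le> B" by (intro exI[of _ B]) auto
qed

lemma lbb_compose:
  fixes c :: "'a::euclidean_space \<Rightarrow> 'b::euclidean_space"
  assumes "lbb h" "continuous_on UNIV c" shows "lbb (\<lambda>x. h (c x))"
  unfolding lbb_def
proof (intro conjI allI)
  have [measurable]: "c \<in> borel_measurable borel"
    using assms(2) by (rule borel_measurable_continuous_onI)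
  show "(\<lambda>x. h (c x)) \<in> borel_measurable borel"
    using assms(1)[THEN lbb_measurable] by measurable
  fix R
  have "compact (c ` cball 0 R)"
    using assms by (intro compact_continuous_image) (auto intro: continuous_on_subset)
  then obtain C where C: "\<forall>y\<in>c ` cball 0 R. norm y \<le> C"
    using compact_imp_bounded bounded_iff by metis
  obtain B where "\<And>y. norm y \<le> C \<Longrightarrow> \<bar>h y\<bar> \<le> B"
    using assms(1) unfolding lbb_def by meson
  with C show "\<exists>B. \<forall>x. norm x \<le> R \<longrightarrow> \<bar>h (c x)\<bar> \<le> B" by (intro exI[of _ B]) auto
qed

lemma bbs_mult_lbb: assumes "bbs f" "lbb g" shows "bbs (\<lambda>x. f x * g x)"
proof -
  obtain B R where *: "B > 0" "\<And>x. \<bar>f x\<bar> \<le> B" "\<And>x. norm x > R \<Longrightarrow> f x = 0"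
    by (rule bbsE[OF assms(1)]) blast
  obtain C where C: "\<And>x. norm x \<le> R \<Longrightarrow> \<bar>g x\<bar> \<le> C" using assms(2) unfolding lbb_def by meson
  have "\<bar>f x * g x\<bar> \<le> B * max C 0" for x
  proof (cases "norm x \<le> R")
    case True
    then show ?thesis using *(1) *(2)[of x] C[OF True] by (auto simp: abs_mult intro!: mult_mono)
  next
    case False
    then show ?thesis using *(1) *(3)[of x] by auto
  qed
  moreover have "\<forall>x. norm x > R \<longrightarrow> f x * g x = 0" using *(3) by auto
  moreover have "(\<lambda>x. f x * g x) \<in> borel_measurable borel"
    using assms(1)[THEN bbs_measurable] assms(2)[THEN lbb_measurable] by measurable
  ultimately show ?thesis unfolding bbs_def by blast
qed

lemma lbb_mult_bbs: "lbb g \<Longrightarrow> bbs f \<Longrightarrow> bbs (\<lambda>x. g x * f x)"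
  using bbs_mult_lbb[of f g] by (simp add: mult.commute)

lemma bbs_dom:
  assumes "bbs f" "g \<in> borel_measurable borel" "\<And>x. \<bar>g x\<bar> \<le> c * \<bar>f x\<bar>"
  shows "bbs g"
proof -
  obtain B R where *: "B > 0" "\<And>x. \<bar>f x\<bar> \<le> B" "\<And>x. norm x > R \<Longrightarrow> f x = 0"
    by (rule bbsE[OF assms(1)]) blast
  have "\<bar>g x\<bar> \<le> \<bar>c\<bar> * B" for x
  proof -
    have "\<bar>g x\<bar> \<le> c * \<bar>f x\<bar>" by (rule assms)
    also have "\<dots> \<le> \<bar>c\<bar> * \<bar>f x\<bar>" by (intro mult_right_mono) auto
    also have "\<dots> \<le> \<bar>c\<bar> * B" using *(2) by (intro mult_left_mono) auto
    finally show ?thesis .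
  qed
  moreover have "g x = 0" if "norm x > R" for x using assms(3)[of x] *(3)[OF that] by auto
  ultimately show ?thesis using assms(2) unfolding bbs_def by blast
qed

lemma bbs_abs: "bbs f \<Longrightarrow> bbs (\<lambda>x. \<bar>f x\<bar>)"
  by (rule bbs_dom[where c = 1 and f = f]) (auto dest: bbs_measurable)

lemma bbs_cmult: "bbs f \<Longrightarrow> bbs (\<lambda>x. c * f x)"
  by (rule lbb_mult_bbs[OF lbb_const])

lemma bbs_add: assumes "bbs f" "bbs g" shows "bbs (\<lambda>x. f x + g x)"
proof -
  obtain B R where f: "\<And>x. \<bar>f x\<bar> \<le> B" "\<And>x. norm x > R \<Longrightarrow> f x = 0"
    by (rule bbsE[OF assms(1)]) blast
  obtain C S where g: "\<And>x. \<bar>g x\<bar> \<le> C" "\<And>x. norm x > S \<Longrightarrow> g x = 0"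
    by (rule bbsE[OF assms(2)]) blast
  have "\<bar>f x + g x\<bar> \<le> B + C" for x using f(1)[of x] g(1)[of x] by linarith
  moreover have "\<forall>x. norm x > max R S \<longrightarrow> f x + g x = 0" using f(2) g(2) by auto
  moreover have "(\<lambda>x. f x + g x) \<in> borel_measurable borel"
    using assms[THEN bbs_measurable] by measurable
  ultimately show ?thesis unfolding bbs_def by blast
qed

lemma bbs_zero: "bbs (\<lambda>x. 0)"
  unfolding bbs_def by auto

lemma bbs_sum: "(\<And>i. i \<in> I \<Longrightarrow> bbs (f i)) \<Longrightarrow> bbs (\<lambda>x. \<Sum>i\<in>I. f i x)"
  by (induction I rule: infinite_finite_induct) (auto intro: bbs_zero bbs_add)

lemma bbs_power: assumes "bbs f" "n > 0" shows "bbs (\<lambda>x. f x ^ n)"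
proof -
  have "bbs (\<lambda>x. f x ^ Suc m)" for m
    by (induction m) (use assms(1) in \<open>auto intro: bbs_mult_lbb dest: bbs_imp_lbb\<close>)
  from this[of "n - 1"] assms(2) show ?thesis by simp
qed

lemma bbs_powr: assumes "bbs f" "q > 0" "\<And>x. f x \<ge> 0" shows "bbs (\<lambda>x. f x powr q)"
proof -
  obtain B R where f: "\<And>x. \<bar>f x\<bar> \<le> B" "\<And>x. norm x > R \<Longrightarrow> f x = 0"
    by (rule bbsE[OF assms(1)]) blast
  have "\<bar>f x powr q\<bar> \<le> B powr q" for x
    using f(1)[of x] assms(2) assms(3)[of x] by (auto intro!: powr_mono2)
  moreover have "\<forall>x. norm x > R \<longrightarrow> f x powr q = 0" using f(2) by auto
  moreover have "(\<lambda>x. f x powr q) \<in> borel_measurable borel"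
    using assms(1)[THEN bbs_measurable] by measurable
  ultimately show ?thesis unfolding bbs_def by blast
qed

lemma bbs_indicator:
  assumes "A \<in> sets borel" "bounded A" shows "bbs (indicator A)"
proof -
  obtain R where "\<And>x. x \<in> A \<Longrightarrow> norm x \<le> R" using assms(2) unfolding bounded_iff by blast
  then have "\<forall>x. norm x > R \<longrightarrow> indicator A x = (0::real)" by (force simp: indicator_def)
  moreover have "\<forall>x. \<bar>indicator A x :: real\<bar> \<le> 1" by (auto simp: indicator_def)
  ultimately show ?thesis using assms(1) unfolding bbs_def
    using borel_measurable_indicator by blast
qed

lemma bbs_continuous:
  assumes "continuous_on UNIV h" "\<And>x. norm x > R \<Longrightarrow> h x = 0" shows "bbs h"
proof -
  have "bbs (\<lambda>x. indicator (cball 0 R) x * h x)"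
    by (intro bbs_mult_lbb bbs_indicator lbb_continuous assms) auto
  moreover have "(\<lambda>x. indicator (cball 0 R) x * h x) = h"
    using assms(2) by (force simp: indicator_def)
  ultimately show ?thesis by simp
qed

lemma bbs_Pair:
  fixes f :: "'a::euclidean_space \<Rightarrow> real" and g :: "'b::euclidean_space \<Rightarrow> real"
  assumes "bbs f" "bbs g" shows "bbs (\<lambda>(x, y). f x * g y)"
proof -
  obtain B R where f: "B > 0" "R > 0" "\<And>x. \<bar>f x\<bar> \<le> B" "\<And>x. norm x > R \<Longrightarrow> f x = 0"
    by (rule bbsE[OF assms(1)]) blast
  obtain C S where g: "C > 0" "S > 0" "\<And>x. \<bar>g x\<bar> \<le> C" "\<And>x. norm x > S \<Longrightarrow> g x = 0"
    by (rule bbsE[OF assms(2)]) blast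
  have "\<bar>f x * g y\<bar> \<le> B * C" for x y
    using f(1,3) g(1,3) by (auto simp: abs_mult intro!: mult_mono)
  moreover have "f x * g y = 0" if "norm (x, y) > R + S" for x y
  proof -
    have "norm x > R \<or> norm y > S" using that norm_Pair_le[of x y] by linarith
    then show ?thesis using f(4) g(4) by auto
  qed
  moreover have "(\<lambda>(x, y). f x * g y) \<in> borel_measurable borel"
    using assms[THEN bbs_measurable] unfolding borel_prod[symmetric] by measurable
  ultimately show ?thesis unfolding bbs_def by (force simp del: mult_eq_0_iff)
qed

text \<open>This is the integrand of all later pairings. The factors \<open>f\<close> and
  \<open>g\<close> confine both variables, so local boundedness of \<open>h\<close> is
  enough.\<close>

lemma bbs_pair_shift:
  fixes f g h :: "'a::euclidean_space \<Rightarrow> real"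
  assumes "bbs f" "bbs g" "lbb h"
  shows "bbs (\<lambda>(x, z). f x * g z * h (x + s *\<^sub>R z))"
proof -
  have "lbb (\<lambda>w::'a \<times> 'a. h (fst w + s *\<^sub>R snd w))"
    by (intro lbb_compose[OF assms(3)] continuous_intros)
  from bbs_mult_lbb[OF bbs_Pair[OF assms(1,2)] this] show ?thesis
    by (simp add: case_prod_unfold)
qed

section \<open>Fubini, affine substitution and a Hoelder inequality\<close>

lemma Fubini_bbs:
  fixes f :: "'a::euclidean_space \<Rightarrow> 'b::euclidean_space \<Rightarrow> real"
  assumes "bbs (\<lambda>(x, y). f x y)"
  shows "(LBINT x. (LBINT y. f x y)) = (LBINT y. (LBINT x. f x y))"
    and "(LBINT w. f (fst w) (snd w)) = (LBINT x. (LBINT y. f x y))"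
    and "integrable lborel (\<lambda>x. LBINT y. f x y)"
proof -
  have i: "integrable (lborel \<Otimes>\<^sub>M lborel) (\<lambda>(x, y). f x y)"
    using bbs_integrable[OF assms] by (simp add: lborel_prod)
  show "(LBINT x. (LBINT y. f x y)) = (LBINT y. (LBINT x. f x y))"
    using lborel_pair.Fubini_integral[OF i] by simp
  show "(LBINT w. f (fst w) (snd w)) = (LBINT x. (LBINT y. f x y))"
    using lborel_pair.integral_fst[OF i] by (simp add: lborel_prod case_prod_unfold)
  show "integrable lborel (\<lambda>x. LBINT y. f x y)"
    using lborel_pair.integrable_fst[OF i] by simp
qed

lemma integral_lborel_affine:
  fixes f :: "'a::euclidean_space \<Rightarrow> real"
  assumes "s \<noteq> 0" "f \<in> borel_measurable borel"
  shows "(LBINT z. f (y + s *\<^sub>R z)) = (LBINT z. f z) / \<bar>s\<bar> ^ DIM('a)"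
proof -
  have "(LBINT z. f z) = \<bar>s\<bar> ^ DIM('a) * (LBINT z. f (y + s *\<^sub>R z))"
    by (subst lborel_affine[OF assms(1), of y], subst integral_density)
      (use assms(2) in \<open>auto simp: integral_distr\<close>)
  then show ?thesis using assms(1) by (simp add: field_simps)
qed

lemma integral_lborel_shift:
  fixes f :: "'a::euclidean_space \<Rightarrow> real"
  assumes "f \<in> borel_measurable borel"
  shows "(LBINT z. f (z + y)) = (LBINT z. f z)"
  using integral_lborel_affine[of 1 f y] assms by (simp add: add.commute)

text \<open>Hoelder with exponents 3/2 and 3, up to the factor 2, obtained by integrating a
  pointwise Young inequality with a free weight and then choosing the weight.\<close>

lemma integral_square_mult_le:
  fixes a b :: "'a::euclidean_space \<Rightarrow> real"
  assumes a: "bbs a" "\<And>x. a x \<ge> 0" and b: "bbs b" "\<And>x. b x \<ge> 0"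
    and \<alpha>: "(LBINT x. a x ^ 3) \<le> \<alpha> ^ 3" "\<alpha> \<ge> 0"
    and \<beta>: "(LBINT x. b x ^ 3) \<le> \<beta> ^ 3" "\<beta> \<ge> 0"
  shows "(LBINT x. (a x)\<^sup>2 * b x) \<le> 2 * \<alpha>\<^sup>2 * \<beta>"
proof -
  \<comment> \<open>Whichever of \<open>t\<close> and \<open>l * s\<close> is smaller, replacing one
    factor by the other gives one of the two summands.\<close>
  have young: "s\<^sup>2 * t \<le> l * s ^ 3 + t ^ 3 / l\<^sup>2" if "s \<ge> 0" "t \<ge> 0" "l > 0" for s t l :: real
  proof (cases "t \<le> l * s")
    case True
    then have "s\<^sup>2 * t \<le> s\<^sup>2 * (l * s)" by (intro mult_left_mono) auto
    also have "\<dots> = l * s ^ 3" by (simp add: power2_eq_square power3_eq_cube)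
    finally show ?thesis using that by (smt (verit) divide_nonneg_nonneg zero_le_power)
  next
    case False
    then have "s \<le> t / l" using that by (simp add: field_simps)
    then have "s\<^sup>2 * t \<le> (t / l)\<^sup>2 * t" using that by (intro mult_right_mono power_mono) auto
    also have "\<dots> = t ^ 3 / l\<^sup>2" by (simp add: power2_eq_square power3_eq_cube)
    finally show ?thesis using that by (smt (verit) mult_nonneg_nonneg zero_le_power)
  qed
  have ia: "integrable lborel (\<lambda>x. a x ^ 3)" and ib: "integrable lborel (\<lambda>x. b x ^ 3)"
    by (intro bbs_integrable bbs_power a b; simp)+
  \<comment> \<open>The shift by \<open>e\<close> keeps the weight defined and positive when
    \<open>\<alpha>\<close> or \<open>\<beta>\<close> is 0; it is removed by a limit at the
    end.\<close>
  have pert: "(LBINT x. (a x)\<^sup>2 * b x) \<le> 2 * (\<alpha> + e)\<^sup>2 * (\<beta> + e)" if "e > 0" for e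
  proof -
    \<comment> \<open>This weight makes the two summands equal, which is where the factor 2 comes
      from.\<close>
    define l where "l = (\<beta> + e) / (\<alpha> + e)"
    have l: "l > 0" using that \<alpha> \<beta> by (simp add: l_def)
    have "(LBINT x. (a x)\<^sup>2 * b x) \<le> (LBINT x. l * a x ^ 3 + b x ^ 3 / l\<^sup>2)"
      by (intro integral_mono bbs_integrable bbs_mult_lbb bbs_power a bbs_imp_lbb b
          Bochner_Integration.integrable_add integrable_mult_right integrable_divide ia ib young l) auto
    also have "\<dots> = l * (LBINT x. a x ^ 3) + (LBINT x. b x ^ 3) / l\<^sup>2"
      using ia ib by simp
    also have "\<dots> \<le> l * (\<alpha> + e) ^ 3 + (\<beta> + e) ^ 3 / l\<^sup>2"
      using \<alpha> \<beta> that l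
      by (intro add_mono mult_left_mono divide_right_mono order_trans[OF \<alpha>(1)]
          order_trans[OF \<beta>(1)] power_mono) auto
    also have "\<dots> = 2 * (\<alpha> + e)\<^sup>2 * (\<beta> + e)"
    proof -
      have "l * (\<alpha> + e) ^ 3 = (\<alpha> + e)\<^sup>2 * (\<beta> + e)" "(\<beta> + e) ^ 3 / l\<^sup>2 = (\<alpha> + e)\<^sup>2 * (\<beta> + e)"
        using that \<alpha> \<beta> by (auto simp: l_def power2_eq_square power3_eq_cube divide_simps)
      then show ?thesis by simp
    qed
    finally show ?thesis .
  qed
  have "((\<lambda>e. 2 * (\<alpha> + e)\<^sup>2 * (\<beta> + e)) \<longlongrightarrow> 2 * (\<alpha> + 0)\<^sup>2 * (\<beta> + 0)) (at_right 0)"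
    by (intro tendsto_intros)
  moreover have "eventually (\<lambda>e. (LBINT x. (a x)\<^sup>2 * b x) \<le> 2 * (\<alpha> + e)\<^sup>2 * (\<beta> + e)) (at_right 0)"
    using pert by (auto simp: eventually_at_filter)
  ultimately show ?thesis
    by (intro tendsto_lowerbound[where F = "at_right 0"]) auto
qed

section \<open>Continuously differentiable functions and integration by parts\<close>

text \<open>The partial derivatives are carried as an explicit argument, so that the rules below
  compute them symbolically and equations between them can be used without evaluating a Frechet
  derivative.\<close>

definition C1_grad :: "(real^3 \<Rightarrow> 'b::real_normed_vector) \<Rightarrow> (3 \<Rightarrow> real^3 \<Rightarrow> 'b) \<Rightarrow> bool" where
  "C1_grad f f' \<longleftrightarrow> (\<forall>x. (f has_derivative (\<lambda>h. \<Sum>j\<in>UNIV. h $ j *\<^sub>R f' j x)) (at x)) \<and>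
     (\<forall>j. continuous_on UNIV (f' j))"

lemma C1_gradD: "C1_grad f f' \<Longrightarrow> (f has_derivative (\<lambda>h. \<Sum>j\<in>UNIV. h $ j *\<^sub>R f' j x)) (at x)"
  by (simp add: C1_grad_def)

lemma C1_grad_continuous: "C1_grad f f' \<Longrightarrow> continuous_on UNIV f"
  by (meson C1_gradD continuous_at_imp_continuous_on has_derivative_continuous)

lemma C1_grad_partial_continuous: "C1_grad f f' \<Longrightarrow> continuous_on UNIV (f' j)"
  by (simp add: C1_grad_def)

lemma C1_gradI:
  assumes "\<And>x. (f has_derivative f'' x) (at x)"
    and "\<And>x h. f'' x h = (\<Sum>j\<in>UNIV. h $ j *\<^sub>R f' j x)"
    and "\<And>j. continuous_on UNIV (f' j)"
  shows "C1_grad f f'"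
proof -
  have "f'' x = (\<lambda>h. \<Sum>j\<in>UNIV. h $ j *\<^sub>R f' j x)" for x using assms(2) by auto
  with assms(1,3) show ?thesis unfolding C1_grad_def by metis
qed

lemma C1_grad_linear:
  assumes "bounded_linear T" "C1_grad f f'"
  shows "C1_grad (\<lambda>x. T (f x)) (\<lambda>j x. T (f' j x))"
proof (rule C1_gradI)
  show "((\<lambda>x. T (f x)) has_derivative (\<lambda>h. T (\<Sum>j\<in>UNIV. h $ j *\<^sub>R f' j x))) (at x)" for x
    by (rule bounded_linear.has_derivative[OF assms(1) C1_gradD[OF assms(2)]])
  show "T (\<Sum>j\<in>UNIV. h $ j *\<^sub>R f' j x) = (\<Sum>j\<in>UNIV. h $ j *\<^sub>R T (f' j x))" for x h
    using assms(1) by (simp add: linear_sum linear_cmul bounded_linear.linear)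
  show "continuous_on UNIV (\<lambda>x. T (f' j x))" for j
    by (intro bounded_linear.continuous_on[OF assms(1)] C1_grad_partial_continuous[OF assms(2)])
qed

lemmas C1_grad_nth = C1_grad_linear[OF bounded_linear_vec_nth]
lemmas C1_grad_cmult = C1_grad_linear[OF bounded_linear_mult_right]

lemma C1_grad_bilinear:
  assumes "bounded_bilinear B" "C1_grad f f'" "C1_grad g g'"
  shows "C1_grad (\<lambda>x. B (f x) (g x)) (\<lambda>j x. B (f' j x) (g x) + B (f x) (g' j x))"
proof (rule C1_gradI)
  interpret bounded_bilinear B by fact
  show "((\<lambda>x. B (f x) (g x)) has_derivative (\<lambda>h. B (f x) (\<Sum>j\<in>UNIV. h $ j *\<^sub>R g' j x) +
      B (\<Sum>j\<in>UNIV. h $ j *\<^sub>R f' j x) (g x))) (at x)" for x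
    by (intro FDERIV C1_gradD assms)
  show "B (f x) (\<Sum>j\<in>UNIV. h $ j *\<^sub>R g' j x) + B (\<Sum>j\<in>UNIV. h $ j *\<^sub>R f' j x) (g x) =
     (\<Sum>j\<in>UNIV. h $ j *\<^sub>R (B (f' j x) (g x) + B (f x) (g' j x)))" for x h
    by (simp add: sum_left sum_right scaleR_left scaleR_right scaleR_add_right sum.distrib add.commute)
  show "continuous_on UNIV (\<lambda>x. B (f' j x) (g x) + B (f x) (g' j x))" for j
    using assms(2,3) by (intro continuous_intros continuous_on
      C1_grad_partial_continuous C1_grad_continuous)
qed

lemmas C1_grad_mult = C1_grad_bilinear[OF bounded_bilinear_mult]
lemmas C1_grad_inner = C1_grad_bilinear[OF bounded_bilinear_inner]

lemma C1_grad_add: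
  assumes "C1_grad f f'" "C1_grad g g'"
  shows "C1_grad (\<lambda>x. f x + g x) (\<lambda>j x. f' j x + g' j x)"
proof (rule C1_gradI)
  show "((\<lambda>x. f x + g x) has_derivative (\<lambda>h. (\<Sum>j\<in>UNIV. h $ j *\<^sub>R f' j x) +
      (\<Sum>j\<in>UNIV. h $ j *\<^sub>R g' j x))) (at x)" for x
    by (intro has_derivative_add C1_gradD assms)
  show "continuous_on UNIV (\<lambda>x. f' j x + g' j x)" for j
    using assms by (intro continuous_intros C1_grad_partial_continuous)
qed (simp add: scaleR_add_right sum.distrib)

lemma C1_grad_const: "C1_grad (\<lambda>x. c) (\<lambda>j x. 0)"
  by (rule C1_gradI) (auto intro: has_derivative_const)

lemma C1_grad_sum:
  "(\<And>i. i \<in> I \<Longrightarrow> C1_grad (f i) (f' i)) \<Longrightarrow>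
    C1_grad (\<lambda>x. \<Sum>i\<in>I. f i x) (\<lambda>j x. \<Sum>i\<in>I. f' i j x)"
  by (induction I rule: infinite_finite_induct) (auto intro: C1_grad_const C1_grad_add)

lemma C1_grad_affine:
  assumes "C1_grad f f'"
  shows "C1_grad (\<lambda>z. f (x + s *\<^sub>R z)) (\<lambda>j z. s *\<^sub>R f' j (x + s *\<^sub>R z))"
proof (rule C1_gradI)
  show "((\<lambda>z. f (x + s *\<^sub>R z)) has_derivative
      (\<lambda>h. \<Sum>j\<in>UNIV. (s *\<^sub>R h) $ j *\<^sub>R f' j (x + s *\<^sub>R z))) (at z)" for z
    by (rule has_derivative_compose[OF _ C1_gradD[OF assms]]) (auto intro!: derivative_eq_intros)
  show "continuous_on UNIV (\<lambda>z. s *\<^sub>R f' j (x + s *\<^sub>R z))" for j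
    using C1_grad_partial_continuous[OF assms]
    by (intro continuous_intros) (auto intro!: continuous_on_compose2[where f="\<lambda>z. x + s *\<^sub>R z"] continuous_intros)
qed (simp add: ac_simps)

lemma C1_grad_line:
  fixes f :: "real^3 \<Rightarrow> real"
  assumes "C1_grad f f'"
  shows "((\<lambda>s. f (x + s *\<^sub>R z)) has_real_derivative (\<Sum>j\<in>UNIV. z $ j * f' j (x + s *\<^sub>R z))) (at s)"
proof -
  have "((\<lambda>s. f (x + s *\<^sub>R z)) has_derivative
      (\<lambda>h. \<Sum>j\<in>UNIV. (h *\<^sub>R z) $ j *\<^sub>R f' j (x + s *\<^sub>R z))) (at s)"
    by (rule has_derivative_compose[OF _ C1_gradD[OF assms]]) (auto intro!: derivative_eq_intros)
  moreover have "(\<lambda>h. \<Sum>j\<in>UNIV. (h *\<^sub>R z) $ j *\<^sub>R f' j (x + s *\<^sub>R z)) =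
      (*) (\<Sum>j\<in>UNIV. z $ j * f' j (x + s *\<^sub>R z))"
    by (auto simp: sum_distrib_left sum_distrib_right ac_simps)
  ultimately show ?thesis by (simp add: has_field_derivative_def)
qed

text \<open>Differentiation is local; this passes support conditions on to the partial
  derivatives.\<close>

lemma C1_grad_eq_0:
  fixes f :: "real^3 \<Rightarrow> 'b::real_normed_vector"
  assumes "C1_grad f f'" "open U" "x \<in> U" "\<And>y. y \<in> U \<Longrightarrow> f y = 0"
  shows "f' j x = 0"
proof -
  have "((\<lambda>_. 0) has_derivative (\<lambda>h. \<Sum>j\<in>UNIV. h $ j *\<^sub>R f' j x)) (at x)"
    by (rule has_derivative_transform_within_open[OF C1_gradD[OF assms(1)] assms(2,3)])
      (use assms(4) in auto)
  then have "(\<lambda>h. \<Sum>j\<in>UNIV. h $ j *\<^sub>R f' j x) = (\<lambda>_. 0)"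
    using has_derivative_unique has_derivative_const by blast
  from fun_cong[OF this, of "axis j 1"] have "(\<Sum>i\<in>UNIV. axis j 1 $ i *\<^sub>R f' i x) = 0" .
  moreover have "(\<Sum>i\<in>UNIV. axis j (1::real) $ i *\<^sub>R f' i x) = (\<Sum>i\<in>UNIV. if i = j then f' i x else 0)"
    by (intro sum.cong) (auto simp: axis_def)
  ultimately show ?thesis by simp
qed

section \<open>Differentiation under the integral and integration by parts\<close>

lemma has_real_derivative_integral:
  fixes F F' :: "real \<Rightarrow> 'a::euclidean_space \<Rightarrow> real"
  assumes int: "\<And>s. integrable lborel (F s)"
    and der: "\<And>s x. ((\<lambda>s. F s x) has_real_derivative F' s x) (at s)"
    and bound: "\<And>s x. \<bar>s - t\<bar> \<le> 1 \<Longrightarrow> \<bar>F' s x\<bar> \<le> B x"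
    and B: "integrable lborel B" and meas: "F' t \<in> borel_measurable borel"
  shows "((\<lambda>s. LBINT x. F s x) has_real_derivative (LBINT x. F' t x)) (at t)"
  unfolding DERIV_def tendsto_at_iff_sequentially
proof (intro allI impI)
  fix X :: "nat \<Rightarrow> real"
  assume X: "\<forall>i. X i \<in> UNIV - {0}" "X \<longlonglongrightarrow> 0"
  then have "\<forall>\<^sub>F n in sequentially. \<bar>X n\<bar> < 1"
    using tendstoD[of X 0 sequentially 1] by auto
  \<comment> \<open>The bound \<open>B\<close> is available for \<open>s\<close> within distance 1
    of \<open>t\<close>, so dominated convergence is applied to the tail of the sequence.\<close>
  then obtain N where N: "\<And>n. n \<ge> N \<Longrightarrow> \<bar>X n\<bar> < 1"
    by (auto simp: eventually_sequentially)
  define q where "q n x = (F (t + X n) x - F t x) / X n" for n x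
  have q_bound: "\<bar>q n x\<bar> \<le> B x" if "n \<ge> N" for n x
  proof -
    \<comment> \<open>The mean value inequality turns the bound on the derivative into a bound on
      the difference quotient.\<close>
    have "norm (F (t + X n) x - F t x) \<le> B x * norm (t + X n - t)"
    proof (rule field_differentiable_bound[of "{t - 1..t + 1}" "\<lambda>s. F s x" "\<lambda>s. F' s x"])
      show "((\<lambda>s. F s x) has_real_derivative F' s x) (at s within {t - 1..t + 1})" for s
        by (rule has_field_derivative_at_within[OF der])
      show "norm (F' s x) \<le> B x" if "s \<in> {t - 1..t + 1}" for s
        using bound[of s x] that by (auto simp: abs_le_iff)
      show "t + X n \<in> {t - 1..t + 1}" using N[OF that] by (auto simp: abs_less_iff)
    qed auto
    then show ?thesis using X(1) by (auto simp: q_def abs_divide divide_le_eq)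
  qed
  have "(\<lambda>n. LBINT x. q (n + N) x) \<longlonglongrightarrow> (LBINT x. F' t x)"
  proof (rule integral_dominated_convergence)
    show "AE x in lborel. (\<lambda>n. q (n + N) x) \<longlonglongrightarrow> F' t x"
    proof (intro AE_I2 LIMSEQ_ignore_initial_segment)
      fix x
      have "((\<lambda>h. (F (t + h) x - F t x) / h) \<longlongrightarrow> F' t x) (at 0)"
        using der[of x t] by (simp add: DERIV_def)
      then show "(\<lambda>n. q n x) \<longlonglongrightarrow> F' t x"
        using X unfolding tendsto_at_iff_sequentially q_def o_def by blast
    qed
    show "AE x in lborel. norm (q (n + N) x) \<le> B x" for n using q_bound by auto
  qed (use int[THEN borel_measurable_integrable] B meas in \<open>auto simp: q_def\<close>)
  then have "(\<lambda>n. LBINT x. q n x) \<longlonglongrightarrow> (LBINT x. F' t x)" by (rule LIMSEQ_offset)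
  moreover have "(LBINT x. q n x) = ((LBINT x. F (t + X n) x) - (LBINT x. F t x)) / X n" for n
    unfolding q_def using int by simp
  ultimately show "((\<lambda>h. ((LBINT x. F (t + h) x) - (LBINT x. F t x)) / h) \<circ> X)
      \<longlonglongrightarrow> (LBINT x. F' t x)"
    by (simp add: o_def)
qed

text \<open>Translating along an axis does not change the integral of \<open>h\<close>, and its
  derivative in the translation length is the integral of the partial derivative.\<close>

lemma integral_partial_eq_0:
  fixes h :: "real^3 \<Rightarrow> real"
  assumes C1: "C1_grad h h'" and supp: "\<And>x. norm x > R \<Longrightarrow> h x = 0"
  shows "(LBINT x. h' j x) = 0"
proof -
  let ?e = "axis j (1::real) :: real^3"
  have cont: "continuous_on UNIV h" "continuous_on UNIV (h' j)"
    using C1 by (auto intro: C1_grad_continuous C1_grad_partial_continuous)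
  have [measurable]: "h \<in> borel_measurable borel" using cont(1) by (rule borel_measurable_continuous_onI)
  have supp': "h' j x = 0" if "norm x > R" for x
    by (rule C1_grad_eq_0[OF C1, of "- cball 0 R"]) (use that supp in auto)
  obtain C where C: "\<And>x. \<bar>h' j x\<bar> \<le> C"
    using bbsE[OF bbs_continuous[of "h' j" R]] cont(2) supp' by metis
  have bh: "bbs h" by (rule bbs_continuous[OF cont(1) supp])
  have "((\<lambda>s. LBINT x. h (x + s *\<^sub>R ?e)) has_real_derivative
      (LBINT x. h' j (x + 0 *\<^sub>R ?e))) (at 0)"
  proof (rule has_real_derivative_integral[where B = "\<lambda>x. C * indicator (cball 0 (R + 1)) x"])
    show "integrable lborel (\<lambda>x. h (x + s *\<^sub>R ?e))" for s
    proof (rule bbs_integrable, rule bbs_continuous)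
      show "continuous_on UNIV (\<lambda>x. h (x + s *\<^sub>R ?e))"
        by (intro continuous_on_compose2[OF cont(1)] continuous_intros) auto
      show "h (x + s *\<^sub>R ?e) = 0" if "norm x > R + \<bar>s\<bar>" for x
      proof (rule supp)
        have "norm x \<le> norm (x + s *\<^sub>R ?e) + norm (s *\<^sub>R ?e)"
          using norm_triangle_ineq4[of "x + s *\<^sub>R ?e" "s *\<^sub>R ?e"] by simp
        then show "norm (x + s *\<^sub>R ?e) > R" using that by simp
      qed
    qed
    have "(\<Sum>i\<in>UNIV. ?e $ i * h' i y) = h' j y" for y
    proof -
      have "(\<Sum>i\<in>UNIV. ?e $ i * h' i y) = (\<Sum>i\<in>UNIV. if i = j then h' i y else 0)"
        by (intro sum.cong) (auto simp: axis_def)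
      then show ?thesis by simp
    qed
    with C1_grad_line[OF C1, of _ ?e]
    show "((\<lambda>s. h (x + s *\<^sub>R ?e)) has_real_derivative h' j (x + s *\<^sub>R ?e)) (at s)" for s x by simp
    \<comment> \<open>For translations of length at most 1 the support stays in the ball of radius
      \<open>R + 1\<close>, which gives an integrable majorant.\<close>
    show "\<bar>h' j (x + s *\<^sub>R ?e)\<bar> \<le> C * indicator (cball 0 (R + 1)) x" if "\<bar>s - 0\<bar> \<le> 1" for s x
    proof (cases "norm x \<le> R + 1")
      case True
      then show ?thesis using C by simp
    next
      case False
      have "norm x \<le> norm (x + s *\<^sub>R ?e) + norm (s *\<^sub>R ?e)"
        using norm_triangle_ineq4[of "x + s *\<^sub>R ?e" "s *\<^sub>R ?e"] by simp
      then have "norm (x + s *\<^sub>R ?e) > R" using False that by simp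
      then show ?thesis using supp' False by simp
    qed
    show "integrable lborel (\<lambda>x. C * indicator (cball 0 (R + 1)) x)"
      by (intro bbs_integrable bbs_cmult bbs_indicator) auto
    show "(\<lambda>x. h' j (x + 0 *\<^sub>R ?e)) \<in> borel_measurable borel"
      using cont(2) by (simp add: borel_measurable_continuous_onI)
  qed
  moreover have "(LBINT x. h (x + s *\<^sub>R ?e)) = (LBINT x. h x)" for s
    by (rule integral_lborel_shift) simp
  ultimately have "((\<lambda>s::real. LBINT x. h x) has_real_derivative (LBINT x. h' j x)) (at 0)"
    by simp
  then show ?thesis using DERIV_const DERIV_unique by blast
qed

lemma integral_by_parts:
  fixes a b :: "real^3 \<Rightarrow> real"
  assumes a: "C1_grad a a'" "\<And>x. norm x > R \<Longrightarrow> a x = 0" and b: "C1_grad b b'"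
  shows "(LBINT x. a' j x * b x) = - (LBINT x. a x * b' j x)"
proof -
  have supp': "a' j x = 0" if "norm x > R" for x
    by (rule C1_grad_eq_0[OF a(1), of "- cball 0 R"]) (use that a(2) in auto)
  have "(LBINT x. a' j x * b x + a x * b' j x) = 0"
    by (rule integral_partial_eq_0[OF C1_grad_mult[OF a(1) b], of R]) (use a in auto)
  moreover have "integrable lborel (\<lambda>x. a' j x * b x)" "integrable lborel (\<lambda>x. a x * b' j x)"
    by (intro bbs_integrable bbs_mult_lbb lbb_continuous bbs_continuous[where R = R]
      C1_grad_partial_continuous[OF a(1)] C1_grad_partial_continuous[OF b]
      C1_grad_continuous[OF a(1)] C1_grad_continuous[OF b] a supp'; assumption)+
  ultimately show ?thesis by simp
qed

section \<open>Averages over balls\<close>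

lemma integral_eq_0_continuous:
  fixes f :: "'a::euclidean_space \<Rightarrow> real"
  assumes int: "integrable lborel f" "(LBINT x. f x) = 0"
    and cont: "continuous_on UNIV f" and nonneg: "\<And>x. f x \<ge> 0"
  shows "f x = 0"
proof (rule ccontr)
  assume "f x \<noteq> 0"
  then have pos: "f x / 2 > 0" using nonneg[of x] by simp
  have "isCont f x" using cont by (simp add: continuous_on_eq_continuous_at)
  from this[unfolded continuous_at_eps_delta, rule_format, OF pos]
  obtain d where d: "d > 0" "\<And>y. dist y x < d \<Longrightarrow> dist (f y) (f x) < f x / 2" by blast
  have "f x / 2 * indicator (ball x d) y \<le> f y" for y
  proof (cases "y \<in> ball x d")
    case True
    then have "\<bar>f y - f x\<bar> < f x / 2" using d(2)[of y] unfolding dist_real_def by (simp add: dist_commute)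
    then have "f x / 2 \<le> f y" by arith
    then show ?thesis using True by simp
  next
    case False
    then show ?thesis using nonneg[of y] by simp
  qed
  then have "(LBINT y. f x / 2 * indicator (ball x d) y) \<le> (LBINT y. f y)"
    by (intro integral_mono int bbs_integrable bbs_cmult bbs_indicator) auto
  then have "f x / 2 * measure lborel (ball x d) \<le> 0" using int(2) by simp
  moreover have "measure lborel (ball x d) > 0" using content_ball_pos[OF d(1)] .
  ultimately show False using pos by (simp add: mult_le_0_iff)
qed

section \<open>Polynomial bump kernels\<close>

definition bump :: "nat \<Rightarrow> real^3 \<Rightarrow> real" where
  "bump m z = (max 0 (1 - z \<bullet> z)) ^ m"

lemma bump_eq_0: "norm z \<ge> 1 \<Longrightarrow> m > 0 \<Longrightarrow> bump m z = 0"
  using power_mono[of 1 "norm z" 2] by (simp add: bump_def power2_norm_eq_inner)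

lemma continuous_bump: "continuous_on UNIV (bump m)"
  unfolding bump_def by (intro continuous_intros)

lemma bbs_bump: "m > 0 \<Longrightarrow> bbs (bump m)"
  by (rule bbs_continuous[OF continuous_bump, of 1]) (simp add: bump_eq_0)

lemma bump_nonneg: "bump m z \<ge> 0"
  by (simp add: bump_def)

lemma bump_le_1: "bump m z \<le> 1"
  unfolding bump_def by (intro power_le_one) auto

lemma bump_le_indicator: "m > 0 \<Longrightarrow> bump m z \<le> indicator (cball 0 1) z"
  using bump_le_1[of m z] bump_eq_0[of z m] by (auto simp: indicator_def)

lemma DERIV_max_0_power:
  "((\<lambda>t::real. (max 0 t) ^ Suc (Suc n)) has_real_derivative (real (Suc (Suc n)) * (max 0 t) ^ Suc n)) (at t)"
proof -
  consider "t > 0" | "t < 0" | "t = 0" by linarith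
  then show ?thesis
  proof cases
    case 1
    have "((\<lambda>t. t ^ Suc (Suc n)) has_real_derivative (real (Suc (Suc n)) * (max 0 t) ^ Suc n)) (at t)"
      using 1 DERIV_pow[of "Suc (Suc n)" t] by (simp add: max_def)
    then show ?thesis
      by (rule DERIV_cong_ev[THEN iffD1, rotated -1])
        (use 1 in \<open>auto simp: eventually_nhds intro!: exI[of _ "{0<..}"]\<close>)
  next
    case 2
    have "((\<lambda>t. 0) has_real_derivative (real (Suc (Suc n)) * (max 0 t) ^ Suc n)) (at t)"
      using 2 by (auto simp: max_def)
    then show ?thesis
      by (rule DERIV_cong_ev[THEN iffD1, rotated -1])
        (use 2 in \<open>auto simp: eventually_nhds intro!: exI[of _ "{..<0}"]\<close>)
  next
    \<comment> \<open>At the kink the difference quotient is at most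
      \<open>(max 0 h) ^ Suc n\<close>, whose exponent is still positive; this is why the power must
      be at least 2.\<close>
    case 3
    have "((\<lambda>h. (max 0 h) ^ Suc (Suc n) / h) \<longlongrightarrow> 0) (at (0::real))"
    proof (rule Lim_null_comparison)
      show "\<forall>\<^sub>F h in at 0. norm ((max 0 h) ^ Suc (Suc n) / h) \<le> (max 0 h) ^ Suc n"
        by (intro always_eventually allI) (auto simp: max_def)
      show "((\<lambda>h. (max 0 h) ^ Suc n) \<longlongrightarrow> 0) (at (0::real))"
        by (rule tendsto_eq_intros tendsto_max tendsto_ident_at refl | simp)+
    qed
    then show ?thesis using 3 by (simp add: DERIV_def)
  qed
qed

text \<open>Each derivative lowers the exponent by one, so finitely many derivatives of a bump are
  explicit and every later kernel bound is a number.\<close>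

lemma C1_grad_bump:
  "C1_grad (bump (Suc (Suc m))) (\<lambda>j z. - 2 * real (Suc (Suc m)) * z $ j * bump (Suc m) z)"
proof (rule C1_gradI)
  let ?n = "Suc (Suc m)"
  fix z :: "real^3"
  have "((\<lambda>z::real^3. 1 - z \<bullet> z) has_derivative (\<lambda>h. - (z \<bullet> h + h \<bullet> z))) (at z)"
    by (auto intro!: derivative_eq_intros)
  from has_derivative_compose[OF this DERIV_max_0_power[of m, unfolded has_field_derivative_def]]
  show "(bump ?n has_derivative
      (\<lambda>h. real ?n * (max 0 (1 - z \<bullet> z)) ^ Suc m * (- (z \<bullet> h + h \<bullet> z)))) (at z)"
    unfolding bump_def .
  show "real ?n * (max 0 (1 - z \<bullet> z)) ^ Suc m * (- (z \<bullet> h + h \<bullet> z)) =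
      (\<Sum>j\<in>UNIV. h $ j *\<^sub>R (- 2 * real ?n * z $ j * bump (Suc m) z))" for h
  proof -
    have "(\<Sum>j\<in>UNIV. h $ j *\<^sub>R (- 2 * real ?n * z $ j * bump (Suc m) z)) =
        - 2 * real ?n * bump (Suc m) z * (\<Sum>j\<in>UNIV. h $ j * z $ j)"
      by (simp add: sum_distrib_left sum_distrib_right ac_simps)
    also have "(\<Sum>j\<in>UNIV. h $ j * z $ j) = h \<bullet> z" by (simp add: inner_vec_def)
    finally show ?thesis by (simp add: bump_def inner_commute algebra_simps)
  qed
  show "continuous_on UNIV (\<lambda>z. - 2 * real ?n * z $ j * bump (Suc m) z)" for j
    by (intro continuous_intros continuous_bump)
qed

lemma integral_bump_pos: "m > 0 \<Longrightarrow> (LBINT z. bump m z) > 0"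
proof (rule ccontr)
  assume m: "m > 0" and "\<not> (LBINT z. bump m z) > 0"
  moreover have "(LBINT z. bump m z) \<ge> 0" by (simp add: bump_nonneg)
  ultimately have "(LBINT z. bump m z) = 0" by linarith
  then have "bump m 0 = 0"
    using integral_eq_0_continuous[OF bbs_integrable[OF bbs_bump[OF m]] _ continuous_bump bump_nonneg] by simp
  then show False by (simp add: bump_def)
qed

text \<open>The unnormalised mean over the ball of radius \<open>\<bar>s\<bar>\<close> about
  \<open>y\<close>. Integrating over the unit ball keeps the total weight independent of
  \<open>s\<close> and gives sense to \<open>s = 0\<close> and to the negative scales that arise
  after swapping variables.\<close>

definition ball_sum :: "real \<Rightarrow> (real^3 \<Rightarrow> real) \<Rightarrow> real^3 \<Rightarrow> real" where
  "ball_sum s h y = (LBINT z. indicator (cball 0 1) z * h (y + s *\<^sub>R z))"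

lemma bbs_unit_ball: "bbs (indicator (cball (0::real^3) 1))"
  by (intro bbs_indicator) auto

lemma integrable_ball_sum:
  fixes h :: "real^3 \<Rightarrow> real"
  shows "lbb h \<Longrightarrow> integrable lborel (\<lambda>z. indicator (cball 0 1) z * h (y + s *\<^sub>R z))"
  using bbs_integrable[OF bbs_mult_lbb[OF bbs_unit_ball lbb_compose[of h "\<lambda>z. y + s *\<^sub>R z"]]]
  by (simp add: continuous_on_add continuous_on_scaleR continuous_on_id)

lemma ball_sum_nonneg: "(\<And>x. h x \<ge> 0) \<Longrightarrow> ball_sum s h y \<ge> 0"
  unfolding ball_sum_def by (intro integral_nonneg_AE) auto

lemma integral_le_ball_sum:
  assumes "lbb h" "f \<in> borel_measurable borel"
    and "\<And>z. \<bar>f z\<bar> \<le> c * (indicator (cball 0 1) z * h (y + s *\<^sub>R z))"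
  shows "\<bar>LBINT z. f z\<bar> \<le> c * ball_sum s h y"
proof -
  have i: "integrable lborel (\<lambda>z. c * (indicator (cball 0 1) z * h (y + s *\<^sub>R z)))"
    by (intro integrable_mult_right integrable_ball_sum assms)
  have "integrable lborel f"
    by (rule Bochner_Integration.integrable_bound[OF i]) (use assms in \<open>auto intro!: AE_I2 order_trans[OF _ abs_ge_self]\<close>)
  then have "\<bar>LBINT z. f z\<bar> \<le> (LBINT z. c * (indicator (cball 0 1) z * h (y + s *\<^sub>R z)))"
    using integral_mono[OF integrable_norm[OF \<open>integrable lborel f\<close>] i] assms(3)
    by (intro order_trans[OF integral_abs_bound]) auto
  then show ?thesis by (simp add: ball_sum_def)
qed

lemma bbs_ball_sum_pair:
  assumes "bbs h" shows "bbs (\<lambda>(y, z). indicator (cball (0::real^3) 1) z * h (y + s *\<^sub>R z))"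
proof -
  obtain B R where h: "B > 0" "R > 0" "\<And>x. \<bar>h x\<bar> \<le> B" "\<And>x. norm x > R \<Longrightarrow> h x = 0"
    by (rule bbsE[OF assms]) blast
  \<comment> \<open>The added indicator supplies bounded support in \<open>y\<close>. It changes
    nothing, since \<open>h (y + s *\<^sub>R z)\<close> vanishes for larger \<open>y\<close> when
    \<open>z\<close> is in the unit ball.\<close>
  have "bbs (\<lambda>(y, z). indicator (cball 0 (R + \<bar>s\<bar>)) y * indicator (cball 0 1) z * h (y + s *\<^sub>R z))"
    by (intro bbs_pair_shift bbs_indicator bbs_imp_lbb[OF assms]) auto
  moreover have "indicator (cball 0 (R + \<bar>s\<bar>)) y * indicator (cball 0 1) z * h (y + s *\<^sub>R z) =
      indicator (cball 0 1) z * h (y + s *\<^sub>R z)" for y z :: "real^3"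
  proof (cases "norm y \<le> R + \<bar>s\<bar> \<or> norm z > 1")
    case False
    have "norm y \<le> norm (y + s *\<^sub>R z) + norm (s *\<^sub>R z)"
      using norm_triangle_ineq4[of "y + s *\<^sub>R z" "s *\<^sub>R z"] by simp
    moreover have "norm (s *\<^sub>R z) \<le> \<bar>s\<bar>" using False by (simp add: mult_left_le)
    ultimately have "norm (y + s *\<^sub>R z) > R" using False by linarith
    then show ?thesis using h(4) by simp
  qed (auto simp: indicator_def)
  ultimately show ?thesis by simp
qed

lemma bbs_ball_sum:
  assumes "bbs h" shows "bbs (ball_sum s h)"
proof -
  obtain B R where h: "B > 0" "R > 0" "\<And>x. \<bar>h x\<bar> \<le> B" "\<And>x. norm x > R \<Longrightarrow> h x = 0"
    by (rule bbsE[OF assms]) blast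
  let ?\<omega> = "LBINT z. indicator (cball (0::real^3) 1) z * B"
  have "ball_sum s h \<in> borel_measurable borel"
    using borel_measurable_integrable[OF Fubini_bbs(3)[OF bbs_ball_sum_pair[OF assms, of s]]]
    by (simp add: ball_sum_def[abs_def])
  moreover have "\<bar>ball_sum s h y\<bar> \<le> ?\<omega>" for y
  proof -
    have "\<bar>ball_sum s h y\<bar> \<le> (LBINT z. \<bar>indicator (cball 0 1) z * h (y + s *\<^sub>R z)\<bar>)"
      unfolding ball_sum_def by (rule integral_abs_bound)
    also have "\<dots> \<le> ?\<omega>"
      using h(3) by (intro integral_mono integrable_abs integrable_ball_sum bbs_imp_lbb[OF assms]
        bbs_integrable bbs_mult_lbb bbs_unit_ball lbb_const) (auto simp: indicator_def)
    finally show ?thesis .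
  qed
  moreover have "ball_sum s h y = 0" if y: "norm y > R + \<bar>s\<bar>" for y
  proof -
    have eq: "indicator (cball 0 1) z * h (y + s *\<^sub>R z) = 0" for z :: "real^3"
    proof (cases "norm z \<le> 1")
      case True
      have "norm y \<le> norm (y + s *\<^sub>R z) + norm (s *\<^sub>R z)"
        using norm_triangle_ineq4[of "y + s *\<^sub>R z" "s *\<^sub>R z"] by simp
      moreover have "norm (s *\<^sub>R z) \<le> \<bar>s\<bar>" using True by (simp add: mult_left_le)
      ultimately have "norm (y + s *\<^sub>R z) > R" using y by linarith
      then show ?thesis using h(4) by simp
    qed simp
    show ?thesis unfolding ball_sum_def eq by simp
  qed
  ultimately show ?thesis unfolding bbs_def by blast
qed

lemma integral_ball_sum:
  assumes "bbs h"
  shows "(LBINT y. ball_sum s h y) = measure lborel (cball (0::real^3) 1) * (LBINT x. h x)"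
proof -
  have "(LBINT y. ball_sum s h y) =
      (LBINT z. (LBINT y. indicator (cball 0 1) z * h (y + s *\<^sub>R z)))"
    unfolding ball_sum_def by (rule Fubini_bbs(1)[OF bbs_ball_sum_pair[OF assms]])
  also have "\<dots> = (LBINT z. indicator (cball (0::real^3) 1) z * (LBINT x. h x))"
    by (simp add: integral_lborel_shift[OF bbs_measurable[OF assms]])
  finally show ?thesis by simp
qed

text \<open>Dropping the restriction to the ball and substituting
  \<open>x = y + s *\<^sub>R z\<close> costs the Jacobian of the dilation.\<close>

lemma ball_sum_le_integral:
  assumes h: "bbs h" "\<And>x. h x \<ge> 0" and s: "s \<noteq> 0"
  shows "ball_sum s h y \<le> (LBINT x. h x) / \<bar>s\<bar> ^ 3"
proof -
  obtain B R where hR: "R > 0" "\<And>x. norm x > R \<Longrightarrow> h x = 0"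
    by (rule bbsE[OF h(1)]) blast
  have "bbs (\<lambda>z. indicator (cball 0 ((R + norm y) / \<bar>s\<bar>)) z * h (y + s *\<^sub>R z))"
    by (intro bbs_mult_lbb bbs_indicator lbb_compose[OF bbs_imp_lbb[OF h(1)]] continuous_intros) auto
  moreover have "indicator (cball 0 ((R + norm y) / \<bar>s\<bar>)) z * h (y + s *\<^sub>R z) = h (y + s *\<^sub>R z)" for z
  proof (cases "norm z \<le> (R + norm y) / \<bar>s\<bar>")
    case False
    then have "norm (s *\<^sub>R z) > R + norm y" using s by (simp add: field_simps)
    moreover have "norm (s *\<^sub>R z) \<le> norm (y + s *\<^sub>R z) + norm y"
      using norm_triangle_ineq4[of "y + s *\<^sub>R z" y] by simp
    ultimately show ?thesis using hR(2)[of "y + s *\<^sub>R z"] by simp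
  qed simp
  ultimately have b: "bbs (\<lambda>z. h (y + s *\<^sub>R z))" by simp
  have "ball_sum s h y \<le> (LBINT z. h (y + s *\<^sub>R z))"
    unfolding ball_sum_def
    by (intro integral_mono integrable_ball_sum bbs_imp_lbb[OF h(1)] bbs_integrable[OF b])
      (auto simp: indicator_def h(2))
  also have "\<dots> = (LBINT x. h x) / \<bar>s\<bar> ^ 3"
    using integral_lborel_affine[OF s bbs_measurable[OF h(1)], of y] by simp
  finally show ?thesis .
qed

lemma powr_ge_tangent:
  assumes "q \<ge> 1" "c > 0" "(t::real) \<ge> 0"
  shows "c powr q + q * c powr (q - 1) * (t - c) \<le> t powr q"
proof (cases "t = 0")
  \<comment> \<open>The convexity argument lives on the open half-line; at 0 the claim reduces to
    \<open>(1 - q) * c powr q \<le> 0\<close>.\<close>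
  case True
  have "c powr q = c powr (q - 1) * c" using assms by (simp add: powr_diff)
  then have "c powr q + q * c powr (q - 1) * (t - c) = (1 - q) * (c powr (q - 1) * c)"
    using True by (simp add: algebra_simps)
  also have "\<dots> \<le> 0" using assms by (simp add: mult_nonpos_nonneg)
  finally show ?thesis using True by simp
next
  case False
  have "t powr q - c powr q \<ge> (q * c powr (q - 1)) * (t - c)"
    by (rule convex_on_imp_above_tangent[where A = "{0<..}"])
      (use assms False in \<open>auto intro!: powr_convex derivative_eq_intros simp: interior_open\<close>)
  then show ?thesis by simp
qed

text \<open>Jensen for the unit ball, by integrating the tangent inequality at the mean
  value.\<close>

lemma ball_sum_powr_le:
  assumes h: "bbs h" "\<And>x. h x \<ge> 0" and q: "q \<ge> 1"
  shows "ball_sum s h y powr q \<le>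
    measure lborel (cball (0::real^3) 1) powr (q - 1) * ball_sum s (\<lambda>x. h x powr q) y"
proof (cases "ball_sum s h y = 0")
  case True
  then show ?thesis by (simp add: ball_sum_nonneg)
next
  case False
  define \<omega> where "\<omega> = measure lborel (cball (0::real^3) 1)"
  have \<omega>: "\<omega> > 0" by (simp add: \<omega>_def content_cball_pos)
  define b where "b = ball_sum s h y"
  have b: "b > 0" using False ball_sum_nonneg[of h s y] h(2) by (simp add: b_def less_le)
  \<comment> \<open>At the normalised mean the linear part of the tangent integrates to
    zero.\<close>
  define c where "c = b / \<omega>"
  have c: "c > 0" using b \<omega> by (simp add: c_def)
  have lh: "lbb h" "lbb (\<lambda>x. h x powr q)"
    using q by (intro bbs_imp_lbb bbs_powr h; simp)+
  have i: "integrable lborel (indicator (cball 0 1) :: real^3 \<Rightarrow> real)"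
    by (intro bbs_integrable bbs_unit_ball)
  have "(LBINT z. indicator (cball 0 1) z * h (y + s *\<^sub>R z)) = \<omega> * c"
    using \<omega> by (simp add: ball_sum_def[symmetric] b_def[symmetric] c_def)
  then have "\<omega> * c powr q = (LBINT z. (c powr q - q * c powr (q - 1) * c) * indicator (cball 0 1) z +
      q * c powr (q - 1) * (indicator (cball 0 1) z * h (y + s *\<^sub>R z)))"
    using i integrable_ball_sum[OF lh(1), of y s]
    by (simp add: \<omega>_def[symmetric] left_diff_distrib)
  also have "\<dots> \<le> (LBINT z. indicator (cball 0 1) z * h (y + s *\<^sub>R z) powr q)"
  proof (rule integral_mono)
    show "(c powr q - q * c powr (q - 1) * c) * indicator (cball 0 1) z +
      q * c powr (q - 1) * (indicator (cball 0 1) z * h (y + s *\<^sub>R z))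
      \<le> indicator (cball 0 1) z * h (y + s *\<^sub>R z) powr q" for z
      using powr_ge_tangent[OF q c h(2), of "y + s *\<^sub>R z"] by (simp add: indicator_def algebra_simps)
  qed (use i integrable_ball_sum[OF lh(1), of y s] integrable_ball_sum[OF lh(2), of y s] in auto)
  finally have "\<omega> * c powr q \<le> ball_sum s (\<lambda>x. h x powr q) y" by (simp add: ball_sum_def)
  then have "\<omega> powr (q - 1) * (\<omega> * c powr q) \<le> \<omega> powr (q - 1) * ball_sum s (\<lambda>x. h x powr q) y"
    by (intro mult_left_mono) auto
  moreover have "\<omega> powr (q - 1) * (\<omega> * c powr q) = b powr q"
    using \<omega> b by (simp add: c_def powr_divide powr_diff)
  ultimately show ?thesis by (simp only: b_def \<omega>_def)
qed

text \<open>Means at scale \<open>s\<close> improve \<open>L^q\<close> to \<open>L^3\<close>. Of the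
  three factors of the mean, \<open>3 - q\<close> are estimated by its supremum, of order
  \<open>s powr (- 3 / q)\<close>, and the remaining \<open>q\<close> by Jensen. The resulting power
  of \<open>s\<close> drives both scale integrals below.\<close>

lemma integral_ball_sum_cubed_le:
  assumes h: "bbs h" "\<And>x. h x \<ge> 0" and q: "1 \<le> q" "q \<le> 3" and s: "s \<noteq> 0"
    and \<Lambda>: "(LBINT x. h x powr q) \<le> \<Lambda> powr q" "\<Lambda> \<ge> 0"
  shows "(LBINT y. ball_sum s h y ^ 3) \<le>
    (measure lborel (cball (0::real^3) 1) powr ((4 - 3 / q) / 3) * \<bar>s\<bar> powr (1 - 3 / q) * \<Lambda>) ^ 3"
proof -
  define \<omega> where "\<omega> = measure lborel (cball (0::real^3) 1)"
  have \<omega>: "\<omega> > 0" by (simp add: \<omega>_def content_cball_pos)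
  let ?b = "ball_sum s h"
  have bq: "bbs (\<lambda>x. h x powr q)" using q by (intro bbs_powr h) auto
  have bn: "?b y \<ge> 0" for y by (intro ball_sum_nonneg h)
  \<comment> \<open>\<open>T\<close> is the supremum bound for the mean, from Jensen followed by
    \<open>ball_sum_le_integral\<close>.\<close>
  define T where "T = \<omega> powr ((q - 1) / q) * \<bar>s\<bar> powr (- 3 / q) * \<Lambda>"
  have T: "T \<ge> 0" using \<Lambda> by (simp add: T_def)
  have sup: "?b y \<le> T" for y
  proof -
    have "ball_sum s (\<lambda>x. h x powr q) y \<le> (LBINT z. h z powr q) / \<bar>s\<bar> ^ 3"
      by (rule ball_sum_le_integral[OF bq _ s]) simp
    also have "\<dots> \<le> \<Lambda> powr q / \<bar>s\<bar> ^ 3" using \<Lambda> by (intro divide_right_mono) auto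
    finally have "?b y powr q \<le> \<omega> powr (q - 1) * (\<Lambda> powr q / \<bar>s\<bar> ^ 3)"
      using ball_sum_powr_le[OF h q(1), of s y] unfolding \<omega>_def[symmetric]
      by (meson mult_left_mono order_trans powr_ge_zero)
    also have "\<dots> = T powr q"
    proof -
      have "T powr q = \<omega> powr (q - 1) * \<bar>s\<bar> powr (- 3) * \<Lambda> powr q"
        using q \<omega> s \<Lambda> by (simp add: T_def powr_mult powr_powr)
      then show ?thesis using s by (simp add: powr_minus powr_numeral divide_inverse)
    qed
    finally show ?thesis
      using q T bn[of y] powr_less_mono2[of q T "?b y"] by (meson not_le less_le_trans zero_less_one)
  qed
  have "(LBINT y. ?b y ^ 3) \<le>
      (LBINT y. T powr (3 - q) * (\<omega> powr (q - 1) * ball_sum s (\<lambda>x. h x powr q) y))"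
  proof (rule integral_mono)
    show "integrable lborel (\<lambda>y. ?b y ^ 3)"
      by (intro bbs_integrable bbs_power bbs_ball_sum h) auto
    show "integrable lborel (\<lambda>y. T powr (3 - q) * (\<omega> powr (q - 1) * ball_sum s (\<lambda>x. h x powr q) y))"
      by (intro integrable_mult_right bbs_integrable bbs_ball_sum bq)
    fix y
    have "?b y ^ 3 = ?b y powr (3 - q) * ?b y powr q"
      using bn[of y] by (cases "?b y = 0") (auto simp: powr_add[symmetric] powr_numeral)
    also have "\<dots> \<le> T powr (3 - q) * (\<omega> powr (q - 1) * ball_sum s (\<lambda>x. h x powr q) y)"
      using q sup[of y] bn[of y] ball_sum_powr_le[OF h q(1), of s y]
      unfolding \<omega>_def by (intro mult_mono powr_mono2) auto
    finally show "?b y ^ 3 \<le> T powr (3 - q) * (\<omega> powr (q - 1) * ball_sum s (\<lambda>x. h x powr q) y)" .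
  qed
  also have "\<dots> = T powr (3 - q) * (\<omega> powr (q - 1) * (\<omega> * (LBINT x. h x powr q)))"
    by (simp add: integral_ball_sum[OF bq] \<omega>_def)
  also have "\<dots> \<le> T powr (3 - q) * (\<omega> powr (q - 1) * (\<omega> * \<Lambda> powr q))"
    using \<Lambda> \<omega> by (intro mult_left_mono) auto
  also have "\<dots> = (\<omega> powr ((4 - 3 / q) / 3) * \<bar>s\<bar> powr (1 - 3 / q) * \<Lambda>) ^ 3"
  proof (cases "\<Lambda> = 0")
    case False
    then have L: "\<Lambda> > 0" using \<Lambda> by simp
    \<comment> \<open>Taking logarithms turns the identity between powers into linear arithmetic in
      the exponents.\<close>
    have "T powr (3 - q) * (\<omega> powr (q - 1) * (\<omega> * \<Lambda> powr q)) =
      exp (ln (\<omega> powr ((q - 1) / q) * \<bar>s\<bar> powr (- 3 / q) * \<Lambda>) * (3 - q) + ln \<omega> * (q - 1) + ln \<omega> + ln \<Lambda> * q)"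
      using L \<omega> s by (simp add: T_def powr_def exp_add ac_simps)
    also have "\<dots> = exp (3 * ln (\<omega> powr ((4 - 3 / q) / 3) * \<bar>s\<bar> powr (1 - 3 / q) * \<Lambda>))"
      using L \<omega> s q by (simp add: ln_mult ln_powr) (simp add: field_simps)
    also have "\<dots> = (\<omega> powr ((4 - 3 / q) / 3) * \<bar>s\<bar> powr (1 - 3 / q) * \<Lambda>) ^ 3"
      using L \<omega> s by (simp add: exp_of_nat_mult[of 3, simplified])
    finally show ?thesis .
  qed simp
  finally show ?thesis by (simp add: \<omega>_def)
qed

section \<open>Control of the cubic norm on a shell\<close>

text \<open>The singularity of the derivative bound at 0 is integrable, so the scale can be run down
  to \<open>s = 0\<close>, where the mollification disappears. The bound is required on the open
  interval, the derivative itself everywhere.\<close>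

lemma powr_half_growth:
  fixes G :: "real \<Rightarrow> real"
  assumes der: "\<And>s. (G has_real_derivative G' s) (at s)"
    and bound: "\<And>s. 0 < s \<Longrightarrow> s < t \<Longrightarrow> \<bar>G' s\<bar> \<le> c * s powr (-1/2)" and "t > 0"
  shows "\<bar>G t - G 0\<bar> \<le> 2 * c * sqrt t"
proof -
  have "norm (G t - G 0) \<le> 2 * c * sqrt t - 2 * c * sqrt 0"
  proof (rule differentiable_bound_general[OF \<open>t > 0\<close>, where f' = G' and \<phi>' = "\<lambda>s. c * s powr (-1/2)"])
    show "continuous_on {0..t} G"
      using der by (meson DERIV_continuous continuous_at_imp_continuous_on)
    show "continuous_on {0..t} (\<lambda>s. 2 * c * sqrt s)" by (intro continuous_intros)
    show "(G has_vector_derivative G' s) (at s)" for s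
      using der by (simp add: has_real_derivative_iff_has_vector_derivative)
    show "((\<lambda>s. 2 * c * sqrt s) has_vector_derivative c * s powr (-1/2)) (at s)" if "0 < s" for s
    proof -
      have "s powr (-1/2) = inverse (sqrt s)"
        using that by (simp add: powr_minus powr_half_sqrt)
      then show ?thesis
        using that unfolding has_real_derivative_iff_has_vector_derivative[symmetric]
        by (auto intro!: derivative_eq_intros)
    qed
  qed (use bound in auto)
  then show ?thesis by simp
qed

text \<open>The derivative bound is integrable at infinity, so the total change above
  \<open>t0\<close> is controlled at \<open>t0\<close> alone, whatever \<open>t\<close> is.\<close>

lemma powr_growth:
  fixes G :: "real \<Rightarrow> real"
  assumes der: "\<And>s. (G has_real_derivative G' s) (at s)"
    and bound: "\<And>s. t0 < s \<Longrightarrow> s < t \<Longrightarrow> \<bar>G' s\<bar> \<le> c * s powr (- a - 1)"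
    and "0 < t0" "t0 \<le> t" "a > 0" "c \<ge> 0"
  shows "\<bar>G t - G t0\<bar> \<le> c / a * t0 powr (- a)"
proof (cases "t0 = t")
  case True
  then show ?thesis using assms by simp
next
  case False
  then have "t0 < t" using assms by simp
  have "norm (G t - G t0) \<le> - (c / a * t powr (- a)) - (- (c / a * t0 powr (- a)))"
  proof (rule differentiable_bound_general[OF \<open>t0 < t\<close>, where f' = G' and \<phi>' = "\<lambda>s. c * s powr (- a - 1)"])
    show "continuous_on {t0..t} G"
      using der by (meson DERIV_continuous continuous_at_imp_continuous_on)
    show "continuous_on {t0..t} (\<lambda>s. - (c / a * s powr (- a)))"
      using assms by (intro continuous_intros) auto
    show "(G has_vector_derivative G' s) (at s)" for s
      using der by (simp add: has_real_derivative_iff_has_vector_derivative)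
    show "((\<lambda>s. - (c / a * s powr (- a))) has_vector_derivative c * s powr (- a - 1)) (at s)" if "t0 < s" for s
      using that assms unfolding has_real_derivative_iff_has_vector_derivative[symmetric]
      by (auto intro!: derivative_eq_intros)
  qed (use bound in auto)
  also have "\<dots> \<le> c / a * t0 powr (- a)" using assms by simp
  finally show ?thesis by simp
qed

section \<open>Shells around the unit sphere and scale-dependent pairings\<close>

definition shell :: "real \<Rightarrow> (real^3) set" where
  "shell r = {x. \<bar>norm x - 1\<bar> \<le> r}"

lemma closed_shell: "closed (shell r)"
  unfolding shell_def by (intro closed_Collect_le continuous_intros)

lemma borel_shell [measurable]: "shell r \<in> sets borel"
  using closed_shell by (rule borel_closed)

lemma bounded_shell: "bounded (shell r)"
  unfolding bounded_iff shell_def by (intro exI[of _ "1 + r"]) auto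

lemma shell_mono: "r \<le> t \<Longrightarrow> shell r \<subseteq> shell t"
  by (auto simp: shell_def)

text \<open>Shifts of length at most \<open>\<epsilon>\<close> carry the shells of half-width
  \<open>\<epsilon>\<close> and \<open>2 * \<epsilon>\<close> into those of half-width
  \<open>2 * \<epsilon>\<close> and \<open>3 * \<epsilon>\<close>; these three nested shells
  accommodate all shifts in the proof.\<close>

lemma shell_shift:
  assumes "x \<in> shell r" "norm z \<le> 1" "\<bar>s\<bar> \<le> d"
  shows "x + s *\<^sub>R z \<in> shell (r + d)"
proof -
  have "norm (s *\<^sub>R z) \<le> \<bar>s\<bar>" using assms(2) by (simp add: mult_left_le)
  moreover have "\<bar>norm (x + s *\<^sub>R z) - norm x\<bar> \<le> norm (s *\<^sub>R z)"
    using norm_triangle_ineq3[of "x + s *\<^sub>R z" x] by simp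
  ultimately show ?thesis using assms unfolding shell_def by simp
qed

lemma bbs_indicator_shell: "bbs (indicator (shell r))"
  by (intro bbs_indicator bounded_shell) simp

lemma pairing_has_derivative:
  fixes W k h :: "real^3 \<Rightarrow> real"
  assumes W: "bbs W" and k: "bbs k" and h: "C1_grad h h'"
  shows "((\<lambda>s. LBINT x. (LBINT z. W x * k z * h (x + s *\<^sub>R z))) has_real_derivative
    (LBINT x. (LBINT z. W x * k z * (\<Sum>j\<in>UNIV. z $ j * h' j (x + t *\<^sub>R z))))) (at t)"
proof -
  have hb: "lbb h" by (intro lbb_continuous C1_grad_continuous[OF h])
  have hb': "lbb (h' j)" for j by (intro lbb_continuous C1_grad_partial_continuous[OF h])
  let ?F = "\<lambda>s w. W (fst w) * k (snd w) * h (fst w + s *\<^sub>R snd w)"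
  let ?F' = "\<lambda>s w. W (fst w) * k (snd w) * (\<Sum>j\<in>UNIV. snd w $ j * h' j (fst w + s *\<^sub>R snd w))"
  have Wk: "bbs (\<lambda>w. W (fst w) * k (snd w))" using bbs_Pair[OF W k] by (simp add: case_prod_unfold)
  have lbbF': "lbb (\<lambda>w::(real^3) \<times> (real^3). \<Sum>j\<in>UNIV. snd w $ j * h' j (fst w + s *\<^sub>R snd w))" for s
    by (intro lbb_sum lbb_mult lbb_compose[OF hb'] lbb_continuous continuous_intros)
  have bF: "bbs (?F s)" for s
    by (intro bbs_mult_lbb[OF Wk] lbb_compose[OF hb] continuous_intros)
  have bF': "bbs (?F' s)" for s by (intro bbs_mult_lbb[OF Wk] lbbF')
  obtain B R where R: "R > 0" "\<And>w. norm w > R \<Longrightarrow> W (fst w) * k (snd w) = 0"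
    by (rule bbsE[OF Wk]) blast
  \<comment> \<open>Boundedness jointly in the scale and both space variables gives one majorant for
    all scales within distance 1 of \<open>t\<close>.\<close>
  have "lbb (\<lambda>q::real \<times> (real^3) \<times> (real^3).
      \<Sum>j\<in>UNIV. snd (snd q) $ j * h' j (fst (snd q) + fst q *\<^sub>R snd (snd q)))"
    by (intro lbb_sum lbb_mult lbb_compose[OF hb'] lbb_continuous continuous_intros)
  then have "\<exists>C. \<forall>q::real \<times> (real^3) \<times> (real^3). norm q \<le> \<bar>t\<bar> + 1 + R \<longrightarrow>
      \<bar>\<Sum>j\<in>UNIV. snd (snd q) $ j * h' j (fst (snd q) + fst q *\<^sub>R snd (snd q))\<bar> \<le> C"
    unfolding lbb_def by blast
  then obtain C where C': "\<And>q::real \<times> (real^3) \<times> (real^3). norm q \<le> \<bar>t\<bar> + 1 + R \<Longrightarrow>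
      \<bar>\<Sum>j\<in>UNIV. snd (snd q) $ j * h' j (fst (snd q) + fst q *\<^sub>R snd (snd q))\<bar> \<le> C"
    by blast
  have C: "\<bar>\<Sum>j\<in>UNIV. snd w $ j * h' j (fst w + s *\<^sub>R snd w)\<bar> \<le> C"
    if "norm (s, w) \<le> \<bar>t\<bar> + 1 + R" for s :: real and w :: "(real^3) \<times> (real^3)"
    using C'[of "(s, w)"] that by simp
  have "((\<lambda>s. LBINT w. ?F s w) has_real_derivative (LBINT w. ?F' t w)) (at t)"
  proof (rule has_real_derivative_integral[where B = "\<lambda>w. C * \<bar>W (fst w) * k (snd w)\<bar>"])
    show "integrable lborel (?F s)" for s by (rule bbs_integrable[OF bF])
    show "((\<lambda>s. ?F s w) has_real_derivative ?F' s w) (at s)" for s w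
      by (intro DERIV_cmult C1_grad_line h)
    show "\<bar>?F' s w\<bar> \<le> C * \<bar>W (fst w) * k (snd w)\<bar>" if "\<bar>s - t\<bar> \<le> 1" for s w
    proof (cases "norm w \<le> R")
      case True
      have "norm (s, w) \<le> norm s + norm w" by (rule norm_Pair_le)
      also have "\<dots> \<le> \<bar>t\<bar> + 1 + R" using that True by simp
      finally have "\<bar>\<Sum>j\<in>UNIV. snd w $ j * h' j (fst w + s *\<^sub>R snd w)\<bar> \<le> C" by (rule C)
      from mult_left_mono[OF this, of "\<bar>W (fst w) * k (snd w)\<bar>"] show ?thesis
        by (simp add: abs_mult mult.commute)
    next
      case False
      then show ?thesis using R(2)[of w] by (simp only: mult_zero_left abs_zero mult_zero_right)
    qed
    show "integrable lborel (\<lambda>w. C * \<bar>W (fst w) * k (snd w)\<bar>)"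
      by (intro bbs_integrable bbs_cmult bbs_abs Wk)
    show "?F' t \<in> borel_measurable borel" by (rule bbs_measurable[OF bF'])
  qed
  moreover have "(LBINT w. ?F s w) = (LBINT x. (LBINT z. W x * k z * h (x + s *\<^sub>R z)))" for s
    by (rule Fubini_bbs(2)) (use bF in \<open>simp add: case_prod_unfold\<close>)
  moreover have "(LBINT w. ?F' t w) =
      (LBINT x. (LBINT z. W x * k z * (\<Sum>j\<in>UNIV. z $ j * h' j (x + t *\<^sub>R z))))"
    by (rule Fubini_bbs(2)) (use bF' in \<open>simp add: case_prod_unfold\<close>)
  ultimately show ?thesis by simp
qed

text \<open>The trilinear estimate behind all scale bounds. The kernel lives in the unit ball, so
  the inner integral is at most a ball mean of \<open>H\<close>; \<open>a\<close> squared against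
  this mean is then Hoelder with 3/2 and 3.\<close>

lemma pairing_le:
  fixes W H a k :: "real^3 \<Rightarrow> real" and h :: "real^3 \<Rightarrow> real^3 \<Rightarrow> real"
  assumes W: "bbs W" "\<And>x. \<bar>W x\<bar> \<le> (a x)\<^sup>2" and a: "bbs a" "\<And>x. a x \<ge> 0"
    and k: "bbs k" "\<And>z. \<bar>k z\<bar> \<le> \<kappa> * indicator (cball 0 1) z" "\<kappa> \<ge> 0"
    and H: "bbs H" "\<And>x. H x \<ge> 0" and h: "lbb (\<lambda>(x, z). h x z)"
    and hH: "\<And>x z. W x \<noteq> 0 \<Longrightarrow> norm z \<le> 1 \<Longrightarrow> \<bar>h x z\<bar> \<le> H (x + s *\<^sub>R z)"
    and q: "1 \<le> q" "q \<le> 3" and s: "s \<noteq> 0"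
    and \<alpha>: "(LBINT x. a x ^ 3) \<le> \<alpha> ^ 3" "\<alpha> \<ge> 0"
    and \<Lambda>: "(LBINT x. H x powr q) \<le> \<Lambda> powr q" "\<Lambda> \<ge> 0"
  shows "\<bar>LBINT x. (LBINT z. W x * k z * h x z)\<bar> \<le>
    2 * \<kappa> * \<alpha>\<^sup>2 * (measure lborel (cball (0::real^3) 1) powr ((4 - 3 / q) / 3) * \<bar>s\<bar> powr (1 - 3 / q) * \<Lambda>)"
proof -
  let ?T = "measure lborel (cball (0::real^3) 1) powr ((4 - 3 / q) / 3) * \<bar>s\<bar> powr (1 - 3 / q) * \<Lambda>"
  have bH: "bbs (ball_sum s H)" by (rule bbs_ball_sum[OF H(1)])
  have inner: "\<bar>LBINT z. W x * k z * h x z\<bar> \<le> \<kappa> * ((a x)\<^sup>2 * ball_sum s H x)" for x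
  proof (cases "W x = 0")
    case True
    then show ?thesis using k(3) ball_sum_nonneg[of H s x, OF H(2)] by simp
  next
    case False
    have "lbb (\<lambda>z. case (x, z) of (x, z) \<Rightarrow> h x z)" by (intro lbb_compose[OF h] continuous_intros)
    then have m: "(\<lambda>z. W x * k z * h x z) \<in> borel_measurable borel"
      using k(1)[THEN bbs_measurable] by (auto dest: lbb_measurable)
    have "\<bar>LBINT z. W x * k z * h x z\<bar> \<le> (\<bar>W x\<bar> * \<kappa>) * ball_sum s H x"
    proof (rule integral_le_ball_sum[OF bbs_imp_lbb[OF H(1)] m])
      fix z
      show "\<bar>W x * k z * h x z\<bar> \<le> \<bar>W x\<bar> * \<kappa> * (indicator (cball 0 1) z * H (x + s *\<^sub>R z))"
      proof (cases "norm z \<le> 1")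
        case True
        then show ?thesis using k(2)[of z] k(3) hH[OF False True]
          by (auto simp: abs_mult mult.assoc intro!: mult_left_mono mult_mono)
      next
        case F: False
        then show ?thesis using k(2)[of z] by simp
      qed
    qed
    also have "\<dots> \<le> ((a x)\<^sup>2 * \<kappa>) * ball_sum s H x"
      using W(2)[of x] k(3) ball_sum_nonneg[of H s x, OF H(2)] by (intro mult_right_mono) auto
    finally show ?thesis by (simp add: ac_simps)
  qed
  have bb: "bbs (\<lambda>x. \<kappa> * ((a x)\<^sup>2 * ball_sum s H x))"
    by (intro bbs_cmult bbs_mult_lbb bbs_power a bbs_imp_lbb[OF bH]) auto
  have "bbs (\<lambda>w. case w of (x, z) \<Rightarrow> W x * k z * h x z)"
    using bbs_mult_lbb[OF bbs_Pair[OF W(1) k(1)] h] by (simp add: case_prod_unfold)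
  then have "integrable lborel (\<lambda>x. LBINT z. W x * k z * h x z)"
    by (rule Fubini_bbs(3))
  then have "\<bar>LBINT x. (LBINT z. W x * k z * h x z)\<bar> \<le>
      (LBINT x. \<kappa> * ((a x)\<^sup>2 * ball_sum s H x))"
    by (intro order_trans[OF integral_abs_bound] integral_mono integrable_abs
      bbs_integrable[OF bb] inner)
  also have "\<dots> = \<kappa> * (LBINT x. (a x)\<^sup>2 * ball_sum s H x)" by simp
  also have "\<dots> \<le> \<kappa> * (2 * \<alpha>\<^sup>2 * ?T)"
    using \<Lambda> by (intro mult_left_mono[OF _ k(3)] integral_square_mult_le a bH ball_sum_nonneg H(2) \<alpha>
      integral_ball_sum_cubed_le[OF H q s \<Lambda>]) auto
  finally show ?thesis by (simp add: ac_simps)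
qed

definition grad_abs :: "(3 \<Rightarrow> real^3 \<Rightarrow> 'b::real_normed_vector) \<Rightarrow> real^3 \<Rightarrow> real" where
  "grad_abs f' x = sqrt (\<Sum>j\<in>UNIV. (norm (f' j x))\<^sup>2)"

lemma norm_le_grad_abs: "norm (f' j x) \<le> grad_abs f' x"
  unfolding grad_abs_def by (rule real_le_rsqrt) (auto intro!: member_le_sum)

lemma grad_abs_nonneg: "grad_abs f' x \<ge> 0"
  by (simp add: grad_abs_def sum_nonneg)

lemma grad_abs_square: "(grad_abs f' x)\<^sup>2 = (\<Sum>j\<in>UNIV. (norm (f' j x))\<^sup>2)"
  by (simp add: grad_abs_def sum_nonneg)

lemma continuous_grad_abs: "C1_grad f f' \<Longrightarrow> continuous_on UNIV (grad_abs f')"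
  unfolding grad_abs_def by (intro continuous_intros C1_grad_partial_continuous)

lemma abs_sum_coord_le:
  assumes "norm (z::real^3) \<le> 1" "\<And>j. \<bar>y j\<bar> \<le> Y"
  shows "\<bar>\<Sum>j\<in>UNIV. z $ j * y j\<bar> \<le> 3 * Y"
proof -
  have "\<bar>\<Sum>j\<in>UNIV. z $ j * y j\<bar> \<le> (\<Sum>j\<in>(UNIV::3 set). 1 * Y)"
  proof (intro order_trans[OF sum_abs] sum_mono)
    fix j
    have "\<bar>z $ j\<bar> \<le> 1" using component_le_norm_cart[of z j] assms(1) by linarith
    then show "\<bar>z $ j * y j\<bar> \<le> 1 * Y" unfolding abs_mult using assms(2)[of j] by (intro mult_mono) auto
  qed
  then show ?thesis by simp
qed

abbreviation "ball_vol \<equiv> measure lborel (cball (0::real^3) 1)"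
abbreviation "bump_mass \<equiv> (LBINT z. bump 4 z)"

text \<open>The difference of \<open>v\<close> and its means at scale \<open>s0\<close> is paid for by the gradient, the means
  themselves by the \<open>L\<^sup>p\<close> norm.\<close>

lemma L3_shell_le:
  fixes v :: "real^3 \<Rightarrow> real^3"
  assumes v: "C1_grad v v'" and s0: "0 < s0" "s0 \<le> \<epsilon>" and p: "1 \<le> p" "p < 3"
    and \<Lambda>: "(LBINT x. (indicator (shell (3 * \<epsilon>)) x * norm (v x)) powr p) \<le> \<Lambda> powr p" "\<Lambda> \<ge> 0"
    and \<Delta>: "(LBINT x. (indicator (shell (3 * \<epsilon>)) x * grad_abs v' x)\<^sup>2) \<le> \<Delta>\<^sup>2" "\<Delta> \<ge> 0"
    and \<alpha>: "(LBINT x. (indicator (shell (2 * \<epsilon>)) x * norm (v x)) ^ 3) = \<alpha> ^ 3" "\<alpha> \<ge> 0"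
  shows "\<alpha> \<le> (36 * ball_vol powr (5/6) + 6 * ball_vol powr ((4 - 3 / p) / 3)) / bump_mass *
    (s0 powr (1 - 3 / p) * \<Lambda> + sqrt s0 * \<Delta>)"
proof -
  define a where "a x = indicator (shell (2 * \<epsilon>)) x * norm (v x)" for x
  define V where "V x = indicator (shell (3 * \<epsilon>)) x * norm (v x)" for x
  define H where "H x = indicator (shell (3 * \<epsilon>)) x * grad_abs v' x" for x
  \<comment> \<open>Dual choice: summing \<open>W i x * v x $ i\<close> over \<open>i\<close> gives
    the cube to be estimated, while each \<open>W i\<close> is bounded by the square of
    \<open>a\<close>.\<close>
  define W where "W i x = a x * v x $ i" for i x
  have cv: "continuous_on UNIV v" "continuous_on UNIV (\<lambda>x. v x $ i)" for i
    by (intro continuous_intros C1_grad_continuous[OF v])+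
  have a: "bbs a" "a x \<ge> 0" for x
    unfolding a_def by (intro bbs_mult_lbb bbs_indicator_shell lbb_continuous continuous_intros cv | simp add: indicator_def)+
  have V: "bbs V" "V x \<ge> 0" for x
    unfolding V_def by (intro bbs_mult_lbb bbs_indicator_shell lbb_continuous continuous_intros cv | simp add: indicator_def)+
  have H: "bbs H" "H x \<ge> 0" for x
    unfolding H_def
    by (intro bbs_mult_lbb bbs_indicator_shell lbb_continuous continuous_grad_abs[OF v] |
      simp add: indicator_def grad_abs_nonneg)+
  have W: "bbs (W i)" for i
    unfolding W_def[abs_def] by (intro bbs_mult_lbb a lbb_continuous cv)
  have Wa: "\<bar>W i x\<bar> \<le> (a x)\<^sup>2" for i x
    using component_le_norm_cart[of "v x" i]
    by (auto simp: W_def a_def power2_eq_square indicator_def abs_mult intro!: mult_left_mono)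
  have W0: "x \<in> shell (2 * \<epsilon>)" if "W i x \<noteq> 0" for i x
    using that by (auto simp: W_def a_def indicator_def split: if_splits)
  have mass: "bump_mass > 0" by (rule integral_bump_pos) simp
  have b4: "bbs (bump 4)" "\<bar>bump 4 z\<bar> \<le> 1 * indicator (cball 0 1) z" for z
    using bump_le_indicator[of 4 z] bump_nonneg[of 4 z] by (auto intro: bbs_bump)
  have vi: "C1_grad (\<lambda>x. v x $ i) (\<lambda>j x. v' j x $ i)" for i by (rule C1_grad_nth[OF v])
  \<comment> \<open>\<open>G i\<close> pairs \<open>W i\<close> with the mean of the velocity
    component at scale \<open>s\<close>; at \<open>s = 0\<close> the mean is the component times
    \<open>bump_mass\<close>.\<close>
  define G where "G i s = (LBINT x. (LBINT z. W i x * bump 4 z * v (x + s *\<^sub>R z) $ i))" for i s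
  define G' where "G' i s = (LBINT x. (LBINT z. W i x * bump 4 z *
      (\<Sum>j\<in>UNIV. z $ j * v' j (x + s *\<^sub>R z) $ i)))" for i s
  have der: "(G i has_real_derivative G' i s) (at s)" for i s
    unfolding G_def[abs_def] G'_def by (rule pairing_has_derivative[OF W b4(1) vi])
  have in_shell: "x + s *\<^sub>R z \<in> shell (3 * \<epsilon>)" if "W i x \<noteq> 0" "norm z \<le> 1" "0 < s" "s \<le> s0" for i x z s
    using shell_shift[OF W0[OF that(1)] that(2), of s \<epsilon>] that s0 by simp
  have G'_bound: "\<bar>G' i s\<bar> \<le> (6 * \<alpha>\<^sup>2 * (ball_vol powr (5/6) * \<Delta>)) * s powr (-1/2)"
    if s: "0 < s" "s < s0" for i s
  proof -
    \<comment> \<open>The case \<open>q = 2\<close> of the pairing bound; the factor 3 counts the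
      coordinates of \<open>z\<close>, and \<open>(4 - 3 / 2) / 3\<close> is 5/6.\<close>
    have "\<bar>G' i s\<bar> \<le> 2 * 1 * \<alpha>\<^sup>2 * (ball_vol powr ((4 - 3 / 2) / 3) * \<bar>s\<bar> powr (1 - 3 / 2) * (3 * \<Delta>))"
      unfolding G'_def
    proof (rule pairing_le[where a = a and H = "\<lambda>x. 3 * H x"])
      show "lbb (\<lambda>(x::real^3, z). \<Sum>j\<in>UNIV. z $ j * v' j (x + s *\<^sub>R z) $ i)"
        unfolding case_prod_unfold
        by (intro lbb_sum lbb_mult lbb_compose[OF lbb_continuous[OF C1_grad_partial_continuous[OF vi]]]
          lbb_continuous continuous_intros)
      show "\<bar>\<Sum>j\<in>UNIV. z $ j * v' j (x + s *\<^sub>R z) $ i\<bar> \<le> 3 * H (x + s *\<^sub>R z)"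
        if "W i x \<noteq> 0" "norm z \<le> 1" for x z
      proof (rule abs_sum_coord_le[OF that(2)])
        fix j
        have "\<bar>v' j (x + s *\<^sub>R z) $ i\<bar> \<le> grad_abs v' (x + s *\<^sub>R z)"
          using component_le_norm_cart norm_le_grad_abs order_trans by blast
        then show "\<bar>v' j (x + s *\<^sub>R z) $ i\<bar> \<le> H (x + s *\<^sub>R z)"
          using in_shell[OF that, of s] s by (simp add: H_def)
      qed
      have "(LBINT x. (3 * H x) powr 2) = 9 * (LBINT x. (H x)\<^sup>2)"
        using H(2) by (simp add: powr_numeral power_mult_distrib)
      then show "(LBINT x. (3 * H x) powr 2) \<le> (3 * \<Delta>) powr 2"
        using \<Delta> by (simp add: powr_numeral power_mult_distrib H_def)
    qed (use W Wa a b4 H \<alpha> \<Delta>(2) s in \<open>auto simp: a_def intro!: bbs_cmult\<close>)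
    then show ?thesis using s by (simp add: ac_simps)
  qed
  have grow: "\<bar>G i s0 - G i 0\<bar> \<le> 12 * \<alpha>\<^sup>2 * (ball_vol powr (5/6) * \<Delta>) * sqrt s0" for i
    using powr_half_growth[OF der G'_bound s0(1), of i] by (simp add: ac_simps)
  \<comment> \<open>At the scale \<open>s0\<close> no derivative is taken; here the means are
    controlled by the \<open>L^p\<close> norm, with \<open>q = p\<close>.\<close>
  have end_bound: "\<bar>G i s0\<bar> \<le> 2 * 1 * \<alpha>\<^sup>2 * (ball_vol powr ((4 - 3 / p) / 3) * \<bar>s0\<bar> powr (1 - 3 / p) * \<Lambda>)" for i
    unfolding G_def
  proof (rule pairing_le[where a = a and H = V])
    show "lbb (\<lambda>(x::real^3, z). v (x + s0 *\<^sub>R z) $ i)"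
      unfolding case_prod_unfold by (intro lbb_compose[OF lbb_continuous[OF cv(2)]] continuous_intros)
    show "\<bar>v (x + s0 *\<^sub>R z) $ i\<bar> \<le> V (x + s0 *\<^sub>R z)" if "W i x \<noteq> 0" "norm z \<le> 1" for x z
      using in_shell[OF that, of s0] s0 component_le_norm_cart[of "v (x + s0 *\<^sub>R z)" i] by (simp add: V_def)
  qed (use W Wa a b4 V \<alpha> \<Lambda> p s0 in \<open>auto simp: a_def V_def\<close>)
  have "\<alpha> ^ 3 * bump_mass = (\<Sum>i\<in>UNIV. G i 0)"
  proof -
    have "G i 0 = (LBINT x. W i x * v x $ i) * bump_mass" for i
    proof -
      have "(LBINT z. W i x * bump 4 z * v (x + 0 *\<^sub>R z) $ i) = (W i x * v x $ i) * bump_mass" for x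
        by (subst integral_mult_right_zero[symmetric]) (simp add: ac_simps)
      then show ?thesis unfolding G_def by (simp only: integral_mult_left_zero)
    qed
    then have "(\<Sum>i\<in>UNIV. G i 0) = (\<Sum>i\<in>UNIV. LBINT x. W i x * v x $ i) * bump_mass"
      by (simp add: sum_distrib_right)
    also have "(\<Sum>i\<in>UNIV. LBINT x. W i x * v x $ i) = (LBINT x. (\<Sum>i\<in>UNIV. W i x * v x $ i))"
      by (intro Bochner_Integration.integral_sum[symmetric] bbs_integrable bbs_mult_lbb W lbb_continuous cv)
    also have "(\<lambda>x. \<Sum>i\<in>UNIV. W i x * v x $ i) = (\<lambda>x. a x ^ 3)"
    proof
      fix x
      have "(\<Sum>i\<in>UNIV. W i x * v x $ i) = a x * (v x \<bullet> v x)"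
        by (simp add: W_def inner_vec_def sum_distrib_left mult.assoc)
      also have "\<dots> = a x ^ 3"
        by (simp add: a_def power2_norm_eq_inner[symmetric] power3_eq_cube power2_eq_square indicator_def)
      finally show "(\<Sum>i\<in>UNIV. W i x * v x $ i) = a x ^ 3" .
    qed
    finally show ?thesis using \<alpha>(1) by (simp add: a_def)
  qed
  also have "\<dots> \<le> (\<Sum>i\<in>(UNIV::3 set). 12 * \<alpha>\<^sup>2 * (ball_vol powr (5/6) * \<Delta>) * sqrt s0 +
      2 * \<alpha>\<^sup>2 * (ball_vol powr ((4 - 3 / p) / 3) * s0 powr (1 - 3 / p) * \<Lambda>))"
  proof (rule sum_mono)
    fix i :: 3
    show "G i 0 \<le> 12 * \<alpha>\<^sup>2 * (ball_vol powr (5/6) * \<Delta>) * sqrt s0 +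
      2 * \<alpha>\<^sup>2 * (ball_vol powr ((4 - 3 / p) / 3) * s0 powr (1 - 3 / p) * \<Lambda>)"
      using grow[of i] end_bound[of i] s0 by simp
  qed
  also have "\<dots> = \<alpha>\<^sup>2 * (36 * ball_vol powr (5/6) * (sqrt s0 * \<Delta>) +
      6 * ball_vol powr ((4 - 3 / p) / 3) * (s0 powr (1 - 3 / p) * \<Lambda>))"
    by (simp add: algebra_simps)
  also have "\<dots> \<le> \<alpha>\<^sup>2 * ((36 * ball_vol powr (5/6) + 6 * ball_vol powr ((4 - 3 / p) / 3)) *
      (s0 powr (1 - 3 / p) * \<Lambda> + sqrt s0 * \<Delta>))"
    using \<Lambda> \<Delta> s0 by (intro mult_left_mono) (simp_all add: algebra_simps)
  finally have *: "\<alpha>\<^sup>2 * (\<alpha> * bump_mass) \<le> \<alpha>\<^sup>2 * ((36 * ball_vol powr (5/6) + 6 * ball_vol powr ((4 - 3 / p) / 3)) *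
      (s0 powr (1 - 3 / p) * \<Lambda> + sqrt s0 * \<Delta>))"
    by (simp add: power3_eq_cube power2_eq_square mult.assoc)
  \<comment> \<open>Both sides carry the factor \<open>\<alpha>\<^sup>2\<close>, which is cancelled
    unless it is zero.\<close>
  show ?thesis
  proof (cases "\<alpha> = 0")
    case True
    then show ?thesis using \<Lambda> \<Delta> s0 mass by simp
  next
    case False
    then have "\<alpha> * bump_mass \<le> (36 * ball_vol powr (5/6) + 6 * ball_vol powr ((4 - 3 / p) / 3)) *
      (s0 powr (1 - 3 / p) * \<Lambda> + sqrt s0 * \<Delta>)"
      using * by (simp add: mult_le_cancel_left)
    then show ?thesis using mass by (simp add: field_simps)
  qed
qed

section \<open>Scale derivative of the mollified pressure\<close>

text \<open>Support of the pair bounds \<open>z\<close> first, and then \<open>y\<close> up to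
  \<open>\<bar>c\<bar>\<close> times that bound.\<close>

lemma bbs_shear:
  fixes g :: "(real^3) \<times> (real^3) \<Rightarrow> real"
  assumes "bbs g" shows "bbs (\<lambda>(y, z). g (y + c *\<^sub>R z, z))"
proof -
  obtain B R where g: "B > 0" "R > 0" "\<And>x. \<bar>g x\<bar> \<le> B" "\<And>x. norm x > R \<Longrightarrow> g x = 0"
    by (rule bbsE[OF assms]) blast
  have "lbb (\<lambda>w. g (fst w + c *\<^sub>R snd w, snd w))"
    by (intro lbb_compose[OF bbs_imp_lbb[OF assms]] continuous_intros)
  then have "(\<lambda>w. g (fst w + c *\<^sub>R snd w, snd w)) \<in> borel_measurable borel"
    by (rule lbb_measurable)
  moreover have "g (y + c *\<^sub>R z, z) = 0" if "norm (y, z) > R + \<bar>c\<bar> * R" for y z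
  proof (rule ccontr)
    assume "g (y + c *\<^sub>R z, z) \<noteq> 0"
    then have R: "norm (y + c *\<^sub>R z, z) \<le> R" using g(4) by (meson not_le)
    then have z: "norm z \<le> R" using norm_snd_le[of z "y + c *\<^sub>R z"] by linarith
    have "(y, z) = (y + c *\<^sub>R z, z) - (c *\<^sub>R z, 0)" by simp
    then have "norm (y, z) \<le> norm (y + c *\<^sub>R z, z) + norm (c *\<^sub>R z, 0::real^3)"
      using norm_triangle_ineq4 by metis
    also have "norm (c *\<^sub>R z, 0::real^3) \<le> \<bar>c\<bar> * R" using z by (simp add: norm_Pair mult_left_mono)
    finally show False using R that by linarith
  qed
  ultimately show ?thesis using g(3) unfolding bbs_def case_prod_unfold
    by (intro conjI exI[of _ B] exI[of _ "R + \<bar>c\<bar> * R"] allI impI) simp_all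
qed

text \<open>For each fixed \<open>z\<close> substitute \<open>y = x + s *\<^sub>R z\<close>. The
  shift moves to \<open>f\<close>, with opposite sign, so that \<open>f\<close> can be averaged or
  differentiated while the velocity product stays at the base point.\<close>

lemma pairing_swap:
  fixes f k F :: "real^3 \<Rightarrow> real"
  assumes f: "bbs f" and k: "bbs k" and F: "lbb F"
  shows "(LBINT x. (LBINT z. f x * k z * F (x + s *\<^sub>R z))) =
    (LBINT y. (LBINT z. F y * k z * f (y + (- s) *\<^sub>R z)))"
proof -
  have b: "bbs (\<lambda>(x, z). f x * k z * F (x + s *\<^sub>R z))" by (rule bbs_pair_shift[OF f k F])
  have b': "bbs (\<lambda>(y, z). F y * k z * f (y + (- s) *\<^sub>R z))"
    using bbs_shear[OF b, of "- s"] by (simp add: case_prod_unfold ac_simps)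
  have "(LBINT x. f x * k z * F (x + s *\<^sub>R z)) = (LBINT y. F y * k z * f (y + (- s) *\<^sub>R z))" for z
  proof -
    have "lbb (\<lambda>y. F y * k z * f (y + (- s) *\<^sub>R z))"
      by (intro lbb_mult F lbb_const lbb_compose[OF bbs_imp_lbb[OF f]] continuous_intros)
    from integral_lborel_shift[OF lbb_measurable[OF this], of "s *\<^sub>R z"] show ?thesis
      by (simp add: ac_simps)
  qed
  then show ?thesis using Fubini_bbs(1)[OF b] Fubini_bbs(1)[OF b'] by simp
qed

lemma C1_grad_coord: "C1_grad (\<lambda>z. z $ i) (\<lambda>j z. if j = i then 1 else 0)"
proof (rule C1_gradI)
  show "((\<lambda>z. z $ i) has_derivative (\<lambda>h. h $ i)) (at x)" for x :: "real^3"
    by (rule bounded_linear_imp_has_derivative[OF bounded_linear_vec_nth])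
  show "h $ i = (\<Sum>j\<in>UNIV. h $ j *\<^sub>R (if j = i then 1 else 0))" for h :: "real^3"
    by (simp add: if_distrib cong: if_cong)
qed auto

text \<open>\<open>ker1\<close>, \<open>ker2\<close> and \<open>ker3\<close> are the first, second
  and third partial derivatives of \<open>bump 5\<close>, written out by powers of the bump.\<close>

definition ker1 :: "3 \<Rightarrow> real^3 \<Rightarrow> real" where
  "ker1 j z = - 10 * (z $ j * bump 4 z)"

definition ker2 :: "3 \<Rightarrow> 3 \<Rightarrow> real^3 \<Rightarrow> real" where
  "ker2 j k z = - 10 * ((if j = k then bump 4 z else 0) - 8 * (z $ j * z $ k * bump 3 z))"

definition ker3 :: "3 \<Rightarrow> 3 \<Rightarrow> 3 \<Rightarrow> real^3 \<Rightarrow> real" where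
  "ker3 j k l z = - 10 * (- 8 * ((if j = k then z $ l else 0) + (if j = l then z $ k else 0) +
     (if k = l then z $ j else 0)) * bump 3 z + 48 * (z $ j * z $ k * z $ l * bump 2 z))"

lemma C1_grad_eq: "C1_grad f f' \<Longrightarrow> (\<And>j x. f' j x = g j x) \<Longrightarrow> C1_grad f g"
  by (metis ext)

lemma C1_grad_bump4: "C1_grad (bump 4) (\<lambda>j z. - 8 * (z $ j * bump 3 z))"
  using C1_grad_bump[of 2] by (simp add: eval_nat_numeral mult.assoc)

lemma C1_grad_bump3: "C1_grad (bump 3) (\<lambda>j z. - 6 * (z $ j * bump 2 z))"
  using C1_grad_bump[of 1] by (simp add: eval_nat_numeral mult.assoc)

lemma C1_grad_ker1: "C1_grad (ker1 j) (ker2 j)"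
proof -
  have "C1_grad (\<lambda>z. - 10 * (z $ j * bump 4 z))
      (\<lambda>k z. - 10 * ((if k = j then 1 else 0) * bump 4 z + z $ j * (- 8 * (z $ k * bump 3 z))))"
    by (intro C1_grad_cmult C1_grad_mult C1_grad_coord C1_grad_bump4)
  then show ?thesis unfolding ker1_def[abs_def]
    by (rule C1_grad_eq) (auto simp: ker2_def)
qed

lemma C1_grad_ker2: "C1_grad (ker2 j k) (ker3 j k)"
proof -
  have "C1_grad (\<lambda>z. - 10 * ((if j = k then 1 else 0) * bump 4 z + - 8 * (z $ j * z $ k * bump 3 z)))
      (\<lambda>l z. - 10 * ((if j = k then 1 else 0) * (- 8 * (z $ l * bump 3 z)) +
         - 8 * (((if l = j then 1 else 0) * z $ k + z $ j * (if l = k then 1 else 0)) * bump 3 z +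
            z $ j * z $ k * (- 6 * (z $ l * bump 2 z)))))"
    by (intro C1_grad_cmult C1_grad_add C1_grad_mult C1_grad_coord C1_grad_bump4 C1_grad_bump3)
  moreover have "(\<lambda>z. - 10 * ((if j = k then 1 else 0) * bump 4 z + - 8 * (z $ j * z $ k * bump 3 z))) = ker2 j k"
    by (auto simp: ker2_def)
  ultimately have "C1_grad (ker2 j k)
      (\<lambda>l z. - 10 * ((if j = k then 1 else 0) * (- 8 * (z $ l * bump 3 z)) +
         - 8 * (((if l = j then 1 else 0) * z $ k + z $ j * (if l = k then 1 else 0)) * bump 3 z +
            z $ j * z $ k * (- 6 * (z $ l * bump 2 z)))))"
    by simp
  then show ?thesis by (rule C1_grad_eq) (auto simp: ker3_def algebra_simps)
qed

text \<open>Symmetry of third derivatives. It puts the index of the velocity component last, where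
  an integration by parts produces the divergence.\<close>

lemma ker3_commute: "ker3 j k k z = ker3 k k j z"
  by (auto simp: ker3_def)

lemma bump_outside: "norm z > 1 \<Longrightarrow> m > 0 \<Longrightarrow> bump m z = 0"
  by (simp add: bump_eq_0)

lemma ker_outside:
  assumes "norm z > 1" shows "ker1 j z = 0" "ker2 j k z = 0" "ker3 j k l z = 0"
  using bump_outside[OF assms] by (auto simp: ker1_def ker2_def ker3_def)

lemma bbs_ker: "bbs (ker1 j)" "bbs (ker2 j k)"
  using C1_grad_ker1 C1_grad_ker2 ker_outside
  by (intro bbs_continuous[where R = 1]; meson C1_grad_continuous)+

lemma coord_bump_le:
  assumes "m > 0" "norm z \<le> 1"
  shows "\<bar>z $ j * bump m z\<bar> \<le> 1" "\<bar>z $ j * z $ k * bump m z\<bar> \<le> 1"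
proof -
  have "\<bar>z $ j\<bar> \<le> 1" for j using component_le_norm_cart[of z j] assms(2) by linarith
  then show "\<bar>z $ j * bump m z\<bar> \<le> 1" "\<bar>z $ j * z $ k * bump m z\<bar> \<le> 1"
    using bump_le_1[of m z] bump_nonneg[of m z] by (auto simp: abs_mult intro!: mult_le_one)
qed

text \<open>On the unit ball coordinates and bumps are at most 1 in absolute value;
  \<open>90\<close> is \<open>10 * (1 + 8)\<close>.\<close>

lemma ker_bound:
  "\<bar>ker1 j z\<bar> \<le> 10 * indicator (cball 0 1) z" "\<bar>ker2 j k z\<bar> \<le> 90 * indicator (cball 0 1) z"
proof -
  have "\<bar>ker1 j z\<bar> \<le> 10 \<and> \<bar>ker2 j k z\<bar> \<le> 90" if "norm z \<le> 1"
  proof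
    show "\<bar>ker1 j z\<bar> \<le> 10" using coord_bump_le(1)[of 4 z j] that by (simp add: ker1_def)
    have "\<bar>if j = k then bump 4 z else 0\<bar> \<le> 1" using bump_le_1[of 4 z] bump_nonneg[of 4 z] by auto
    moreover have "\<bar>z $ j * z $ k * bump 3 z\<bar> \<le> 1" using coord_bump_le(2)[of 3 z j k] that by simp
    moreover have "\<bar>- 10 * (a - 8 * b)\<bar> \<le> 90" if "\<bar>a\<bar> \<le> 1" "\<bar>b\<bar> \<le> 1" for a b :: real
      using that by (auto simp: abs_le_iff)
    ultimately show "\<bar>ker2 j k z\<bar> \<le> 90" unfolding ker2_def by blast
  qed
  then show "\<bar>ker1 j z\<bar> \<le> 10 * indicator (cball 0 1) z" "\<bar>ker2 j k z\<bar> \<le> 90 * indicator (cball 0 1) z"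
    using ker_outside[of z] by (cases "norm z \<le> 1"; simp)+
qed

text \<open>The viscosity is a parameter because dilation changes it. \<open>v'' j k\<close> is the
  \<open>k\<close>-th partial of \<open>v' j\<close>, and the momentum equation is solved for the
  pressure gradient, the only form in which it is used.\<close>

locale navier_stokes =
  fixes \<nu> :: real and v :: "real^3 \<Rightarrow> real^3" and v' :: "3 \<Rightarrow> real^3 \<Rightarrow> real^3"
    and v'' :: "3 \<Rightarrow> 3 \<Rightarrow> real^3 \<Rightarrow> real^3" and q :: "real^3 \<Rightarrow> real" and q' :: "3 \<Rightarrow> real^3 \<Rightarrow> real"
  assumes C1v: "C1_grad v v'" and C1v': "\<And>j. C1_grad (v' j) (v'' j)" and C1q: "C1_grad q q'"
    and NS: "\<And>x j. q' j x = \<nu> * (\<Sum>k\<in>UNIV. v'' k k x $ j) - (\<Sum>k\<in>UNIV. v x $ k * v' k x $ j)"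
    and div0: "\<And>x. (\<Sum>j\<in>UNIV. v' j x $ j) = 0"
begin

lemma C1_line_v: "C1_grad (\<lambda>z. v (x + s *\<^sub>R z) $ i) (\<lambda>j z. s * v' j (x + s *\<^sub>R z) $ i)"
  using C1_grad_affine[OF C1_grad_nth[OF C1v]] by simp

lemma C1_line_v': "C1_grad (\<lambda>z. v' k (x + s *\<^sub>R z) $ i) (\<lambda>j z. s * v'' k j (x + s *\<^sub>R z) $ i)"
  using C1_grad_affine[OF C1_grad_nth[OF C1v']] by simp

lemma continuous_v: "continuous_on UNIV v" "continuous_on UNIV (v' j)" "continuous_on UNIV (v'' j k)"
  using C1_grad_continuous[OF C1v] C1_grad_continuous[OF C1v'] C1_grad_partial_continuous[OF C1v'] by auto

lemma lbb_shift:
  "lbb (\<lambda>z. v (x + s *\<^sub>R z) $ i)" "lbb (\<lambda>z. v' j (x + s *\<^sub>R z) $ i)" "lbb (\<lambda>z. v'' j k (x + s *\<^sub>R z) $ i)"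
  "lbb (\<lambda>z. q' j (x + s *\<^sub>R z))"
  by (intro lbb_continuous continuous_intros continuous_on_compose2[OF continuous_v(1)]
    continuous_on_compose2[OF continuous_v(2)] continuous_on_compose2[OF continuous_v(3)]
    continuous_on_compose2[OF C1_grad_partial_continuous[OF C1q]]; simp)+

text \<open>The \<open>z\<close>-derivative of a field at \<open>x + s *\<^sub>R z\<close> carries a
  factor \<open>s\<close>, so moving two derivatives to the kernel uses up
  \<open>s\<^sup>2\<close>.\<close>

lemma integral_laplacian_shift:
  assumes a: "C1_grad a a'" "\<And>j. C1_grad (a' j) (a'' j)" "\<And>z. norm z > 1 \<Longrightarrow> a z = 0"
    "\<And>j z. norm z > 1 \<Longrightarrow> a' j z = 0"
  shows "s\<^sup>2 * (LBINT z. a z * v'' k k (x + s *\<^sub>R z) $ i) = (LBINT z. a'' k k z * v (x + s *\<^sub>R z) $ i)"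
proof -
  have "s * (LBINT z. a z * v'' k k (x + s *\<^sub>R z) $ i) = (LBINT z. a z * (s * v'' k k (x + s *\<^sub>R z) $ i))"
    by (subst integral_mult_right_zero[symmetric]) (simp add: ac_simps)
  also have "\<dots> = - (LBINT z. a' k z * v' k (x + s *\<^sub>R z) $ i)"
    using integral_by_parts[OF a(1,3) C1_line_v'] by simp
  finally have "s\<^sup>2 * (LBINT z. a z * v'' k k (x + s *\<^sub>R z) $ i) =
      - (s * (LBINT z. a' k z * v' k (x + s *\<^sub>R z) $ i))"
    by (simp add: power2_eq_square mult.assoc)
  also have "s * (LBINT z. a' k z * v' k (x + s *\<^sub>R z) $ i) = (LBINT z. a' k z * (s * v' k (x + s *\<^sub>R z) $ i))"
    by (subst integral_mult_right_zero[symmetric]) (simp add: ac_simps)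
  also have "- \<dots> = (LBINT z. a'' k k z * v (x + s *\<^sub>R z) $ i)"
    using integral_by_parts[OF a(2,4) C1_line_v] by simp
  finally show ?thesis .
qed

text \<open>Divergence form of the transport term: differentiating the product of two components
  gives it plus a multiple of the divergence, which vanishes.\<close>

lemma integral_convective_shift:
  assumes a: "C1_grad a a'" "\<And>z. norm z > 1 \<Longrightarrow> a z = 0"
  shows "s * (LBINT z. a z * (\<Sum>k\<in>UNIV. v (x + s *\<^sub>R z) $ k * v' k (x + s *\<^sub>R z) $ i)) =
    - (\<Sum>k\<in>UNIV. LBINT z. a' k z * (v (x + s *\<^sub>R z) $ k * v (x + s *\<^sub>R z) $ i))"
proof -
  let ?v = "\<lambda>z. v (x + s *\<^sub>R z)" and ?v' = "\<lambda>k z. v' k (x + s *\<^sub>R z)"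
  have bb: "bbs a" by (rule bbs_continuous[OF C1_grad_continuous[OF a(1)] a(2)])
  have C1: "C1_grad (\<lambda>z. ?v z $ k * ?v z $ i) (\<lambda>j z. s * ?v' j z $ k * ?v z $ i + ?v z $ k * (s * ?v' j z $ i))" for k
    by (intro C1_grad_mult C1_line_v)
  have "(\<Sum>k\<in>UNIV. LBINT z. a' k z * (?v z $ k * ?v z $ i)) =
      - (\<Sum>k\<in>UNIV. LBINT z. a z * (s * ?v' k z $ k * ?v z $ i + ?v z $ k * (s * ?v' k z $ i)))"
    using integral_by_parts[OF a C1] by (simp add: sum_negf)
  also have "(\<Sum>k\<in>UNIV. LBINT z. a z * (s * ?v' k z $ k * ?v z $ i + ?v z $ k * (s * ?v' k z $ i))) =
      (LBINT z. (\<Sum>k\<in>UNIV. a z * (s * ?v' k z $ k * ?v z $ i + ?v z $ k * (s * ?v' k z $ i))))"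
    by (intro Bochner_Integration.integral_sum[symmetric] bbs_integrable bbs_mult_lbb bb lbb_add lbb_mult lbb_const lbb_shift)
  also have "(\<lambda>z. \<Sum>k\<in>UNIV. a z * (s * ?v' k z $ k * ?v z $ i + ?v z $ k * (s * ?v' k z $ i))) =
      (\<lambda>z. s * (a z * (\<Sum>k\<in>UNIV. ?v z $ k * ?v' k z $ i)))"
  proof
    fix z
    have "(\<Sum>k\<in>UNIV. a z * (s * ?v' k z $ k * ?v z $ i + ?v z $ k * (s * ?v' k z $ i))) =
        a z * s * ?v z $ i * (\<Sum>k\<in>UNIV. ?v' k z $ k) + s * (a z * (\<Sum>k\<in>UNIV. ?v z $ k * ?v' k z $ i))"
      by (simp add: sum_distrib_left sum.distrib algebra_simps)
    then show "(\<Sum>k\<in>UNIV. a z * (s * ?v' k z $ k * ?v z $ i + ?v z $ k * (s * ?v' k z $ i))) =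
        s * (a z * (\<Sum>k\<in>UNIV. ?v z $ k * ?v' k z $ i))" by (simp add: div0)
  qed
  finally show ?thesis by simp
qed

lemma integral_pressure_gradient_shift:
  assumes a: "bbs a"
  shows "(LBINT z. a z * q' j (x + s *\<^sub>R z)) =
    \<nu> * (\<Sum>k\<in>UNIV. LBINT z. a z * v'' k k (x + s *\<^sub>R z) $ j) -
    (LBINT z. a z * (\<Sum>k\<in>UNIV. v (x + s *\<^sub>R z) $ k * v' k (x + s *\<^sub>R z) $ j))"
proof -
  have i: "integrable lborel (\<lambda>z. a z * v'' k k (x + s *\<^sub>R z) $ j)" for k
    by (intro bbs_integrable bbs_mult_lbb a lbb_shift)
  have i2: "integrable lborel (\<lambda>z. a z * (\<Sum>k\<in>UNIV. v (x + s *\<^sub>R z) $ k * v' k (x + s *\<^sub>R z) $ j))"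
    by (intro bbs_integrable bbs_mult_lbb a lbb_sum lbb_mult lbb_shift)
  have "(\<lambda>z. a z * q' j (x + s *\<^sub>R z)) = (\<lambda>z. \<nu> * (\<Sum>k\<in>UNIV. a z * v'' k k (x + s *\<^sub>R z) $ j) -
      a z * (\<Sum>k\<in>UNIV. v (x + s *\<^sub>R z) $ k * v' k (x + s *\<^sub>R z) $ j))"
    by (simp add: NS sum_distrib_left algebra_simps)
  then show ?thesis using i i2
    by (simp add: Bochner_Integration.integral_diff Bochner_Integration.integral_sum)
qed

text \<open>The linear term drops out of the Poisson equation for the pressure by incompressibility;
  testing with the radial kernel \<open>bump 5\<close>, whose gradient is \<open>- 10 z\<close> times \<open>bump 4\<close>,
  gives the scale derivative of the mollified pressure.\<close>

lemma integral_radial_pressure_derivative: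
  assumes s: "s \<noteq> 0"
  shows "(LBINT z. bump 4 z * (\<Sum>j\<in>UNIV. z $ j * q' j (x + s *\<^sub>R z))) =
    - (1 / (10 * s)) * (\<Sum>j\<in>UNIV. \<Sum>k\<in>UNIV. LBINT z. ker2 j k z * (v (x + s *\<^sub>R z) $ k * v (x + s *\<^sub>R z) $ j))"
proof -
  let ?v = "\<lambda>z. v (x + s *\<^sub>R z)" and ?v' = "\<lambda>k z. v' k (x + s *\<^sub>R z)" and ?v'' = "\<lambda>j k z. v'' j k (x + s *\<^sub>R z)"
  have lap: "s\<^sup>2 * (LBINT z. ker1 j z * ?v'' k k z $ j) = (LBINT z. ker3 j k k z * ?v z $ j)" for j k
    by (rule integral_laplacian_shift[OF C1_grad_ker1 C1_grad_ker2 ker_outside(1,2)])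
  \<comment> \<open>The viscous part: with three derivatives on \<open>bump 5\<close>, one can be
    returned to \<open>v\<close> as its divergence.\<close>
  have "(\<Sum>j\<in>UNIV. LBINT z. ker3 j k k z * ?v z $ j) = 0" for k
  proof -
    have "(LBINT z. ker3 j k k z * ?v z $ j) = - (LBINT z. ker2 k k z * (s * ?v' j z $ j))" for j
      using integral_by_parts[OF C1_grad_ker2[of k k] ker_outside(2) C1_line_v, where R = 1 and j = j and x1 = x and s1 = s and i1 = j] by (simp add: ker3_commute[of j k])
    then have "(\<Sum>j\<in>UNIV. LBINT z. ker3 j k k z * ?v z $ j) = - (\<Sum>j\<in>UNIV. LBINT z. ker2 k k z * (s * ?v' j z $ j))"
      by (simp add: sum_negf)
    also have "(\<Sum>j\<in>UNIV. LBINT z. ker2 k k z * (s * ?v' j z $ j)) = (LBINT z. (\<Sum>j\<in>UNIV. ker2 k k z * (s * ?v' j z $ j)))"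
      by (intro Bochner_Integration.integral_sum[symmetric] bbs_integrable bbs_mult_lbb bbs_ker lbb_mult lbb_const lbb_shift)
    also have "(\<lambda>z. \<Sum>j\<in>UNIV. ker2 k k z * (s * ?v' j z $ j)) = (\<lambda>z. 0)"
      by (simp add: sum_distrib_left[symmetric] mult.assoc[symmetric] div0)
    finally show ?thesis by simp
  qed
  then have "(\<Sum>j\<in>UNIV. \<Sum>k\<in>UNIV. s\<^sup>2 * (LBINT z. ker1 j z * ?v'' k k z $ j)) = 0"
    unfolding lap by (subst sum.swap) simp
  then have lap0: "(\<Sum>j\<in>UNIV. \<Sum>k\<in>UNIV. LBINT z. ker1 j z * ?v'' k k z $ j) = 0"
    using s by (simp add: sum_distrib_left[symmetric])
  have conv: "(LBINT z. ker1 j z * (\<Sum>k\<in>UNIV. ?v z $ k * ?v' k z $ j)) =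
      - (1 / s) * (\<Sum>k\<in>UNIV. LBINT z. ker2 j k z * (?v z $ k * ?v z $ j))" for j
    using integral_convective_shift[OF C1_grad_ker1[of j] ker_outside(1), of s x j] s by (simp add: field_simps)
  have "(\<Sum>j\<in>UNIV. LBINT z. ker1 j z * q' j (x + s *\<^sub>R z)) =
      \<nu> * (\<Sum>j\<in>UNIV. \<Sum>k\<in>UNIV. LBINT z. ker1 j z * ?v'' k k z $ j) -
      (\<Sum>j\<in>UNIV. LBINT z. ker1 j z * (\<Sum>k\<in>UNIV. ?v z $ k * ?v' k z $ j))"
    by (simp add: integral_pressure_gradient_shift[OF bbs_ker(1)] sum_subtractf sum_distrib_left)
  also have "\<dots> = (1 / s) * (\<Sum>j\<in>UNIV. \<Sum>k\<in>UNIV. LBINT z. ker2 j k z * (?v z $ k * ?v z $ j))"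
    unfolding lap0 conv by (simp add: sum_distrib_left sum_negf)
  finally have *: "(\<Sum>j\<in>UNIV. LBINT z. ker1 j z * q' j (x + s *\<^sub>R z)) =
    (1 / s) * (\<Sum>j\<in>UNIV. \<Sum>k\<in>UNIV. LBINT z. ker2 j k z * (?v z $ k * ?v z $ j))" .
  have "(LBINT z. bump 4 z * (\<Sum>j\<in>UNIV. z $ j * q' j (x + s *\<^sub>R z))) =
      (LBINT z. - (1 / 10) * (\<Sum>j\<in>UNIV. ker1 j z * q' j (x + s *\<^sub>R z)))"
    by (simp add: ker1_def sum_distrib_left ac_simps)
  also have "\<dots> = - (1 / 10) * (\<Sum>j\<in>UNIV. LBINT z. ker1 j z * q' j (x + s *\<^sub>R z))"
    by (subst integral_mult_right_zero, subst Bochner_Integration.integral_sum)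
      (auto intro!: bbs_integrable bbs_mult_lbb bbs_ker lbb_shift)
  finally show ?thesis unfolding * by simp
qed

end

section \<open>Energy identity\<close>

context navier_stokes
begin

text \<open>Taking the inner product of the equation with \<open>v\<close> shows that the flux field
  \<open>B\<close> has divergence \<open>- \<nu>\<close> times the squared gradient; testing this
  with \<open>\<phi>\<close> gives the identity.\<close>

lemma energy_identity:
  assumes \<phi>: "C1_grad \<phi> \<phi>1" "\<And>x. norm x > R \<Longrightarrow> \<phi> x = 0"
  shows "\<nu> * (LBINT x. \<phi> x * (grad_abs v' x)\<^sup>2) =
    (LBINT x. (\<Sum>j\<in>UNIV. \<phi>1 j x * (- \<nu> * (v' j x \<bullet> v x) + (v x \<bullet> v x / 2 + q x) * v x $ j)))"
proof -
  define B where "B j x = - \<nu> * (v' j x \<bullet> v x) + ((1/2) * (v x \<bullet> v x) + q x) * v x $ j" for j x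
  define B' where "B' j k x = - \<nu> * (v'' j k x \<bullet> v x + v' j x \<bullet> v' k x) +
    (((1/2) * (v' k x \<bullet> v x + v x \<bullet> v' k x) + q' k x) * v x $ j + ((1/2) * (v x \<bullet> v x) + q x) * v' k x $ j)" for j k x
  have B: "C1_grad (B j) (B' j)" for j
    unfolding B_def[abs_def] B'_def[abs_def]
    by (intro C1_grad_add C1_grad_cmult C1_grad_mult C1_grad_inner C1v C1v' C1q C1_grad_nth)
  have supp: "\<phi>1 j x = 0" if "norm x > R" for j x
    by (rule C1_grad_eq_0[OF \<phi>(1), of "- cball 0 R"]) (use that \<phi>(2) in auto)
  have b1: "bbs (\<phi>1 j)" for j
    by (rule bbs_continuous[OF C1_grad_partial_continuous[OF \<phi>(1)] supp])
  have b0: "bbs \<phi>" by (rule bbs_continuous[OF C1_grad_continuous[OF \<phi>(1)] \<phi>(2)])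
  have "(LBINT x. (\<Sum>j\<in>UNIV. \<phi>1 j x * B j x)) = (\<Sum>j\<in>UNIV. LBINT x. \<phi>1 j x * B j x)"
    by (intro Bochner_Integration.integral_sum bbs_integrable bbs_mult_lbb b1 lbb_continuous C1_grad_continuous[OF B])
  also have "\<dots> = - (\<Sum>j\<in>UNIV. LBINT x. \<phi> x * B' j j x)"
    by (simp add: integral_by_parts[OF \<phi> B] sum_negf)
  also have "(\<Sum>j\<in>UNIV. LBINT x. \<phi> x * B' j j x) = (LBINT x. (\<Sum>j\<in>UNIV. \<phi> x * B' j j x))"
    by (intro Bochner_Integration.integral_sum[symmetric] bbs_integrable bbs_mult_lbb b0 lbb_continuous
        C1_grad_partial_continuous[OF B])
  also have "(\<lambda>x. \<Sum>j\<in>UNIV. \<phi> x * B' j j x) = (\<lambda>x. - \<nu> * (\<phi> x * (grad_abs v' x)\<^sup>2))"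
  proof
    fix x
    \<comment> \<open>\<open>L\<close> and \<open>N\<close> are the components of the Laplacian and
      of the transport term; both cancel against the pressure gradient, and the last sum is the
      divergence.\<close>
    define L where "L i = (\<Sum>k\<in>UNIV. v'' k k x $ i)" for i
    define N where "N i = (\<Sum>k\<in>UNIV. v x $ k * v' k x $ i)" for i
    have q': "q' i x = \<nu> * L i - N i" for i by (simp add: NS L_def N_def)
    have "(\<Sum>j\<in>UNIV. v'' j j x \<bullet> v x) = (\<Sum>i\<in>UNIV. L i * v x $ i)"
      by (simp add: inner_vec_def L_def sum_distrib_right) (rule sum.swap)
    moreover have "(\<Sum>j\<in>UNIV. (v' j x \<bullet> v x) * v x $ j) = (\<Sum>i\<in>UNIV. N i * v x $ i)"
      by (simp add: inner_vec_def N_def sum_distrib_left ac_simps) (subst sum.swap, simp add: ac_simps)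
    moreover have "(\<Sum>j\<in>UNIV. q' j x * v x $ j) = \<nu> * (\<Sum>i\<in>UNIV. L i * v x $ i) - (\<Sum>i\<in>UNIV. N i * v x $ i)"
      by (simp add: q' sum_subtractf sum_distrib_left algebra_simps)
    moreover have "(\<Sum>j\<in>UNIV. v' j x \<bullet> v' j x) = (grad_abs v' x)\<^sup>2"
      by (simp add: grad_abs_square power2_norm_eq_inner)
    moreover have "(\<Sum>j\<in>UNIV. B' j j x) = - \<nu> * ((\<Sum>j\<in>UNIV. v'' j j x \<bullet> v x) + (\<Sum>j\<in>UNIV. v' j x \<bullet> v' j x)) +
        (\<Sum>j\<in>UNIV. (v' j x \<bullet> v x) * v x $ j) + (\<Sum>j\<in>UNIV. q' j x * v x $ j) +
        ((1/2) * (v x \<bullet> v x) + q x) * (\<Sum>j\<in>UNIV. v' j x $ j)"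
      by (simp add: B'_def sum.distrib sum_distrib_left sum_subtractf sum_negf sum_divide_distrib inner_commute algebra_simps)
    ultimately have "(\<Sum>j\<in>UNIV. B' j j x) = - \<nu> * (grad_abs v' x)\<^sup>2"
      by (simp add: div0 algebra_simps)
    then show "(\<Sum>j\<in>UNIV. \<phi> x * B' j j x) = - \<nu> * (\<phi> x * (grad_abs v' x)\<^sup>2)"
      by (simp add: sum_distrib_left[symmetric])
  qed
  finally show ?thesis by (simp add: B_def)
qed

text \<open>Incompressibility makes the test function of the pressure mean free, so constants may be
  subtracted from the mollified pressure.\<close>

lemma flux_eq_0:
  assumes \<phi>: "C1_grad \<phi> \<phi>1" "\<And>x. norm x > R \<Longrightarrow> \<phi> x = 0"
  shows "(LBINT x. (\<Sum>j\<in>UNIV. \<phi>1 j x * v x $ j)) = 0"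
proof -
  have supp: "\<phi>1 j x = 0" if "norm x > R" for j x
    by (rule C1_grad_eq_0[OF \<phi>(1), of "- cball 0 R"]) (use that \<phi>(2) in auto)
  have b1: "bbs (\<phi>1 j)" for j
    by (rule bbs_continuous[OF C1_grad_partial_continuous[OF \<phi>(1)] supp])
  have b0: "bbs \<phi>" by (rule bbs_continuous[OF C1_grad_continuous[OF \<phi>(1)] \<phi>(2)])
  have "(LBINT x. (\<Sum>j\<in>UNIV. \<phi>1 j x * v x $ j)) = (\<Sum>j\<in>UNIV. LBINT x. \<phi>1 j x * v x $ j)"
    by (intro Bochner_Integration.integral_sum bbs_integrable bbs_mult_lbb b1 lbb_continuous
      C1_grad_continuous[OF C1_grad_nth[OF C1v]])
  also have "\<dots> = - (\<Sum>j\<in>UNIV. LBINT x. \<phi> x * v' j x $ j)"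
    by (simp add: integral_by_parts[OF \<phi> C1_grad_nth[OF C1v]] sum_negf)
  also have "(\<Sum>j\<in>UNIV. LBINT x. \<phi> x * v' j x $ j) = (LBINT x. (\<Sum>j\<in>UNIV. \<phi> x * v' j x $ j))"
    by (intro Bochner_Integration.integral_sum[symmetric] bbs_integrable bbs_mult_lbb b0 lbb_continuous
      C1_grad_partial_continuous[OF C1_grad_nth[OF C1v]])
  also have "\<dots> = 0" by (simp add: sum_distrib_left[symmetric] div0)
  finally show ?thesis by simp
qed

definition pressure_mean :: "real \<Rightarrow> real^3 \<Rightarrow> real" where
  "pressure_mean s x = (LBINT z. bump 4 z * q (x + s *\<^sub>R z))"

lemma lbb_velocity_product: "lbb (\<lambda>x. v x $ k * v x $ j)"
  by (intro lbb_mult lbb_continuous continuous_intros continuous_v)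

text \<open>The scale derivative of the mollified pressure is integrated from 0 to
  \<open>\<epsilon>\<close>, split at \<open>s0\<close>. Below \<open>s0\<close> one derivative of
  the kernel goes to \<open>f\<close>, which offsets the factor \<open>1 / s\<close>; above
  \<open>s0\<close> the function \<open>f\<close> itself is averaged and \<open>1 / s\<close> is
  harmless.\<close>

lemma pressure_mean_variation:
  assumes f: "C1_grad f f'" and supp: "\<And>x. x \<notin> shell \<epsilon> \<Longrightarrow> f x = 0"
    and s0: "0 < s0" "s0 \<le> \<epsilon>" and p: "1 \<le> p" "p < 3"
    and \<alpha>: "(LBINT x. (indicator (shell (2 * \<epsilon>)) x * norm (v x)) ^ 3) = \<alpha> ^ 3" "\<alpha> \<ge> 0"
    and \<Lambda>: "(LBINT x. \<bar>f x\<bar> powr p) \<le> \<Lambda> powr p" "\<Lambda> \<ge> 0"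
    and \<Delta>: "(LBINT x. (grad_abs f' x)\<^sup>2) \<le> \<Delta>\<^sup>2" "\<Delta> \<ge> 0"
  shows "\<bar>(LBINT x. f x * pressure_mean \<epsilon> x) - bump_mass * (LBINT x. f x * q x)\<bar> \<le>
    (36 * ball_vol powr (5/6) + 162 * ball_vol powr ((4 - 3 / p) / 3) / (3 / p - 1)) * \<alpha>\<^sup>2 *
      (sqrt s0 * \<Delta> + s0 powr (1 - 3 / p) * \<Lambda>)"
proof -
  define a where "a x = indicator (shell (2 * \<epsilon>)) x * norm (v x)" for x
  define W where "W j k x = indicator (shell (2 * \<epsilon>)) x * (v x $ k * v x $ j)" for j k x
  have a: "bbs a" "a x \<ge> 0" for x
    unfolding a_def by (intro bbs_mult_lbb bbs_indicator_shell lbb_continuous continuous_intros continuous_v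
      | simp add: indicator_def)+
  have W: "bbs (W j k)" for j k
    unfolding W_def[abs_def] by (intro bbs_mult_lbb bbs_indicator_shell lbb_velocity_product)
  have Wa: "\<bar>W j k x\<bar> \<le> (a x)\<^sup>2" for j k x
    using component_le_norm_cart[of "v x" k] component_le_norm_cart[of "v x" j]
    by (auto simp: W_def a_def power2_eq_square indicator_def abs_mult intro!: mult_mono)
  have supp': "f' j x = 0" if "x \<notin> shell \<epsilon>" for j x
    by (rule C1_grad_eq_0[OF f, of "- shell \<epsilon>"]) (use that supp closed_shell in auto)
  obtain R where R: "\<And>x. x \<in> shell \<epsilon> \<Longrightarrow> norm x \<le> R"
    using bounded_shell[of \<epsilon>] unfolding bounded_iff by blast
  have bf: "bbs f" and bf': "bbs (f' j)" for j
    using R supp supp' by (intro bbs_continuous[where R = R] C1_grad_continuous[OF f]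
      C1_grad_partial_continuous[OF f]; force)+
  have g0: "grad_abs f' x = 0" if "x \<notin> shell \<epsilon>" for x
    using supp'[OF that] by (simp add: grad_abs_def)
  have bg: "bbs (grad_abs f')"
    using R g0 by (intro bbs_continuous[where R = R] continuous_grad_abs[OF f]) force
  have b4: "bbs (bump 4)" by (rule bbs_bump) simp
  define G where "G s = (LBINT x. (LBINT z. f x * bump 4 z * q (x + s *\<^sub>R z)))" for s
  define G' where "G' s = (LBINT x. (LBINT z. f x * bump 4 z *
      (\<Sum>j\<in>UNIV. z $ j * q' j (x + s *\<^sub>R z))))" for s
  have der: "(G has_real_derivative G' s) (at s)" for s
    unfolding G_def[abs_def] G'_def by (rule pairing_has_derivative[OF bf b4 C1q])
  define T where "T j k s = (LBINT x. (LBINT z. f x * ker2 j k z * (v (x + s *\<^sub>R z) $ k * v (x + s *\<^sub>R z) $ j)))" for j k s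
  have G'_T: "G' s = - (1 / (10 * s)) * (\<Sum>j\<in>UNIV. \<Sum>k\<in>UNIV. T j k s)" if "s \<noteq> 0" for s
  proof -
    have "(LBINT z. f x * bump 4 z * (\<Sum>j\<in>UNIV. z $ j * q' j (x + s *\<^sub>R z))) =
        - (1 / (10 * s)) * (\<Sum>j\<in>UNIV. \<Sum>k\<in>UNIV. LBINT z. f x * ker2 j k z * (v (x + s *\<^sub>R z) $ k * v (x + s *\<^sub>R z) $ j))" for x
    proof -
      have "(LBINT z. f x * bump 4 z * (\<Sum>j\<in>UNIV. z $ j * q' j (x + s *\<^sub>R z))) =
          f x * (LBINT z. bump 4 z * (\<Sum>j\<in>UNIV. z $ j * q' j (x + s *\<^sub>R z)))"
        by (simp only: mult.assoc integral_mult_right_zero)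
      moreover have "(LBINT z. f x * ker2 j k z * (v (x + s *\<^sub>R z) $ k * v (x + s *\<^sub>R z) $ j)) =
          f x * (LBINT z. ker2 j k z * (v (x + s *\<^sub>R z) $ k * v (x + s *\<^sub>R z) $ j))" for j k
        by (simp only: mult.assoc integral_mult_right_zero)
      ultimately show ?thesis unfolding integral_radial_pressure_derivative[OF that]
        by (simp add: sum_distrib_left ac_simps)
    qed
    moreover have "integrable lborel (\<lambda>x. LBINT z. f x * ker2 j k z * (v (x + s *\<^sub>R z) $ k * v (x + s *\<^sub>R z) $ j))" for j k
      by (rule Fubini_bbs(3)[OF bbs_pair_shift[OF bf bbs_ker(2) lbb_velocity_product]])
    ultimately show ?thesis
      by (simp add: G'_def T_def Bochner_Integration.integral_sum)
  qed
  \<comment> \<open>After the swap the velocities sit at a point within distance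
    \<open>\<epsilon>\<close> of the support of \<open>f\<close>, hence in the shell of half-width
    \<open>2 * \<epsilon>\<close>, and \<open>W\<close> may replace their product.\<close>
  have T_eq: "T j k s = (LBINT y. (LBINT z. W j k y * ker2 j k z * f (y + (- s) *\<^sub>R z)))"
    if "0 < s" "s \<le> \<epsilon>" for j k s
  proof -
    have "T j k s = (LBINT y. (LBINT z. v y $ k * v y $ j * ker2 j k z * f (y + (- s) *\<^sub>R z)))"
      unfolding T_def using pairing_swap[OF bf bbs_ker(2) lbb_velocity_product] by simp
    also have "(\<lambda>y. LBINT z. v y $ k * v y $ j * ker2 j k z * f (y + (- s) *\<^sub>R z)) =
        (\<lambda>y. LBINT z. W j k y * ker2 j k z * f (y + (- s) *\<^sub>R z))"
    proof (intro ext Bochner_Integration.integral_cong refl)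
      fix y z
      show "v y $ k * v y $ j * ker2 j k z * f (y + (- s) *\<^sub>R z) = W j k y * ker2 j k z * f (y + (- s) *\<^sub>R z)"
      proof (cases "norm z \<le> 1 \<and> y + (- s) *\<^sub>R z \<in> shell \<epsilon>")
        case True
        then have "(y + (- s) *\<^sub>R z) + s *\<^sub>R z \<in> shell (\<epsilon> + \<epsilon>)"
          using that by (intro shell_shift) auto
        then show ?thesis by (simp add: W_def)
      next
        case False
        then show ?thesis using supp ker_outside(2)[of z] by (auto simp del: scaleR_minus_left)
      qed
    qed
    finally show ?thesis .
  qed
  have lf: "lbb (\<lambda>(x::real^3, z). f (x + (- s) *\<^sub>R z))" "lbb (\<lambda>(x::real^3, z). f' k (x + (- s) *\<^sub>R z))" for s k
    unfolding case_prod_unfold by (intro lbb_compose[OF bbs_imp_lbb[OF bf]] lbb_compose[OF bbs_imp_lbb[OF bf']] continuous_intros)+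
  have T_large: "\<bar>T j k s\<bar> \<le> 2 * 90 * \<alpha>\<^sup>2 * (ball_vol powr ((4 - 3 / p) / 3) * s powr (1 - 3 / p) * \<Lambda>)"
    if s: "0 < s" "s \<le> \<epsilon>" for j k s
  proof -
    have "\<bar>T j k s\<bar> \<le> 2 * 90 * \<alpha>\<^sup>2 * (ball_vol powr ((4 - 3 / p) / 3) * \<bar>- s\<bar> powr (1 - 3 / p) * \<Lambda>)"
      unfolding T_eq[OF s]
    proof (rule pairing_le[where a = a and H = "\<lambda>x. \<bar>f x\<bar>"])
      show "bbs (\<lambda>x. \<bar>f x\<bar>)" by (rule bbs_abs[OF bf])
    qed (use W Wa a bbs_ker ker_bound lf \<alpha> \<Lambda> p s in \<open>auto simp: a_def\<close>)
    then show ?thesis using s by simp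
  qed
  \<comment> \<open>Integrating by parts replaces \<open>ker2\<close> by \<open>ker1\<close> and
    releases a factor \<open>s\<close>, because \<open>f\<close> is evaluated at
    \<open>y - s *\<^sub>R z\<close>.\<close>
  have T_small: "\<bar>T j k s\<bar> \<le> s * (2 * 10 * \<alpha>\<^sup>2 * (ball_vol powr (5/6) * s powr (-1/2) * \<Delta>))"
    if s: "0 < s" "s \<le> \<epsilon>" for j k s
  proof -
    have "(LBINT z. W j k y * ker2 j k z * f (y + (- s) *\<^sub>R z)) =
        s * (LBINT z. W j k y * ker1 j z * f' k (y + (- s) *\<^sub>R z))" for y
    proof -
      have "(LBINT z. ker2 j k z * f (y + (- s) *\<^sub>R z)) =
          - (LBINT z. ker1 j z * ((- s) *\<^sub>R f' k (y + (- s) *\<^sub>R z)))"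
        by (rule integral_by_parts[OF C1_grad_ker1 ker_outside(1) C1_grad_affine[OF f], where R = 1])
      also have "\<dots> = (LBINT z. s * (ker1 j z * f' k (y + (- s) *\<^sub>R z)))"
        by (simp add: mult.left_commute)
      also have "\<dots> = s * (LBINT z. ker1 j z * f' k (y + (- s) *\<^sub>R z))"
        by (simp only: integral_mult_right_zero)
      finally show ?thesis
        by (simp only: mult.assoc integral_mult_right_zero mult.left_commute[of s])
    qed
    then have "T j k s = s * (LBINT y. (LBINT z. W j k y * ker1 j z * f' k (y + (- s) *\<^sub>R z)))"
      unfolding T_eq[OF s] by (simp only: integral_mult_right_zero)
    moreover have "\<bar>LBINT y. (LBINT z. W j k y * ker1 j z * f' k (y + (- s) *\<^sub>R z))\<bar> \<le>
        2 * 10 * \<alpha>\<^sup>2 * (ball_vol powr ((4 - 3 / 2) / 3) * \<bar>- s\<bar> powr (1 - 3 / 2) * \<Delta>)"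
    proof (rule pairing_le[where a = a and H = "grad_abs f'"])
      show "\<bar>f' k (x + - s *\<^sub>R z)\<bar> \<le> grad_abs f' (x + - s *\<^sub>R z)" for x z
        using norm_le_grad_abs[of f' k] by simp
      show "(LBINT x. grad_abs f' x powr 2) \<le> \<Delta> powr 2"
        using \<Delta> grad_abs_nonneg[of f'] by (simp add: powr_numeral)
    qed (use W Wa a bbs_ker ker_bound lf \<alpha> \<Delta>(2) bg grad_abs_nonneg s in \<open>auto simp: a_def\<close>)
    ultimately show ?thesis using s by (simp add: abs_mult)
  qed
  \<comment> \<open>Nine index pairs, and the factor \<open>1 / (10 * s)\<close> from the scale
    derivative.\<close>
  have sum9: "\<bar>G' s\<bar> \<le> 9 / (10 * s) * Y" if "0 < s" "\<And>j k. \<bar>T j k s\<bar> \<le> Y" for s Y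
  proof -
    have "\<bar>\<Sum>j\<in>UNIV. \<Sum>k\<in>UNIV. T j k s\<bar> \<le> (\<Sum>j\<in>(UNIV::3 set). \<Sum>k\<in>(UNIV::3 set). Y)"
      by (intro order_trans[OF sum_abs] sum_mono that)
    then have "\<bar>\<Sum>j\<in>UNIV. \<Sum>k\<in>UNIV. T j k s\<bar> \<le> 9 * Y" by simp
    then have "(1 / (10 * s)) * \<bar>\<Sum>j\<in>UNIV. \<Sum>k\<in>UNIV. T j k s\<bar> \<le> (1 / (10 * s)) * (9 * Y)"
      using that by (intro mult_left_mono) auto
    then show ?thesis using that G'_T[of s] by (simp add: abs_mult)
  qed
  have small: "\<bar>G s0 - G 0\<bar> \<le> 2 * (18 * \<alpha>\<^sup>2 * (ball_vol powr (5/6) * \<Delta>)) * sqrt s0"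
  proof (rule powr_half_growth[OF der _ s0(1)])
    fix s assume s: "0 < s" "s < s0"
    have "\<bar>G' s\<bar> \<le> 9 / (10 * s) * (s * (2 * 10 * \<alpha>\<^sup>2 * (ball_vol powr (5/6) * s powr (-1/2) * \<Delta>)))"
      using s s0 by (intro sum9 T_small) auto
    then show "\<bar>G' s\<bar> \<le> 18 * \<alpha>\<^sup>2 * (ball_vol powr (5/6) * \<Delta>) * s powr (-1/2)"
      using s by (simp add: ac_simps)
  qed
  have large: "\<bar>G \<epsilon> - G s0\<bar> \<le> (162 * \<alpha>\<^sup>2 * (ball_vol powr ((4 - 3 / p) / 3) * \<Lambda>)) / (3 / p - 1) * s0 powr (- (3 / p - 1))"
  proof (rule powr_growth[OF der _ s0])
    fix s assume s: "s0 < s" "s < \<epsilon>"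
    have "\<bar>G' s\<bar> \<le> 9 / (10 * s) * (2 * 90 * \<alpha>\<^sup>2 * (ball_vol powr ((4 - 3 / p) / 3) * s powr (1 - 3 / p) * \<Lambda>))"
      using s s0 by (intro sum9 T_large) auto
    \<comment> \<open>Together with \<open>1 / s\<close> this leaves the power
      \<open>- (3 / p - 1) - 1\<close>, integrable at infinity since \<open>p < 3\<close>.\<close>
    also have "s powr (1 - 3 / p) = s * s powr (- (3 / p - 1) - 1)"
      using s s0 powr_add[of s 1 "- (3 / p - 1) - 1"] by simp
    finally show "\<bar>G' s\<bar> \<le> 162 * \<alpha>\<^sup>2 * (ball_vol powr ((4 - 3 / p) / 3) * \<Lambda>) * s powr (- (3 / p - 1) - 1)"
      using s s0 by (simp add: ac_simps)
  qed (use p \<Lambda> in \<open>auto simp: field_simps\<close>)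
  have "G 0 = bump_mass * (LBINT x. f x * q x)"
  proof -
    have "(LBINT z. f x * bump 4 z * q (x + 0 *\<^sub>R z)) = bump_mass * (f x * q x)" for x
      by (subst integral_mult_left_zero[symmetric]) (simp add: ac_simps)
    then show ?thesis unfolding G_def by (simp only: integral_mult_right_zero)
  qed
  moreover have "G \<epsilon> = (LBINT x. f x * pressure_mean \<epsilon> x)"
    unfolding G_def pressure_mean_def by (simp only: mult.assoc integral_mult_right_zero)
  moreover have "\<bar>G \<epsilon> - G 0\<bar> \<le> 36 * ball_vol powr (5/6) * \<alpha>\<^sup>2 * (sqrt s0 * \<Delta>) +
      162 * ball_vol powr ((4 - 3 / p) / 3) / (3 / p - 1) * \<alpha>\<^sup>2 * (s0 powr (1 - 3 / p) * \<Lambda>)"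
    using small large by (simp add: ac_simps)
  moreover have "\<dots> \<le> (36 * ball_vol powr (5/6) + 162 * ball_vol powr ((4 - 3 / p) / 3) / (3 / p - 1)) * \<alpha>\<^sup>2 *
      (sqrt s0 * \<Delta> + s0 powr (1 - 3 / p) * \<Lambda>)"
  proof -
    have *: "A * x * X + B * x * Y \<le> (A + B) * x * (X + Y)"
      if "A \<ge> 0" "B \<ge> 0" "x \<ge> 0" "X \<ge> 0" "Y \<ge> 0" for A B x X Y :: real
      using that by (simp add: algebra_simps)
    show ?thesis by (rule *) (use p \<Delta> \<Lambda> s0 in \<open>auto simp: field_simps\<close>)
  qed
  ultimately show ?thesis by linarith
qed

end

section \<open>Cutoffs and oscillation on a shell\<close>

lemma C1_grad_compose_real:
  fixes f :: "real^3 \<Rightarrow> real" and g g' :: "real \<Rightarrow> real"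
  assumes f: "C1_grad f f'" and g: "\<And>t. (g has_real_derivative g' t) (at t)" "continuous_on UNIV g'"
  shows "C1_grad (\<lambda>x. g (f x)) (\<lambda>j x. g' (f x) * f' j x)"
proof (rule C1_gradI)
  show "((\<lambda>x. g (f x)) has_derivative (\<lambda>h. g' (f x) * (\<Sum>j\<in>UNIV. h $ j *\<^sub>R f' j x))) (at x)" for x
    by (rule has_derivative_compose[OF C1_gradD[OF f] g(1)[unfolded has_field_derivative_def]])
  show "g' (f x) * (\<Sum>j\<in>UNIV. h $ j *\<^sub>R f' j x) = (\<Sum>j\<in>UNIV. h $ j *\<^sub>R (g' (f x) * f' j x))" for x h
    by (simp add: sum_distrib_left ac_simps)
  show "continuous_on UNIV (\<lambda>x. g' (f x) * f' j x)" for j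
    by (intro continuous_intros C1_grad_partial_continuous[OF f]
      continuous_on_compose2[OF g(2) C1_grad_continuous[OF f]]) auto
qed

lemma C1_grad_norm_square: "C1_grad (\<lambda>x. x \<bullet> x) (\<lambda>j x. 2 * x $ j)"
proof (rule C1_gradI)
  show "((\<lambda>x. x \<bullet> x) has_derivative (\<lambda>h. x \<bullet> h + h \<bullet> x)) (at x)" for x :: "real^3"
    by (auto intro!: derivative_eq_intros)
  show "x \<bullet> h + h \<bullet> x = (\<Sum>j\<in>UNIV. h $ j *\<^sub>R (2 * x $ j))" for x h :: "real^3"
    by (simp add: inner_vec_def sum.distrib[symmetric] ac_simps)
qed (intro continuous_intros)

text \<open>The cutoff is a primitive of a squared truncated parabola, taken in the variable
  \<open>x \<bullet> x\<close>. Its inner value \<open>c\<close> is the increment of the primitive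
  and is left unnormalised.\<close>

lemma cutoff_exists:
  assumes "0 < \<epsilon>" "\<epsilon> < 1"
  obtains c :: real and \<phi> \<phi>1 \<phi>2 where "c > 0" "C1_grad \<phi> \<phi>1" "\<And>j. C1_grad (\<phi>1 j) (\<phi>2 j)" "\<And>x. \<phi> x \<ge> 0"
    "\<And>x. norm x \<le> 1 - \<epsilon> \<Longrightarrow> \<phi> x = c" "\<And>x. norm x > 1 + \<epsilon> \<Longrightarrow> \<phi> x = 0"
    "\<And>j x. x \<notin> shell \<epsilon> \<Longrightarrow> \<phi>1 j x = 0"
proof -
  define a b where "a = (1 - \<epsilon>)\<^sup>2" and "b = (1 + \<epsilon>)\<^sup>2"
  have ab: "a < b" using assms by (simp_all add: a_def b_def power2_eq_square algebra_simps)
  \<comment> \<open>Positive exactly between the squared radii \<open>a\<close> and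
    \<open>b\<close>; the square makes the truncation continuously differentiable, so the cutoff has
    two continuous derivatives.\<close>
  define w where "w t = (max 0 ((t - a) * (b - t))) ^ 2" for t
  define w' where "w' t = 2 * max 0 ((t - a) * (b - t)) * (a + b - 2 * t)" for t
  have w: "(w has_real_derivative w' t) (at t)" for t
  proof -
    have "((\<lambda>t. (t - a) * (b - t)) has_real_derivative (a + b - 2 * t)) (at t)"
      by (auto intro!: derivative_eq_intros)
    from DERIV_chain2[OF DERIV_max_0_power[of 0] this] show ?thesis
      by (simp add: w_def[abs_def] w'_def eval_nat_numeral)
  qed
  have cw: "continuous_on UNIV w" "continuous_on UNIV w'"
    unfolding w_def[abs_def] w'_def[abs_def] by (intro continuous_intros)+
  have "\<exists>F. \<forall>x::real. - \<infinity> < ereal x \<longrightarrow> ereal x < \<infinity> \<longrightarrow> (F has_vector_derivative w x) (at x)"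
    using cw(1) by (intro einterval_antiderivative) (auto simp: continuous_on_eq_continuous_at)
  then obtain F where F: "\<And>t. (F has_real_derivative w t) (at t)"
    by (auto simp: has_real_derivative_iff_has_vector_derivative)
  have mono: "F s \<le> F t" if "s \<le> t" for s t
    using F zero_le_power2 unfolding w_def by (intro DERIV_nonneg_imp_nondecreasing[OF that]) blast
  have w0: "w t = 0" if "t \<le> a \<or> t \<ge> b" for t
  proof -
    have "(t - a) * (b - t) \<le> 0" using that ab by (auto simp: mult_le_0_iff)
    then show ?thesis by (simp add: w_def max_def)
  qed
  have Fa: "F t = F a" if "t \<le> a" for t
  proof (cases "t = a")
    case False
    then have "t < a" using that by simp
    then obtain z where "t < z" "z < a" "F a - F t = (a - t) * w z"
      using MVT2[of t a F w] F by blast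
    then show ?thesis using w0[of z] by simp
  qed simp
  have Fb: "F t = F b" if "t \<ge> b" for t
  proof (cases "t = b")
    case False
    then have "b < t" using that by simp
    then obtain z where "b < z" "z < t" "F t - F b = (t - b) * w z"
      using MVT2[of b t F w] F by blast
    then show ?thesis using w0[of z] by simp
  qed simp
  have "F a < F b"
  proof -
    obtain z where z: "a < z" "z < b" "F b - F a = (b - a) * w z"
      using MVT2[OF ab, of F w] F by blast
    then have "w z > 0" by (simp add: w_def)
    then show ?thesis using z ab by (metis diff_gt_0_iff_gt mult_pos_pos)
  qed
  \<comment> \<open>The forms \<open>0 + ...\<close> and \<open>(- 1) * ...\<close> match the sum
    and product rules for \<open>C1_grad\<close> literally.\<close>
  define \<phi> where "\<phi> x = F b + (- 1) * F (x \<bullet> x)" for x :: "real^3"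
  define \<phi>1 where "\<phi>1 j x = 0 + (- 1) * (w (x \<bullet> x) * (2 * x $ j))" for j and x :: "real^3"
  define \<phi>2 where "\<phi>2 j k x = 0 + (- 1) * (w' (x \<bullet> x) * (2 * x $ k) * (2 * x $ j) + w (x \<bullet> x) * (2 * (if k = j then 1 else 0)))"
    for j k and x :: "real^3"
  have sq: "x \<bullet> x \<le> a \<longleftrightarrow> norm x \<le> 1 - \<epsilon>" "x \<bullet> x \<ge> b \<longleftrightarrow> norm x \<ge> 1 + \<epsilon>" for x :: "real^3"
    using assms unfolding a_def b_def power2_norm_eq_inner[symmetric]
    by (simp_all add: power2_le_iff_abs_le abs_le_square_iff[symmetric])
  show ?thesis
  proof (rule that[of "F b - F a" \<phi> \<phi>1 \<phi>2])
    show "F b - F a > 0" using \<open>F a < F b\<close> by simp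
    show "C1_grad \<phi> \<phi>1" unfolding \<phi>_def[abs_def] \<phi>1_def[abs_def]
      by (intro C1_grad_add C1_grad_const C1_grad_cmult C1_grad_compose_real[OF C1_grad_norm_square F cw(1)])
    show "C1_grad (\<phi>1 j) (\<phi>2 j)" for j unfolding \<phi>1_def[abs_def] \<phi>2_def[abs_def]
      by (intro C1_grad_add C1_grad_const C1_grad_cmult C1_grad_mult C1_grad_coord
        C1_grad_compose_real[OF C1_grad_norm_square w cw(2)])
    show "\<phi> x \<ge> 0" for x
      using mono[of "x \<bullet> x" b] Fb[of "x \<bullet> x"] by (cases "x \<bullet> x \<le> b") (auto simp: \<phi>_def)
    show "\<phi> x = F b - F a" if "norm x \<le> 1 - \<epsilon>" for x
      using Fa[of "x \<bullet> x"] sq(1)[of x] that by (simp add: \<phi>_def)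
    show "\<phi> x = 0" if "norm x > 1 + \<epsilon>" for x
      using Fb[of "x \<bullet> x"] sq(2)[of x] that by (simp add: \<phi>_def)
    show "\<phi>1 j x = 0" if "x \<notin> shell \<epsilon>" for j x
    proof -
      have "norm x \<le> 1 - \<epsilon> \<or> norm x \<ge> 1 + \<epsilon>" using that by (auto simp: shell_def)
      then have "w (x \<bullet> x) = 0" by (intro w0) (use sq in auto)
      then show ?thesis by (simp add: \<phi>1_def)
    qed
  qed
qed

lemma DERIV_bound_segment:
  fixes g :: "real \<Rightarrow> real"
  assumes "\<And>t. (g has_real_derivative D t) (at t)" "\<And>t. t \<in> closed_segment a b \<Longrightarrow> \<bar>D t\<bar> \<le> B"
  shows "\<bar>g b - g a\<bar> \<le> B * \<bar>b - a\<bar>"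
  using field_differentiable_bound[of "closed_segment a b" g D B b a] assms
  by (auto simp: has_field_derivative_at_within)

text \<open>Two points of the shell are joined by a radial segment, of length at most 2, and an arc
  of a great circle, of radius at most 2 and angle at most \<open>pi < 4\<close>; hence
  \<open>10 = 2 + 8\<close>. The hypothesis speaks of derivatives along curves, so no gradient of
  \<open>m\<close> has to be named.\<close>

lemma shell_oscillation:
  fixes m :: "real^3 \<Rightarrow> real"
  assumes \<epsilon>: "0 < \<epsilon>" "\<epsilon> < 1"
    and curve: "\<And>c c'. (\<And>t. (c has_vector_derivative c' t) (at t)) \<Longrightarrow> continuous_on UNIV c' \<Longrightarrow>
      \<exists>D. \<forall>t. ((\<lambda>t. m (c t)) has_real_derivative D t) (at t) \<and>
        (c t \<in> shell \<epsilon> \<longrightarrow> \<bar>D t\<bar> \<le> norm (c' t) * \<Gamma>)"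
    and xy: "x \<in> shell \<epsilon>" "y \<in> shell \<epsilon>"
  shows "\<bar>m x - m y\<bar> \<le> 10 * \<Gamma>"
proof -
  have pos: "norm x > 0" "norm y > 0" using xy \<epsilon> by (auto simp: shell_def)
  define e where "e = x /\<^sub>R norm x"
  define d where "d = y /\<^sub>R norm y"
  have ne: "norm e = 1" "norm d = 1" using pos by (simp_all add: e_def d_def)
  have xe: "x = norm x *\<^sub>R e" and yd: "y = norm y *\<^sub>R d" using pos by (simp_all add: e_def d_def)
  obtain D where D: "\<And>t. ((\<lambda>t. m (t *\<^sub>R e)) has_real_derivative D t) (at t)"
      "\<And>t. t *\<^sub>R e \<in> shell \<epsilon> \<Longrightarrow> \<bar>D t\<bar> \<le> norm e * \<Gamma>"
  proof -
    have "((\<lambda>t. t *\<^sub>R e) has_vector_derivative e) (at t)" for t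
      unfolding has_vector_derivative_def by (auto intro!: derivative_eq_intros)
    from curve[OF this] show ?thesis using that by auto
  qed
  have \<Gamma>: "\<Gamma> \<ge> 0" using D(2)[of "norm x"] xy(1) xe ne by (metis abs_ge_zero mult_1 order_trans)
  have "\<bar>m (norm y *\<^sub>R e) - m (norm x *\<^sub>R e)\<bar> \<le> \<Gamma> * \<bar>norm y - norm x\<bar>"
  proof (rule DERIV_bound_segment[OF D(1)])
    fix t assume "t \<in> closed_segment (norm x) (norm y)"
    then have "t *\<^sub>R e \<in> shell \<epsilon>"
      using xy \<epsilon> ne by (auto simp: shell_def closed_segment_eq_real_ivl split: if_splits)
    then show "\<bar>D t\<bar> \<le> \<Gamma>" using D(2) ne by simp
  qed
  also have "\<dots> \<le> \<Gamma> * 2" using xy \<epsilon> \<Gamma> by (intro mult_left_mono) (auto simp: shell_def)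
  finally have radial: "\<bar>m (norm y *\<^sub>R e) - m x\<bar> \<le> \<Gamma> * 2" using xe by simp
  define \<tau> where "\<tau> = arccos (e \<bullet> d)"
  have ed: "\<bar>e \<bullet> d\<bar> \<le> 1" using Cauchy_Schwarz_ineq2[of e d] ne by simp
  then have \<tau>: "0 \<le> \<tau>" "\<tau> \<le> pi" "cos \<tau> = e \<bullet> d"
    unfolding \<tau>_def by (auto intro: arccos_lbound arccos_ubound simp: abs_le_iff)
  have ee: "e \<bullet> e = 1" "d \<bullet> d = 1" using ne by (simp_all add: norm_eq_1)
  \<comment> \<open>\<open>e'\<close> completes \<open>e\<close> to an orthonormal basis of the
    plane of the arc. If \<open>sin \<tau>\<close> vanishes, \<open>d\<close> is a multiple of
    \<open>e\<close> and any unit vector orthogonal to \<open>e\<close> serves.\<close>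
  obtain e' where e': "e \<bullet> e' = 0" "e' \<bullet> e' = 1" "d = cos \<tau> *\<^sub>R e + sin \<tau> *\<^sub>R e'"
  proof (cases "sin \<tau> = 0")
    case True
    have "(d - cos \<tau> *\<^sub>R e) \<bullet> (d - cos \<tau> *\<^sub>R e) = 1 - (cos \<tau>)\<^sup>2"
      using ee \<tau>(3) by (simp add: inner_diff_left inner_diff_right inner_commute power2_eq_square)
    also have "\<dots> = 0" using True sin_squared_eq[of \<tau>] by simp
    finally have d: "d = cos \<tau> *\<^sub>R e" by simp
    obtain y :: "real^3" where y: "y \<noteq> 0" "orthogonal e y"
      using orthogonal_to_vector_exists[of e] by auto
    show ?thesis
      by (rule that[of "y /\<^sub>R norm y"]) (use y True d in \<open>auto simp: orthogonal_def power2_norm_eq_inner[symmetric] power2_eq_square field_simps\<close>)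
  next
    case False
    have "(d - cos \<tau> *\<^sub>R e) \<bullet> (d - cos \<tau> *\<^sub>R e) = 1 - (cos \<tau>)\<^sup>2"
      using ee \<tau>(3) by (simp add: inner_diff_left inner_diff_right inner_commute power2_eq_square)
    then have "(d - cos \<tau> *\<^sub>R e) \<bullet> (d - cos \<tau> *\<^sub>R e) = (sin \<tau>)\<^sup>2" by (simp add: sin_squared_eq)
    moreover have "e \<bullet> (d - cos \<tau> *\<^sub>R e) = 0" using ee \<tau>(3) by (simp add: inner_diff_right)
    moreover have "(k /\<^sub>R r) \<bullet> (k /\<^sub>R r) = (k \<bullet> k) / r\<^sup>2" for k :: "real^3" and r :: real
      by (simp add: divide_inverse power2_eq_square)
    ultimately show ?thesis
      using False by (intro that[of "(d - cos \<tau> *\<^sub>R e) /\<^sub>R sin \<tau>"]) (simp_all del: inner_scaleR_left inner_scaleR_right add: inner_scaleR_right[of e])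
  qed
  \<comment> \<open>The arc of radius \<open>norm y\<close> from the direction of \<open>x\<close>,
    at parameter 0, to \<open>y\<close>, at parameter \<open>\<tau>\<close>.\<close>
  define c where "c t = norm y *\<^sub>R (cos t *\<^sub>R e + sin t *\<^sub>R e')" for t
  define c' where "c' t = norm y *\<^sub>R (- sin t *\<^sub>R e + cos t *\<^sub>R e')" for t
  have norm_c: "norm (c t) = norm y" "norm (c' t) = norm y" for t
  proof -
    have "sin t * sin t + cos t * cos t = 1" "cos t * cos t + sin t * sin t = 1"
      using sin_cos_squared_add[of t] by (simp_all add: power2_eq_square)
    then have "(cos t *\<^sub>R e + sin t *\<^sub>R e') \<bullet> (cos t *\<^sub>R e + sin t *\<^sub>R e') = 1"
      "(- sin t *\<^sub>R e + cos t *\<^sub>R e') \<bullet> (- sin t *\<^sub>R e + cos t *\<^sub>R e') = 1"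
      using ee e' by (simp_all add: inner_add_left inner_add_right inner_diff_left inner_diff_right inner_commute)
    then have "norm (cos t *\<^sub>R e + sin t *\<^sub>R e') = 1" "norm (- sin t *\<^sub>R e + cos t *\<^sub>R e') = 1"
      by (simp_all only: norm_eq_1)
    then show "norm (c t) = norm y" "norm (c' t) = norm y"
      unfolding c_def c'_def norm_scaleR by simp_all
  qed
  have "(c has_vector_derivative c' t) (at t)" for t
    unfolding c_def[abs_def] c'_def by (auto intro!: derivative_eq_intros)
  moreover have "continuous_on UNIV c'" unfolding c'_def[abs_def] by (intro continuous_intros)
  ultimately obtain E where E: "\<And>t. ((\<lambda>t. m (c t)) has_real_derivative E t) (at t)"
      "\<And>t. c t \<in> shell \<epsilon> \<Longrightarrow> \<bar>E t\<bar> \<le> norm (c' t) * \<Gamma>"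
    using curve[of c c'] by blast
  have "\<bar>m (c \<tau>) - m (c 0)\<bar> \<le> (norm y * \<Gamma>) * \<bar>\<tau> - 0\<bar>"
  proof (rule DERIV_bound_segment[OF E(1)])
    show "\<bar>E t\<bar> \<le> norm y * \<Gamma>" for t
      using E(2)[of t] xy(2) norm_c by (simp add: shell_def)
  qed
  also have "\<dots> \<le> (2 * \<Gamma>) * 4"
    using xy(2) \<epsilon> \<Gamma> \<tau> pi_less_4 by (intro mult_mono mult_right_mono) (auto simp: shell_def)
  finally have arc: "\<bar>m (c \<tau>) - m (c 0)\<bar> \<le> 8 * \<Gamma>" by simp
  have "c 0 = norm y *\<^sub>R e" "c \<tau> = y" using e'(3) yd by (simp_all add: c_def)
  then show ?thesis using radial arc by (simp add: abs_le_iff)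
qed

context navier_stokes
begin

lemma pressure_mean_curve:
  assumes c: "\<And>t. (c has_vector_derivative c' t) (at t)" "continuous_on UNIV c'"
  shows "((\<lambda>t. pressure_mean s (c t)) has_real_derivative
    (\<Sum>j\<in>UNIV. c' t $ j * (LBINT z. bump 4 z * q' j (c t + s *\<^sub>R z)))) (at t)"
proof -
  have b4: "bbs (bump 4)" by (rule bbs_bump) simp
  have cc: "continuous_on UNIV c"
    using c(1) by (meson continuous_at_imp_continuous_on has_vector_derivative_continuous)
  let ?F = "\<lambda>t z. bump 4 z * q (c t + s *\<^sub>R z)"
  let ?F' = "\<lambda>t z. bump 4 z * (\<Sum>j\<in>UNIV. c' t $ j * q' j (c t + s *\<^sub>R z))"
  have lq: "lbb q" "lbb (q' j)" for j
    by (intro lbb_continuous C1_grad_continuous[OF C1q] C1_grad_partial_continuous[OF C1q])+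
  have "lbb (\<lambda>w::real \<times> (real^3). \<Sum>j\<in>UNIV. c' (fst w) $ j * q' j (c (fst w) + s *\<^sub>R snd w))"
    by (intro lbb_sum lbb_mult lbb_compose[OF lq(2)] lbb_continuous continuous_intros
      continuous_on_compose2[OF c(2)] continuous_on_compose2[OF cc]) auto
  \<comment> \<open>The radius \<open>\<bar>t\<bar> + 2\<close> covers parameters within 1 of
    \<open>t\<close> together with \<open>z\<close> in the unit ball.\<close>
  then have "\<exists>C. \<forall>w::real \<times> (real^3). norm w \<le> \<bar>t\<bar> + 2 \<longrightarrow>
      \<bar>\<Sum>j\<in>UNIV. c' (fst w) $ j * q' j (c (fst w) + s *\<^sub>R snd w)\<bar> \<le> C"
    unfolding lbb_def by blast
  then obtain C where C: "\<And>w::real \<times> (real^3). norm w \<le> \<bar>t\<bar> + 2 \<Longrightarrow>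
      \<bar>\<Sum>j\<in>UNIV. c' (fst w) $ j * q' j (c (fst w) + s *\<^sub>R snd w)\<bar> \<le> C" by blast
  have "((\<lambda>t. LBINT z. ?F t z) has_real_derivative (LBINT z. ?F' t z)) (at t)"
  proof (rule has_real_derivative_integral[where B = "\<lambda>z. bump 4 z * C"])
    show "integrable lborel (?F t)" for t
      by (intro bbs_integrable bbs_mult_lbb b4 lbb_compose[OF lq(1)] continuous_intros)
    show "((\<lambda>t. ?F t z) has_real_derivative ?F' t z) (at t)" for t z
    proof (rule DERIV_cmult)
      have "((\<lambda>t. c t + s *\<^sub>R z) has_derivative (\<lambda>h. h *\<^sub>R c' t)) (at t)"
        using c(1)[of t] unfolding has_vector_derivative_def by (auto intro!: derivative_eq_intros)
      from has_derivative_compose[OF this C1_gradD[OF C1q]]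
      have "((\<lambda>t. q (c t + s *\<^sub>R z)) has_derivative
        (\<lambda>h. \<Sum>j\<in>UNIV. (h *\<^sub>R c' t) $ j *\<^sub>R q' j (c t + s *\<^sub>R z))) (at t)" .
      moreover have "(\<lambda>h. \<Sum>j\<in>UNIV. (h *\<^sub>R c' t) $ j *\<^sub>R q' j (c t + s *\<^sub>R z)) =
        (*) (\<Sum>j\<in>UNIV. c' t $ j * q' j (c t + s *\<^sub>R z))"
        by (auto simp: sum_distrib_left sum_distrib_right ac_simps)
      ultimately show "((\<lambda>t. q (c t + s *\<^sub>R z)) has_real_derivative
          (\<Sum>j\<in>UNIV. c' t $ j * q' j (c t + s *\<^sub>R z))) (at t)"
        by (simp add: has_field_derivative_def)
    qed
    show "\<bar>?F' r z\<bar> \<le> bump 4 z * C" if "\<bar>r - t\<bar> \<le> 1" for r z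
    proof (cases "norm z \<le> 1")
      case True
      have "norm (r, z) \<le> norm r + norm z" by (rule norm_Pair_le)
      then have "norm (r, z) \<le> \<bar>t\<bar> + 2" using True that by simp
      from C[OF this] show ?thesis using bump_nonneg[of 4 z] by (simp add: abs_mult mult_left_mono)
    next
      case False
      then show ?thesis using bump_outside[of z 4] by simp
    qed
    show "integrable lborel (\<lambda>z. bump 4 z * C)"
      by (intro bbs_integrable bbs_mult_lbb b4 lbb_const)
    have "bbs (?F' t)"
      by (intro bbs_mult_lbb b4 lbb_sum lbb_mult lbb_const lbb_compose[OF lq(2)] continuous_intros)
    then show "?F' t \<in> borel_measurable borel" by (rule bbs_measurable)
  qed
  moreover have "(LBINT z. ?F' t z) = (\<Sum>j\<in>UNIV. c' t $ j * (LBINT z. bump 4 z * q' j (c t + s *\<^sub>R z)))"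
  proof -
    have "(LBINT z. ?F' t z) = (LBINT z. (\<Sum>j\<in>UNIV. c' t $ j * (bump 4 z * q' j (c t + s *\<^sub>R z))))"
      by (simp add: sum_distrib_left ac_simps)
    also have "\<dots> = (\<Sum>j\<in>UNIV. LBINT z. c' t $ j * (bump 4 z * q' j (c t + s *\<^sub>R z)))"
      by (intro Bochner_Integration.integral_sum integrable_mult_right bbs_integrable bbs_mult_lbb b4 lbb_shift)
    finally show ?thesis by simp
  qed
  ultimately show ?thesis by (simp add: pressure_mean_def)
qed

text \<open>At the fixed scale \<open>\<epsilon>\<close> all derivatives are moved to the kernel, so
  the gradient of the mean is bounded without derivatives of \<open>v\<close>. Viscosity costs two
  inverse powers of \<open>\<epsilon>\<close>, transport one, and the ball mean three more.\<close>

lemma pressure_mean_gradient_le: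
  assumes \<epsilon>: "0 < \<epsilon>" and x: "x \<in> shell \<epsilon>" and \<nu>: "\<nu> \<ge> 0"
  defines "V \<equiv> \<lambda>x. indicator (shell (2 * \<epsilon>)) x * norm (v x)"
  shows "\<bar>LBINT z. bump 4 z * q' j (x + \<epsilon> *\<^sub>R z)\<bar> \<le>
    168 / \<epsilon> ^ 5 * (\<nu> * (LBINT x. V x)) + 24 / \<epsilon> ^ 4 * (LBINT x. (V x)\<^sup>2)"
proof -
  \<comment> \<open>\<open>K1\<close> and \<open>K2\<close> are the first and second partials of
    \<open>bump 4\<close>, bounded by 8 and \<open>8 * (1 + 6)\<close>; three summands turn 56 and 8
    into 168 and 24.\<close>
  define K1 where "K1 j z = - 8 * (z $ j * bump 3 z)" for j and z :: "real^3"
  define K2 where "K2 j k z = - 8 * ((if k = j then 1 else 0) * bump 3 z + z $ j * (- 6 * (z $ k * bump 2 z)))" for j k and z :: "real^3"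
  have K1: "C1_grad (bump 4) K1" using C1_grad_bump4 by (simp add: K1_def[abs_def])
  have K2: "C1_grad (K1 j) (K2 j)" for j
    unfolding K1_def[abs_def] K2_def[abs_def]
    by (intro C1_grad_cmult C1_grad_mult C1_grad_coord C1_grad_bump3)
  have out: "bump 4 z = 0" "K1 j z = 0" "K2 j k z = 0" if "norm z > 1" for j k z
    using bump_outside[OF that] by (simp_all add: K1_def K2_def)
  have kb: "\<bar>K1 j z\<bar> \<le> 8 * indicator (cball 0 1) z" "\<bar>K2 j k z\<bar> \<le> 56 * indicator (cball 0 1) z" for j k z
  proof -
    have "\<bar>K1 j z\<bar> \<le> 8 \<and> \<bar>K2 j k z\<bar> \<le> 56" if "norm z \<le> 1"
    proof
      show "\<bar>K1 j z\<bar> \<le> 8" using coord_bump_le(1)[of 3 z j] that by (simp add: K1_def)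
      have "\<bar>(if k = j then 1 else 0) * bump 3 z\<bar> \<le> 1" using bump_le_1[of 3 z] bump_nonneg[of 3 z] by auto
      moreover have "\<bar>z $ j * z $ k * bump 2 z\<bar> \<le> 1" using coord_bump_le(2)[of 2 z j k] that by simp
      moreover have "\<bar>- 8 * (a + (- 6) * b)\<bar> \<le> 56" if "\<bar>a\<bar> \<le> 1" "\<bar>b\<bar> \<le> 1" for a b :: real
        using that by (auto simp: abs_le_iff)
      ultimately have "\<bar>- 8 * ((if k = j then 1 else 0) * bump 3 z + (- 6) * (z $ j * z $ k * bump 2 z))\<bar> \<le> 56" by blast
      then show "\<bar>K2 j k z\<bar> \<le> 56" by (simp add: K2_def ac_simps)
    qed
    then show "\<bar>K1 j z\<bar> \<le> 8 * indicator (cball 0 1) z" "\<bar>K2 j k z\<bar> \<le> 56 * indicator (cball 0 1) z"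
      using out[of z] by (cases "norm z \<le> 1"; simp)+
  qed
  have bK: "bbs (K1 j)" "bbs (K2 j k)" for j k
    using out by (intro bbs_continuous[where R = 1] C1_grad_continuous[OF K2] C1_grad_partial_continuous[OF K2]; simp)+
  have b4: "bbs (bump 4)" by (rule bbs_bump) simp
  have V: "bbs V" "V x \<ge> 0" for x
    unfolding V_def by (intro bbs_mult_lbb bbs_indicator_shell lbb_continuous continuous_intros continuous_v
      | simp add: indicator_def)+
  have V2: "bbs (\<lambda>x. (V x)\<^sup>2)" by (intro bbs_power V) simp
  have inV: "V (x + \<epsilon> *\<^sub>R z) = norm (v (x + \<epsilon> *\<^sub>R z))" if "norm z \<le> 1" for z
    using shell_shift[OF x that, of \<epsilon> \<epsilon>] \<epsilon> by (simp add: V_def)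
  have I1: "\<bar>LBINT z. K2 k k z * v (x + \<epsilon> *\<^sub>R z) $ j\<bar> \<le> 56 * ((LBINT x. V x) / \<epsilon> ^ 3)" for k
  proof -
    have "\<bar>LBINT z. K2 k k z * v (x + \<epsilon> *\<^sub>R z) $ j\<bar> \<le> 56 * ball_sum \<epsilon> V x"
    proof (rule integral_le_ball_sum)
      show "(\<lambda>z. K2 k k z * v (x + \<epsilon> *\<^sub>R z) $ j) \<in> borel_measurable borel"
        by (intro bbs_measurable bbs_mult_lbb bK lbb_shift)
      show "\<bar>K2 k k z * v (x + \<epsilon> *\<^sub>R z) $ j\<bar> \<le> 56 * (indicator (cball 0 1) z * V (x + \<epsilon> *\<^sub>R z))" for z
      proof (cases "norm z \<le> 1")
        case True
        then show ?thesis using kb(2)[of k k z] component_le_norm_cart[of "v (x + \<epsilon> *\<^sub>R z)" j]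
          by (simp add: abs_mult inV mult_mono)
      qed (use out(3) in auto)
    qed (rule bbs_imp_lbb[OF V(1)])
    also have "\<dots> \<le> 56 * ((LBINT x. V x) / \<epsilon> ^ 3)"
      using ball_sum_le_integral[OF V, of \<epsilon> x] \<epsilon> by simp
    finally show ?thesis .
  qed
  have I2: "\<bar>LBINT z. K1 k z * (v (x + \<epsilon> *\<^sub>R z) $ k * v (x + \<epsilon> *\<^sub>R z) $ j)\<bar> \<le> 8 * ((LBINT x. (V x)\<^sup>2) / \<epsilon> ^ 3)" for k
  proof -
    have "\<bar>LBINT z. K1 k z * (v (x + \<epsilon> *\<^sub>R z) $ k * v (x + \<epsilon> *\<^sub>R z) $ j)\<bar> \<le> 8 * ball_sum \<epsilon> (\<lambda>x. (V x)\<^sup>2) x"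
    proof (rule integral_le_ball_sum)
      show "(\<lambda>z. K1 k z * (v (x + \<epsilon> *\<^sub>R z) $ k * v (x + \<epsilon> *\<^sub>R z) $ j)) \<in> borel_measurable borel"
        by (intro bbs_measurable bbs_mult_lbb bK lbb_mult lbb_shift)
      show "\<bar>K1 k z * (v (x + \<epsilon> *\<^sub>R z) $ k * v (x + \<epsilon> *\<^sub>R z) $ j)\<bar> \<le> 8 * (indicator (cball 0 1) z * (V (x + \<epsilon> *\<^sub>R z))\<^sup>2)" for z
      proof (cases "norm z \<le> 1")
        case True
        then show ?thesis
          using kb(1)[of k z] component_le_norm_cart[of "v (x + \<epsilon> *\<^sub>R z)" j] component_le_norm_cart[of "v (x + \<epsilon> *\<^sub>R z)" k]
          by (simp add: abs_mult inV mult_mono power2_eq_square)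
      qed (use out(2) in auto)
    qed (rule bbs_imp_lbb[OF V2])
    also have "\<dots> \<le> 8 * ((LBINT x. (V x)\<^sup>2) / \<epsilon> ^ 3)"
      using ball_sum_le_integral[OF V2, of \<epsilon> x] \<epsilon> by simp
    finally show ?thesis .
  qed
  let ?A = "\<Sum>k\<in>UNIV. LBINT z. bump 4 z * v'' k k (x + \<epsilon> *\<^sub>R z) $ j"
  let ?B = "LBINT z. bump 4 z * (\<Sum>k\<in>UNIV. v (x + \<epsilon> *\<^sub>R z) $ k * v' k (x + \<epsilon> *\<^sub>R z) $ j)"
  have "\<epsilon>\<^sup>2 * ?A = (\<Sum>k\<in>UNIV. LBINT z. K2 k k z * v (x + \<epsilon> *\<^sub>R z) $ j)"
    by (simp only: sum_distrib_left integral_laplacian_shift[OF K1 K2 out(1,2)])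
  then have "\<bar>\<epsilon>\<^sup>2 * ?A\<bar> \<le> (\<Sum>k\<in>(UNIV::3 set). 56 * ((LBINT x. V x) / \<epsilon> ^ 3))"
    by (simp only:) (intro order_trans[OF sum_abs] sum_mono I1)
  then have "\<epsilon>\<^sup>2 * \<bar>?A\<bar> \<le> 168 * ((LBINT x. V x) / \<epsilon> ^ 3)" by (simp add: abs_mult)
  then have A: "\<bar>?A\<bar> \<le> 168 / \<epsilon> ^ 5 * (LBINT x. V x)"
    using \<epsilon> by (simp add: field_simps power_add[symmetric])
  have "\<epsilon> * ?B = - (\<Sum>k\<in>UNIV. LBINT z. K1 k z * (v (x + \<epsilon> *\<^sub>R z) $ k * v (x + \<epsilon> *\<^sub>R z) $ j))"
    by (rule integral_convective_shift[OF K1 out(1)])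
  then have "\<bar>\<epsilon> * ?B\<bar> \<le> (\<Sum>k\<in>(UNIV::3 set). 8 * ((LBINT x. (V x)\<^sup>2) / \<epsilon> ^ 3))"
    by (simp only: abs_minus_cancel) (intro order_trans[OF sum_abs] sum_mono I2)
  then have "\<epsilon> * \<bar>?B\<bar> \<le> 24 * ((LBINT x. (V x)\<^sup>2) / \<epsilon> ^ 3)" using \<epsilon> by (simp add: abs_mult)
  then have B: "\<bar>?B\<bar> \<le> 24 / \<epsilon> ^ 4 * (LBINT x. (V x)\<^sup>2)"
    using \<epsilon> by (simp add: field_simps eval_nat_numeral)
  have "\<bar>\<nu> * ?A - ?B\<bar> \<le> \<nu> * \<bar>?A\<bar> + \<bar>?B\<bar>"
    using \<nu> abs_triangle_ineq4[of "\<nu> * ?A" ?B] by (simp add: abs_mult)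
  also have "\<dots> \<le> \<nu> * (168 / \<epsilon> ^ 5 * (LBINT x. V x)) + 24 / \<epsilon> ^ 4 * (LBINT x. (V x)\<^sup>2)"
    using \<nu> A B by (intro add_mono mult_left_mono)
  finally show ?thesis
    unfolding integral_pressure_gradient_shift[OF b4] by (simp add: ac_simps)
qed

end

section \<open>Local energy estimate\<close>

context navier_stokes
begin

text \<open>As \<open>f\<close> has mean zero, the value of the mollified pressure at a reference
  point is subtracted and its oscillation over the shell remains.\<close>

lemma pressure_mean_pairing_le:
  assumes \<epsilon>: "0 < \<epsilon>" "\<epsilon> < 1" and \<nu>: "\<nu> \<ge> 0"
    and f: "bbs f" "\<And>x. x \<notin> shell \<epsilon> \<Longrightarrow> f x = 0" "(LBINT x. f x) = 0"
  defines "V \<equiv> \<lambda>x. indicator (shell (2 * \<epsilon>)) x * norm (v x)"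
  shows "\<bar>LBINT x. f x * pressure_mean \<epsilon> x\<bar> \<le>
    30 * (168 / \<epsilon> ^ 5 * (\<nu> * (LBINT x. V x)) + 24 / \<epsilon> ^ 4 * (LBINT x. (V x)\<^sup>2)) * (LBINT x. \<bar>f x\<bar>)"
proof -
  define \<Gamma> where "\<Gamma> = 168 / \<epsilon> ^ 5 * (\<nu> * (LBINT x. V x)) + 24 / \<epsilon> ^ 4 * (LBINT x. (V x)\<^sup>2)"
  \<comment> \<open>The bound along curves sums three coordinates, hence
    \<open>3 * \<Gamma>\<close>, and the oscillation lemma contributes 10.\<close>
  have osc: "\<bar>pressure_mean \<epsilon> x - pressure_mean \<epsilon> y\<bar> \<le> 10 * (3 * \<Gamma>)" if "x \<in> shell \<epsilon>" "y \<in> shell \<epsilon>" for x y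
  proof (rule shell_oscillation[OF \<epsilon> _ that])
    fix c c' :: "real \<Rightarrow> real^3"
    assume c: "\<And>t. (c has_vector_derivative c' t) (at t)" "continuous_on UNIV c'"
    let ?D = "\<lambda>t. \<Sum>j\<in>UNIV. c' t $ j * (LBINT z. bump 4 z * q' j (c t + \<epsilon> *\<^sub>R z))"
    have "\<bar>?D t\<bar> \<le> norm (c' t) * (3 * \<Gamma>)" if "c t \<in> shell \<epsilon>" for t
    proof -
      have "\<bar>?D t\<bar> \<le> (\<Sum>j\<in>(UNIV::3 set). norm (c' t) * \<Gamma>)"
      proof (intro order_trans[OF sum_abs] sum_mono)
        fix j
        show "\<bar>c' t $ j * (LBINT z. bump 4 z * q' j (c t + \<epsilon> *\<^sub>R z))\<bar> \<le> norm (c' t) * \<Gamma>"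
          unfolding abs_mult \<Gamma>_def V_def
          by (intro mult_mono component_le_norm_cart pressure_mean_gradient_le \<epsilon> that \<nu>) auto
      qed
      then show ?thesis by simp
    qed
    with pressure_mean_curve[OF c] show "\<exists>D. \<forall>t. ((\<lambda>t. pressure_mean \<epsilon> (c t)) has_real_derivative D t) (at t) \<and>
        (c t \<in> shell \<epsilon> \<longrightarrow> \<bar>D t\<bar> \<le> norm (c' t) * (3 * \<Gamma>))"
      by (intro exI[of _ ?D]) blast
  qed
  define x0 :: "real^3" where "x0 = axis 1 1"
  have x0: "x0 \<in> shell \<epsilon>" using \<epsilon> by (simp add: x0_def shell_def)
  have b4: "bbs (bump 4)" by (rule bbs_bump) simp
  have "integrable lborel (\<lambda>x. LBINT z. f x * bump 4 z * q (x + \<epsilon> *\<^sub>R z))"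
    by (rule Fubini_bbs(3)[OF bbs_pair_shift[OF f(1) b4 lbb_continuous[OF C1_grad_continuous[OF C1q]]]])
  then have i1: "integrable lborel (\<lambda>x. f x * pressure_mean \<epsilon> x)"
    by (simp only: mult.assoc integral_mult_right_zero pressure_mean_def)
  have i2: "integrable lborel (\<lambda>x. f x * pressure_mean \<epsilon> x0)"
    by (intro bbs_integrable bbs_mult_lbb f lbb_const)
  have "(LBINT x. f x * pressure_mean \<epsilon> x) = (LBINT x. f x * pressure_mean \<epsilon> x - f x * pressure_mean \<epsilon> x0)"
    using f(3) by (simp add: Bochner_Integration.integral_diff[OF i1 i2])
  also have "\<bar>\<dots>\<bar> \<le> (LBINT x. (30 * \<Gamma>) * \<bar>f x\<bar>)"
  proof (intro order_trans[OF integral_abs_bound] integral_mono)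
    show "integrable lborel (\<lambda>x. \<bar>f x * pressure_mean \<epsilon> x - f x * pressure_mean \<epsilon> x0\<bar>)"
      by (intro integrable_abs Bochner_Integration.integrable_diff i1 i2)
    show "integrable lborel (\<lambda>x. (30 * \<Gamma>) * \<bar>f x\<bar>)"
      by (intro bbs_integrable bbs_cmult bbs_abs f)
    show "\<bar>f x * pressure_mean \<epsilon> x - f x * pressure_mean \<epsilon> x0\<bar> \<le> (30 * \<Gamma>) * \<bar>f x\<bar>" for x
    proof (cases "x \<in> shell \<epsilon>")
      case True
      have "\<bar>f x * pressure_mean \<epsilon> x - f x * pressure_mean \<epsilon> x0\<bar> = \<bar>f x\<bar> * \<bar>pressure_mean \<epsilon> x - pressure_mean \<epsilon> x0\<bar>"
        by (simp add: abs_mult[symmetric] right_diff_distrib)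
      also have "\<dots> \<le> \<bar>f x\<bar> * (10 * (3 * \<Gamma>))" by (intro mult_left_mono osc True x0) auto
      finally show ?thesis by (simp add: ac_simps)
    next
      case False
      then show ?thesis using f(2) by simp
    qed
  qed
  finally show ?thesis by (simp add: \<Gamma>_def)
qed

end

text \<open>The point is uniformity: \<open>C\<close> depends on \<open>\<epsilon>\<close> and
  \<open>p\<close> but not on \<open>\<nu>\<close>, which tends to 0 under dilation. Every term is
  first bounded by the \<open>L^3\<close> norm \<open>\<alpha>\<close> on the middle shell, and then
  \<open>\<alpha>\<close> by the quantity \<open>Y\<close>.\<close>

lemma local_energy_estimate:
  assumes \<epsilon>: "0 < \<epsilon>" "\<epsilon> < 1" and p: "1 \<le> p" "p < 3"
  obtains C where "C > 0"
    "\<And>\<nu> v v' v'' q q' s0 \<Lambda> \<Delta>. navier_stokes \<nu> v v' v'' q q' \<Longrightarrow> \<nu> > 0 \<Longrightarrow> 0 < s0 \<Longrightarrow> s0 \<le> \<epsilon> \<Longrightarrow>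
      \<Lambda> \<ge> 0 \<Longrightarrow> \<Delta> \<ge> 0 \<Longrightarrow>
      (LBINT x. (indicator (shell (3 * \<epsilon>)) x * norm (v x)) powr p) \<le> \<Lambda> powr p \<Longrightarrow>
      (LBINT x. (indicator (shell (3 * \<epsilon>)) x * grad_abs v' x)\<^sup>2) \<le> \<Delta>\<^sup>2 \<Longrightarrow>
      \<nu> * (LBINT x. indicator (cball 0 (1 - \<epsilon>)) x * (grad_abs v' x)\<^sup>2) \<le>
        C * (\<nu> * \<Delta>\<^sup>2 + \<nu> * (s0 powr (1 - 3 / p) * \<Lambda> + sqrt s0 * \<Delta>)\<^sup>2 + (s0 powr (1 - 3 / p) * \<Lambda> + sqrt s0 * \<Delta>) ^ 3)"
proof -
  obtain c :: real and \<phi> \<phi>1 \<phi>2 where c: "c > 0" and \<phi>: "C1_grad \<phi> \<phi>1" "\<And>j. C1_grad (\<phi>1 j) (\<phi>2 j)"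
    and \<phi>_nonneg: "\<And>x. \<phi> x \<ge> 0" and \<phi>_in: "\<And>x. norm x \<le> 1 - \<epsilon> \<Longrightarrow> \<phi> x = c"
    and \<phi>_out: "\<And>x. norm x > 1 + \<epsilon> \<Longrightarrow> \<phi> x = 0" and \<phi>1_out: "\<And>j x. x \<notin> shell \<epsilon> \<Longrightarrow> \<phi>1 j x = 0"
    using cutoff_exists[OF \<epsilon>] by metis
  have \<phi>2_out: "\<phi>2 j k x = 0" if "x \<notin> shell \<epsilon>" for j k x
    by (rule C1_grad_eq_0[OF \<phi>(2), of "- shell \<epsilon>"]) (use that \<phi>1_out closed_shell in auto)
  have norm_shell: "norm x \<le> 1 + \<epsilon>" if "x \<in> shell \<epsilon>" for x using that by (simp add: shell_def)
  have b\<phi>: "bbs \<phi>" "bbs (\<phi>1 j)" "bbs (\<phi>2 j k)" for j k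
  proof -
    show "bbs \<phi>" by (rule bbs_continuous[OF C1_grad_continuous[OF \<phi>(1)] \<phi>_out])
    have "x \<notin> shell \<epsilon>" if "norm x > 1 + \<epsilon>" for x using norm_shell[of x] that by linarith
    then show "bbs (\<phi>1 j)" "bbs (\<phi>2 j k)"
      using bbs_continuous[OF C1_grad_continuous[OF \<phi>(2)]] \<phi>1_out
        bbs_continuous[OF C1_grad_partial_continuous[OF \<phi>(2)]] \<phi>2_out by metis+
  qed
  \<comment> \<open>One bounded function dominates all first and second partials of the cutoff,
    which yields the single constant \<open>B\<close>.\<close>
  have "bbs (\<lambda>x. (\<Sum>j\<in>UNIV. \<bar>\<phi>1 j x\<bar>) + (\<Sum>j\<in>UNIV. \<Sum>k\<in>UNIV. \<bar>\<phi>2 j k x\<bar>))"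
    by (intro bbs_add bbs_sum bbs_abs b\<phi>)
  then obtain B where B: "B > 0" "\<And>x. \<bar>(\<Sum>j\<in>UNIV. \<bar>\<phi>1 j x\<bar>) + (\<Sum>j\<in>UNIV. \<Sum>k\<in>UNIV. \<bar>\<phi>2 j k x\<bar>)\<bar> \<le> B"
    by (rule bbsE) blast
  have B1: "\<bar>\<phi>1 j x\<bar> \<le> B" and B2: "\<bar>\<phi>2 j k x\<bar> \<le> B" for j k x
  proof -
    have "\<bar>\<phi>1 j x\<bar> \<le> (\<Sum>j\<in>UNIV. \<bar>\<phi>1 j x\<bar>)" by (intro member_le_sum) auto
    moreover have "\<bar>\<phi>2 j k x\<bar> \<le> (\<Sum>k\<in>UNIV. \<bar>\<phi>2 j k x\<bar>)" by (intro member_le_sum) auto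
    moreover have "(\<Sum>k\<in>UNIV. \<bar>\<phi>2 j k x\<bar>) \<le> (\<Sum>j\<in>UNIV. \<Sum>k\<in>UNIV. \<bar>\<phi>2 j k x\<bar>)"
      by (intro member_le_sum[where f = "\<lambda>j. \<Sum>k\<in>UNIV. \<bar>\<phi>2 j k x\<bar>"] sum_nonneg) auto
    moreover have "0 \<le> (\<Sum>j\<in>UNIV. \<bar>\<phi>1 j x\<bar>)" "0 \<le> (\<Sum>j\<in>UNIV. \<Sum>k\<in>UNIV. \<bar>\<phi>2 j k x\<bar>)"
      by (intro sum_nonneg; simp)+
    ultimately show "\<bar>\<phi>1 j x\<bar> \<le> B" "\<bar>\<phi>2 j k x\<bar> \<le> B" using B(2)[of x] by linarith+
  qed
  \<comment> \<open>The \<open>L^3\<close> norm of the indicator of the shell; Hoelder with it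
    bounds the integrals of \<open>V\<close> and of its square by \<open>\<alpha>\<close>.\<close>
  define \<beta> where "\<beta> = root 3 (measure lborel (shell (2 * \<epsilon>)))"
  have \<beta>: "\<beta> \<ge> 0" "\<beta> ^ 3 = measure lborel (shell (2 * \<epsilon>))" by (simp_all add: \<beta>_def)
  have mass: "bump_mass > 0" by (rule integral_bump_pos) simp
  \<comment> \<open>\<open>A\<close> comes from the cubic bound, \<open>P\<close> from the scale
    variation of the pressure, and \<open>M\<close> from the oscillation of its mean at unit
    scale.\<close>
  define A where "A = (36 * ball_vol powr (5/6) + 6 * ball_vol powr ((4 - 3 / p) / 3)) / bump_mass"
  define P where "P = (36 * ball_vol powr (5/6) + 162 * ball_vol powr ((4 - 3 / p) / 3) / (3 / p - 1)) / bump_mass"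
  define M where "M = 30 / bump_mass * (168 / \<epsilon> ^ 5 * 2 * \<beta>\<^sup>2 + 24 / \<epsilon> ^ 4 * 2 * \<beta>) * (3 * B * (2 * \<beta>\<^sup>2))"
  have "3 / p - 1 > 0" using p by (simp add: field_simps)
  then have A: "A \<ge> 0" and P: "P \<ge> 0" and M: "M \<ge> 0"
    using mass \<epsilon> \<beta>(1) B(1) unfolding A_def P_def M_def
    by (intro divide_nonneg_nonneg add_nonneg_nonneg mult_nonneg_nonneg; simp)+
  \<comment> \<open>The coefficients of all error terms, divided by the inner value \<open>c\<close>
    of the cutoff; the final 1 makes \<open>C\<close> positive.\<close>
  define C where "C = (3 * B * (2 * \<beta> * A\<^sup>2 + 1) + 3 * B * A ^ 3 + M * A\<^sup>2 + M * A ^ 3 +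
      P * A\<^sup>2 * (13 * B * (sqrt (2 * \<beta>) * A + 1) + 3 * B)) / c + 1"
  show ?thesis
  proof (rule that[of C])
    show "C > 0" using c A P M B(1) \<beta>(1) unfolding C_def
      by (intro add_nonneg_pos divide_nonneg_pos add_nonneg_nonneg mult_nonneg_nonneg) auto
    fix \<nu> v v' v'' q q' s0 \<Lambda> \<Delta>
    assume ns: "navier_stokes \<nu> v v' v'' q q'" and \<nu>: "\<nu> > (0::real)" and s0: "0 < s0" "s0 \<le> \<epsilon>"
      and \<Lambda>0: "(0::real) \<le> \<Lambda>" and \<Delta>0: "(0::real) \<le> \<Delta>"
      and \<Lambda>: "(LBINT x. (indicator (shell (3 * \<epsilon>)) x * norm (v x)) powr p) \<le> \<Lambda> powr p"
      and \<Delta>: "(LBINT x. (indicator (shell (3 * \<epsilon>)) x * grad_abs v' x)\<^sup>2) \<le> \<Delta>\<^sup>2"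
    interpret navier_stokes \<nu> v v' v'' q q' by (rule ns)
    define Y where "Y = s0 powr (1 - 3 / p) * \<Lambda> + sqrt s0 * \<Delta>"
    have Y: "Y \<ge> 0" using s0 \<Lambda>0 \<Delta>0 by (simp add: Y_def)
    define V where "V x = indicator (shell (2 * \<epsilon>)) x * norm (v x)" for x
    define V1 where "V1 x = indicator (shell \<epsilon>) x * norm (v x)" for x
    define V3 where "V3 x = indicator (shell (3 * \<epsilon>)) x * norm (v x)" for x
    define H1 where "H1 x = indicator (shell \<epsilon>) x * grad_abs v' x" for x
    define H3 where "H3 x = indicator (shell (3 * \<epsilon>)) x * grad_abs v' x" for x
    have lv: "lbb (\<lambda>x. norm (v x))" "lbb (grad_abs v')"
      by (intro lbb_continuous continuous_intros continuous_v continuous_grad_abs[OF C1v])+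
    have bV: "bbs V" "bbs V1" "bbs V3" "bbs H1" "bbs H3"
      unfolding V_def[abs_def] V1_def[abs_def] V3_def[abs_def] H1_def[abs_def] H3_def[abs_def]
      by (intro bbs_mult_lbb bbs_indicator_shell lv)+
    have nonneg: "V x \<ge> 0" "V1 x \<ge> 0" "V3 x \<ge> 0" "H1 x \<ge> 0" "H3 x \<ge> 0" for x
      by (simp_all add: V_def V1_def V3_def H1_def H3_def grad_abs_nonneg indicator_def)
    have sub: "shell \<epsilon> \<subseteq> shell (2 * \<epsilon>)" "shell \<epsilon> \<subseteq> shell (3 * \<epsilon>)"
      using \<epsilon> by (intro shell_mono; simp)+
    have le: "V1 x \<le> V x" "V1 x \<le> V3 x" "H1 x \<le> H3 x" for x
      using sub grad_abs_nonneg[of v' x] by (auto simp: V1_def V_def V3_def H1_def H3_def indicator_def)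
    define \<alpha> where "\<alpha> = root 3 (LBINT x. V x ^ 3)"
    have \<alpha>: "\<alpha> \<ge> 0" "(LBINT x. V x ^ 3) = \<alpha> ^ 3"
      by (simp_all add: \<alpha>_def integral_nonneg_AE nonneg)
    have \<alpha>Y: "\<alpha> \<le> A * Y"
      unfolding A_def Y_def
      by (rule L3_shell_le[OF C1v s0 p \<Lambda> \<Lambda>0 \<Delta> \<Delta>0]) (use \<alpha> in \<open>auto simp: V_def\<close>)
    have i\<beta>: "(LBINT x. indicator (shell (2 * \<epsilon>)) x ^ 3) \<le> \<beta> ^ 3"
    proof -
      have "(\<lambda>x. indicator (shell (2 * \<epsilon>)) x ^ 3 :: real) = indicator (shell (2 * \<epsilon>))" by (auto simp: indicator_def)
      then show ?thesis using \<beta>(2) by simp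
    qed
    have V_sq: "(LBINT x. (V x)\<^sup>2) \<le> 2 * \<alpha>\<^sup>2 * \<beta>"
    proof -
      have "(LBINT x. (V x)\<^sup>2 * indicator (shell (2 * \<epsilon>)) x) \<le> 2 * \<alpha>\<^sup>2 * \<beta>"
        by (rule integral_square_mult_le) (use bV bbs_indicator_shell nonneg \<alpha> i\<beta> \<beta> in auto)
      moreover have "(\<lambda>x. (V x)\<^sup>2 * indicator (shell (2 * \<epsilon>)) x) = (\<lambda>x. (V x)\<^sup>2)" by (auto simp: V_def indicator_def)
      ultimately show ?thesis by simp
    qed
    have V_int: "(LBINT x. V x) \<le> 2 * \<beta>\<^sup>2 * \<alpha>"
    proof -
      have "(LBINT x. (indicator (shell (2 * \<epsilon>)) x)\<^sup>2 * V x) \<le> 2 * \<beta>\<^sup>2 * \<alpha>"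
        by (rule integral_square_mult_le) (use bV bbs_indicator_shell nonneg \<alpha> i\<beta> \<beta> in auto)
      moreover have "(\<lambda>x. (indicator (shell (2 * \<epsilon>)) x)\<^sup>2 * V x) = V" by (auto simp: V_def indicator_def)
      ultimately show ?thesis by simp
    qed
    have V1_sq: "(LBINT x. (V1 x)\<^sup>2) \<le> 2 * \<alpha>\<^sup>2 * \<beta>"
      by (rule order_trans[OF _ V_sq], rule integral_mono)
        (auto intro!: bbs_integrable bbs_power bV power_mono le nonneg)
    have V1_cube: "(LBINT x. V1 x ^ 3) \<le> \<alpha> ^ 3"
      unfolding \<alpha>(2)[symmetric] by (rule integral_mono)
        (auto intro!: bbs_integrable bbs_power bV power_mono le nonneg)
    have H1_sq: "(LBINT x. (H1 x)\<^sup>2) \<le> \<Delta>\<^sup>2"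
    proof -
      have "(LBINT x. (H1 x)\<^sup>2) \<le> (LBINT x. (H3 x)\<^sup>2)"
        by (rule integral_mono) (auto intro!: bbs_integrable bbs_power bV power_mono le nonneg)
      then show ?thesis using \<Delta> by (simp add: H3_def)
    qed
    \<comment> \<open>The test function seen by the pressure, \<open>v\<close> times the gradient of
      the cutoff. It needs the second partials of the cutoff because its own gradient enters below
      the scale \<open>s0\<close>.\<close>
    define f where "f x = (\<Sum>j\<in>UNIV. \<phi>1 j x * v x $ j)" for x
    define f' where "f' k x = (\<Sum>j\<in>UNIV. \<phi>2 j k x * v x $ j + \<phi>1 j x * v' k x $ j)" for k x
    have f: "C1_grad f f'"
      unfolding f_def[abs_def] f'_def[abs_def] by (intro C1_grad_sum C1_grad_mult \<phi>(2) C1_grad_nth C1v)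
    have f_out: "f x = 0" "f' k x = 0" if "x \<notin> shell \<epsilon>" for x k
      using \<phi>1_out[OF that] \<phi>2_out[OF that] by (simp_all add: f_def f'_def)
    have bf: "bbs f" using f_out norm_shell
      by (intro bbs_continuous[where R = "1 + \<epsilon>"] C1_grad_continuous[OF f]) force
    have f_le: "\<bar>f x\<bar> \<le> 3 * B * V1 x" for x
    proof (cases "x \<in> shell \<epsilon>")
      case True
      have "\<bar>f x\<bar> \<le> (\<Sum>j\<in>(UNIV::3 set). B * norm (v x))"
        unfolding f_def using B1 component_le_norm_cart[of "v x"] B(1)
        by (intro order_trans[OF sum_abs] sum_mono) (auto simp: abs_mult intro!: mult_mono)
      then show ?thesis using True by (simp add: V1_def)
    qed (use f_out B(1) nonneg in auto)
    have f'_le: "(grad_abs f' x)\<^sup>2 \<le> (162 * B\<^sup>2) * ((V1 x)\<^sup>2 + (H1 x)\<^sup>2)" for x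
    proof (cases "x \<in> shell \<epsilon>")
      case True
      have "\<bar>f' k x\<bar> \<le> (\<Sum>j\<in>(UNIV::3 set). B * norm (v x) + B * grad_abs v' x)" for k
        unfolding f'_def
      proof (intro order_trans[OF sum_abs] sum_mono)
        fix j
        have "\<bar>v' k x $ j\<bar> \<le> grad_abs v' x"
          using component_le_norm_cart norm_le_grad_abs order_trans by blast
        then have "\<bar>\<phi>2 j k x\<bar> * \<bar>v x $ j\<bar> \<le> B * norm (v x)" "\<bar>\<phi>1 j x\<bar> * \<bar>v' k x $ j\<bar> \<le> B * grad_abs v' x"
          using B1 B2 B(1) component_le_norm_cart[of "v x" j] by (intro mult_mono; auto)+
        then show "\<bar>\<phi>2 j k x * v x $ j + \<phi>1 j x * v' k x $ j\<bar> \<le> B * norm (v x) + B * grad_abs v' x"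
          using abs_triangle_ineq[of "\<phi>2 j k x * v x $ j" "\<phi>1 j x * v' k x $ j"] by (simp add: abs_mult)
      qed
      then have "\<bar>f' k x\<bar> \<le> 3 * (B * norm (v x) + B * grad_abs v' x)" for k by simp
      then have "\<bar>f' k x\<bar> \<le> \<bar>3 * (B * norm (v x) + B * grad_abs v' x)\<bar>" for k
        by (rule order_trans[OF _ abs_ge_self])
      then have k: "(f' k x)\<^sup>2 \<le> (3 * (B * norm (v x) + B * grad_abs v' x))\<^sup>2" for k
        by (simp only: abs_le_square_iff)
      have sq: "(s + t)\<^sup>2 \<le> 2 * (s\<^sup>2 + t\<^sup>2)" for s t :: real
        using sum_squares_bound[of s t] by (simp add: power2_sum)
      have "(grad_abs f' x)\<^sup>2 = (\<Sum>k\<in>UNIV. (f' k x)\<^sup>2)" by (simp add: grad_abs_square)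
      also have "\<dots> \<le> (\<Sum>k\<in>(UNIV::3 set). (3 * (B * norm (v x) + B * grad_abs v' x))\<^sup>2)"
        by (intro sum_mono k)
      also have "\<dots> = 27 * (B * norm (v x) + B * grad_abs v' x)\<^sup>2"
        by (simp add: power2_eq_square algebra_simps)
      also have "\<dots> \<le> 27 * (2 * ((B * norm (v x))\<^sup>2 + (B * grad_abs v' x)\<^sup>2))"
        by (intro mult_left_mono sq) auto
      also have "\<dots> = 54 * B\<^sup>2 * ((V1 x)\<^sup>2 + (H1 x)\<^sup>2)"
        using True by (simp add: V1_def H1_def power_mult_distrib algebra_simps)
      also have "\<dots> \<le> (162 * B\<^sup>2) * ((V1 x)\<^sup>2 + (H1 x)\<^sup>2)" by (intro mult_right_mono) auto
      finally show ?thesis .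
    next
      case False
      then have "grad_abs f' x = 0" using f_out by (simp add: grad_abs_def)
      then show ?thesis by simp
    qed
    \<comment> \<open>The factor 13 covers 162, since \<open>13 * 13 = 169\<close>; the other factor
      absorbs \<open>2 * \<alpha>\<^sup>2 * \<beta> + \<Delta>\<^sup>2\<close> into a
      square.\<close>
    define \<Delta>f where "\<Delta>f = 13 * B * (sqrt (2 * \<beta>) * \<alpha> + \<Delta>)"
    have \<Delta>f: "\<Delta>f \<ge> 0" using B(1) \<beta>(1) \<alpha>(1) \<Delta>0 by (simp add: \<Delta>f_def)
    have f'_int: "(LBINT x. (grad_abs f' x)\<^sup>2) \<le> \<Delta>f\<^sup>2"
    proof -
      have i: "integrable lborel (\<lambda>x. (V1 x)\<^sup>2)" "integrable lborel (\<lambda>x. (H1 x)\<^sup>2)"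
        by (intro bbs_integrable bbs_power bV; simp)+
      have "(LBINT x. (grad_abs f' x)\<^sup>2) \<le> (LBINT x. (162 * B\<^sup>2) * ((V1 x)\<^sup>2 + (H1 x)\<^sup>2))"
      proof (rule integral_mono[OF _ _ f'_le])
        have "grad_abs f' x = 0" if "x \<notin> shell \<epsilon>" for x using f_out that by (simp add: grad_abs_def)
        then have "bbs (grad_abs f')" using norm_shell
          by (intro bbs_continuous[where R = "1 + \<epsilon>"] continuous_grad_abs[OF f]) force
        then show "integrable lborel (\<lambda>x. (grad_abs f' x)\<^sup>2)" by (intro bbs_integrable bbs_power) auto
        show "integrable lborel (\<lambda>x. (162 * B\<^sup>2) * ((V1 x)\<^sup>2 + (H1 x)\<^sup>2))"
          using i by (intro integrable_mult_right Bochner_Integration.integrable_add)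
      qed
      also have "\<dots> = (162 * B\<^sup>2) * ((LBINT x. (V1 x)\<^sup>2) + (LBINT x. (H1 x)\<^sup>2))"
        using i by simp
      also have "\<dots> \<le> (169 * B\<^sup>2) * (2 * \<alpha>\<^sup>2 * \<beta> + \<Delta>\<^sup>2)"
        using V1_sq H1_sq by (intro mult_mono add_mono) auto
      also have "\<dots> \<le> \<Delta>f\<^sup>2"
      proof -
        have "2 * \<alpha>\<^sup>2 * \<beta> + \<Delta>\<^sup>2 \<le> (sqrt (2 * \<beta>) * \<alpha> + \<Delta>)\<^sup>2"
          using \<beta>(1) \<alpha>(1) \<Delta>0 by (simp add: power2_sum power_mult_distrib)
        then show ?thesis unfolding \<Delta>f_def by (simp add: power_mult_distrib mult_left_mono)
      qed
      finally show ?thesis .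
    qed
    have f_powr: "(LBINT x. \<bar>f x\<bar> powr p) \<le> (3 * B * \<Lambda>) powr p"
    proof -
      have "(LBINT x. \<bar>f x\<bar> powr p) \<le> (LBINT x. (3 * B) powr p * V3 x powr p)"
      proof (rule integral_mono)
        show "integrable lborel (\<lambda>x. \<bar>f x\<bar> powr p)"
          using p by (intro bbs_integrable bbs_powr bbs_abs bf) auto
        show "integrable lborel (\<lambda>x. (3 * B) powr p * V3 x powr p)"
          using p nonneg by (intro bbs_integrable bbs_cmult bbs_powr bV) auto
        fix x
        have "\<bar>f x\<bar> \<le> 3 * B * V3 x"
          using f_le[of x] le(2)[of x] B(1) by (meson mult_left_mono mult_nonneg_nonneg less_imp_le order_trans zero_le_numeral)
        then have "\<bar>f x\<bar> powr p \<le> (3 * B * V3 x) powr p" using p by (intro powr_mono2) auto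
        then show "\<bar>f x\<bar> powr p \<le> (3 * B) powr p * V3 x powr p"
          using B(1) nonneg(3)[of x] by (simp add: powr_mult)
      qed
      also have "\<dots> \<le> (3 * B) powr p * \<Lambda> powr p" using \<Lambda> by (simp add: V3_def mult_left_mono)
      also have "\<dots> = (3 * B * \<Lambda>) powr p" using B(1) \<Lambda>0 by (simp add: powr_mult)
      finally show ?thesis .
    qed
    have f_int: "(LBINT x. \<bar>f x\<bar>) \<le> 3 * B * (2 * \<beta>\<^sup>2 * \<alpha>)"
    proof -
      have "(LBINT x. \<bar>f x\<bar>) \<le> (LBINT x. 3 * B * V x)"
      proof (rule integral_mono)
        show "\<bar>f x\<bar> \<le> 3 * B * V x" for x
          using f_le[of x] le(1)[of x] B(1) by (meson mult_left_mono mult_nonneg_nonneg less_imp_le order_trans zero_le_numeral)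
      qed (intro bbs_integrable bbs_abs bbs_cmult bf bV)+
      also have "\<dots> \<le> 3 * B * (2 * \<beta>\<^sup>2 * \<alpha>)" using V_int B(1) by (simp add: ac_simps)
      finally show ?thesis .
    qed
    have "\<bar>(LBINT x. f x * pressure_mean \<epsilon> x) - bump_mass * (LBINT x. f x * q x)\<bar> \<le>
      (36 * ball_vol powr (5/6) + 162 * ball_vol powr ((4 - 3 / p) / 3) / (3 / p - 1)) * \<alpha>\<^sup>2 *
      (sqrt s0 * \<Delta>f + s0 powr (1 - 3 / p) * (3 * B * \<Lambda>))"
      using \<alpha> \<Delta>f B(1) \<Lambda>0 f_powr f'_int f_out
      by (intro pressure_mean_variation[OF f _ s0 p]) (auto simp: V_def)
    \<comment> \<open>At unit scale everything is of lower order: each of \<open>V\<close>,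
      \<open>V\<^sup>2\<close> and \<open>f\<close> is reduced to \<open>\<alpha>\<close> on a set
      of finite volume, leaving the powers 2 (with \<open>\<nu>\<close>) and 3.\<close>
    moreover have "\<bar>LBINT x. f x * pressure_mean \<epsilon> x\<bar> \<le> bump_mass * (M * (\<nu> * \<alpha>\<^sup>2 + \<alpha> ^ 3))"
    proof -
      have "(LBINT x. f x) = 0" unfolding f_def by (rule flux_eq_0[OF \<phi>(1) \<phi>_out])
      then have "\<bar>LBINT x. f x * pressure_mean \<epsilon> x\<bar> \<le>
          30 * (168 / \<epsilon> ^ 5 * (\<nu> * (LBINT x. V x)) + 24 / \<epsilon> ^ 4 * (LBINT x. (V x)\<^sup>2)) * (LBINT x. \<bar>f x\<bar>)"
        unfolding V_def using \<nu> bf f_out by (intro pressure_mean_pairing_le \<epsilon>) auto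
      also have "\<dots> \<le> 30 * (168 / \<epsilon> ^ 5 * (\<nu> * (2 * \<beta>\<^sup>2 * \<alpha>)) + 24 / \<epsilon> ^ 4 * (2 * \<alpha>\<^sup>2 * \<beta>)) * (3 * B * (2 * \<beta>\<^sup>2 * \<alpha>))"
        using \<nu> \<epsilon> V_int V_sq f_int \<beta>(1) \<alpha>(1) B(1)
        by (intro mult_mono mult_left_mono add_mono order_refl mult_nonneg_nonneg add_nonneg_nonneg integral_nonneg_AE) auto
      also have "\<dots> \<le> 30 * (168 / \<epsilon> ^ 5 * 2 * \<beta>\<^sup>2 + 24 / \<epsilon> ^ 4 * 2 * \<beta>) * (\<nu> * \<alpha> + \<alpha>\<^sup>2) * (3 * B * (2 * \<beta>\<^sup>2 * \<alpha>))"
      proof -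
        have *: "a * (\<nu> * \<alpha>) + b * \<alpha>\<^sup>2 \<le> (a + b) * (\<nu> * \<alpha> + \<alpha>\<^sup>2)" if "a \<ge> 0" "b \<ge> 0" for a b :: real
          using that \<nu> \<alpha>(1) by (simp add: algebra_simps)
        have "168 / \<epsilon> ^ 5 * (\<nu> * (2 * \<beta>\<^sup>2 * \<alpha>)) + 24 / \<epsilon> ^ 4 * (2 * \<alpha>\<^sup>2 * \<beta>) \<le>
            (168 / \<epsilon> ^ 5 * 2 * \<beta>\<^sup>2 + 24 / \<epsilon> ^ 4 * 2 * \<beta>) * (\<nu> * \<alpha> + \<alpha>\<^sup>2)"
          using *[of "168 / \<epsilon> ^ 5 * 2 * \<beta>\<^sup>2" "24 / \<epsilon> ^ 4 * 2 * \<beta>"] \<epsilon> \<beta>(1) by (simp add: ac_simps)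
        moreover have "30 * X * Z \<le> 30 * K * W * Z" if "X \<le> K * W" "Z \<ge> 0" for X Z K W :: real
          using mult_right_mono[OF that] by (simp add: mult.assoc)
        moreover have "3 * B * (2 * \<beta>\<^sup>2 * \<alpha>) \<ge> 0" using B(1) \<alpha>(1) by simp
        ultimately show ?thesis by blast
      qed
      also have "\<dots> = bump_mass * (M * (\<nu> * \<alpha>\<^sup>2 + \<alpha> ^ 3))"
      proof -
        have m: "bump_mass * (30 / bump_mass * X) = 30 * X" for X using mass by simp
        have "30 * K * (\<nu> * \<alpha> + \<alpha>\<^sup>2) * (3 * B * (2 * \<beta>\<^sup>2 * \<alpha>)) =
            bump_mass * (30 / bump_mass * K * (3 * B * (2 * \<beta>\<^sup>2)) * (\<nu> * \<alpha>\<^sup>2 + \<alpha> ^ 3))" for K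
          unfolding mult.assoc m by (simp add: power2_eq_square power3_eq_cube algebra_simps)
        then show ?thesis unfolding M_def by blast
      qed
      finally show ?thesis .
    qed
    ultimately have "bump_mass * \<bar>LBINT x. f x * q x\<bar> \<le> bump_mass * (M * (\<nu> * \<alpha>\<^sup>2 + \<alpha> ^ 3)) +
      bump_mass * (P * \<alpha>\<^sup>2 * (sqrt s0 * \<Delta>f + s0 powr (1 - 3 / p) * (3 * B * \<Lambda>)))"
      using mass by (simp add: P_def abs_mult)
    then have pressure: "\<bar>LBINT x. f x * q x\<bar> \<le> M * (\<nu> * \<alpha>\<^sup>2 + \<alpha> ^ 3) +
      P * \<alpha>\<^sup>2 * (sqrt s0 * \<Delta>f + s0 powr (1 - 3 / p) * (3 * B * \<Lambda>))"
      using mass by (simp add: distrib_left[symmetric])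
    \<comment> \<open>The cutoff equals \<open>c\<close> on the inner ball and is nonnegative
      elsewhere.\<close>
    have "\<nu> * (c * (LBINT x. indicator (cball 0 (1 - \<epsilon>)) x * (grad_abs v' x)\<^sup>2)) \<le>
      \<nu> * (LBINT x. \<phi> x * (grad_abs v' x)\<^sup>2)"
    proof -
      have lg: "lbb (\<lambda>x. (grad_abs v' x)\<^sup>2)"
        by (intro lbb_continuous continuous_intros continuous_grad_abs[OF C1v])
      have "(LBINT x. c * (indicator (cball 0 (1 - \<epsilon>)) x * (grad_abs v' x)\<^sup>2)) \<le> (LBINT x. \<phi> x * (grad_abs v' x)\<^sup>2)"
      proof (rule integral_mono)
        show "integrable lborel (\<lambda>x. c * (indicator (cball 0 (1 - \<epsilon>)) x * (grad_abs v' x)\<^sup>2))"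
          by (intro bbs_integrable bbs_cmult bbs_mult_lbb bbs_indicator lg) auto
        show "integrable lborel (\<lambda>x. \<phi> x * (grad_abs v' x)\<^sup>2)"
          by (intro bbs_integrable bbs_mult_lbb b\<phi> lg)
        show "c * (indicator (cball 0 (1 - \<epsilon>)) x * (grad_abs v' x)\<^sup>2) \<le> \<phi> x * (grad_abs v' x)\<^sup>2" for x
          using \<phi>_in[of x] \<phi>_nonneg[of x] by (auto simp: indicator_def)
      qed
      then show ?thesis using \<nu> by (simp add: mult_left_mono)
    qed
    also have "\<dots> = (LBINT x. (\<Sum>j\<in>UNIV. \<phi>1 j x * (- \<nu> * (v' j x \<bullet> v x) + (v x \<bullet> v x / 2 + q x) * v x $ j)))"
      by (rule energy_identity[OF \<phi>(1) \<phi>_out])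
    also have "\<dots> = (LBINT x. (- \<nu> * (\<Sum>j\<in>UNIV. \<phi>1 j x * (v' j x \<bullet> v x)) + f x * (v x \<bullet> v x / 2)) + f x * q x)"
      by (intro Bochner_Integration.integral_cong refl)
        (simp add: f_def sum.distrib sum_subtractf sum_negf sum_distrib_left sum_distrib_right algebra_simps)
    also have "\<dots> = (LBINT x. - \<nu> * (\<Sum>j\<in>UNIV. \<phi>1 j x * (v' j x \<bullet> v x)) + f x * (v x \<bullet> v x / 2)) +
        (LBINT x. f x * q x)"
    proof (rule Bochner_Integration.integral_add)
      show "integrable lborel (\<lambda>x. - \<nu> * (\<Sum>j\<in>UNIV. \<phi>1 j x * (v' j x \<bullet> v x)) + f x * (v x \<bullet> v x / 2))"
        by (intro bbs_integrable bbs_add bbs_cmult bbs_sum bbs_mult_lbb b\<phi> bf lbb_continuous continuous_intros continuous_v) auto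
      show "integrable lborel (\<lambda>x. f x * q x)"
        by (intro bbs_integrable bbs_mult_lbb bf lbb_continuous C1_grad_continuous[OF C1q])
    qed
    \<comment> \<open>Viscous and kinetic fluxes need no cancellation; they are estimated pointwise
      on the shell.\<close>
    also have "(LBINT x. - \<nu> * (\<Sum>j\<in>UNIV. \<phi>1 j x * (v' j x \<bullet> v x)) + f x * (v x \<bullet> v x / 2)) \<le>
        3 * B * \<nu> * (2 * \<alpha>\<^sup>2 * \<beta> + \<Delta>\<^sup>2) + 3 * B * \<alpha> ^ 3"
    proof -
      have i: "integrable lborel (\<lambda>x. (V1 x)\<^sup>2)" "integrable lborel (\<lambda>x. (H1 x)\<^sup>2)" "integrable lborel (\<lambda>x. V1 x ^ 3)"
        by (intro bbs_integrable bbs_power bV; simp)+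
      have "(LBINT x. - \<nu> * (\<Sum>j\<in>UNIV. \<phi>1 j x * (v' j x \<bullet> v x)) + f x * (v x \<bullet> v x / 2)) \<le>
          (LBINT x. (3 * B * \<nu>) * ((V1 x)\<^sup>2 + (H1 x)\<^sup>2) + (3 * B) * V1 x ^ 3)"
      proof (rule integral_mono)
        show "integrable lborel (\<lambda>x. - \<nu> * (\<Sum>j\<in>UNIV. \<phi>1 j x * (v' j x \<bullet> v x)) + f x * (v x \<bullet> v x / 2))"
          by (intro bbs_integrable bbs_add bbs_cmult bbs_sum bbs_mult_lbb b\<phi> bf lbb_continuous continuous_intros continuous_v) auto
        show "integrable lborel (\<lambda>x. (3 * B * \<nu>) * ((V1 x)\<^sup>2 + (H1 x)\<^sup>2) + (3 * B) * V1 x ^ 3)"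
          using i by (intro Bochner_Integration.integrable_add integrable_mult_right)
        fix x
        show "- \<nu> * (\<Sum>j\<in>UNIV. \<phi>1 j x * (v' j x \<bullet> v x)) + f x * (v x \<bullet> v x / 2) \<le>
            (3 * B * \<nu>) * ((V1 x)\<^sup>2 + (H1 x)\<^sup>2) + (3 * B) * V1 x ^ 3"
        proof (cases "x \<in> shell \<epsilon>")
          case True
          have "\<bar>\<Sum>j\<in>UNIV. \<phi>1 j x * (v' j x \<bullet> v x)\<bar> \<le> (\<Sum>j\<in>(UNIV::3 set). B * (H1 x * V1 x))"
          proof (intro order_trans[OF sum_abs] sum_mono)
            fix j
            have "\<bar>v' j x \<bullet> v x\<bar> \<le> norm (v' j x) * norm (v x)" by (rule Cauchy_Schwarz_ineq2)
            also have "\<dots> \<le> H1 x * V1 x"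
              using True norm_le_grad_abs[of v' j x] by (simp add: H1_def V1_def mult_right_mono)
            finally show "\<bar>\<phi>1 j x * (v' j x \<bullet> v x)\<bar> \<le> B * (H1 x * V1 x)"
              unfolding abs_mult using B1[of j x] B(1) by (intro mult_mono) auto
          qed
          also have "\<dots> = 3 * B * (H1 x * V1 x)" by simp
          also have "\<dots> \<le> 3 * B * ((V1 x)\<^sup>2 + (H1 x)\<^sup>2)"
          proof (rule mult_left_mono)
            have "H1 x * V1 x \<ge> 0" using nonneg by simp
            then show "H1 x * V1 x \<le> (V1 x)\<^sup>2 + (H1 x)\<^sup>2"
              using sum_squares_bound[of "H1 x" "V1 x"] by simp
          qed (use B(1) in simp)
          finally have "\<bar>\<Sum>j\<in>UNIV. \<phi>1 j x * (v' j x \<bullet> v x)\<bar> \<le> 3 * B * ((V1 x)\<^sup>2 + (H1 x)\<^sup>2)" .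
          then have 1: "- \<nu> * (\<Sum>j\<in>UNIV. \<phi>1 j x * (v' j x \<bullet> v x)) \<le> \<nu> * (3 * B * ((V1 x)\<^sup>2 + (H1 x)\<^sup>2))"
          proof -
            have "- \<nu> * S \<le> \<nu> * T" if "\<bar>S\<bar> \<le> T" for S T
              using mult_left_mono[of "- S" T \<nu>] that \<nu> by (simp add: abs_le_iff)
            then show ?thesis using \<open>\<bar>\<Sum>j\<in>UNIV. \<phi>1 j x * (v' j x \<bullet> v x)\<bar> \<le> 3 * B * ((V1 x)\<^sup>2 + (H1 x)\<^sup>2)\<close> by blast
          qed
          have "v x \<bullet> v x / 2 \<le> (V1 x)\<^sup>2" using True by (simp add: V1_def power2_norm_eq_inner)
          then have "f x * (v x \<bullet> v x / 2) \<le> (3 * B * V1 x) * (V1 x)\<^sup>2"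
            using f_le[of x] B(1) nonneg(2)[of x] by (intro mult_mono) (auto simp: abs_le_iff)
          then have 2: "f x * (v x \<bullet> v x / 2) \<le> 3 * B * V1 x ^ 3" by (simp add: power2_eq_square power3_eq_cube mult.assoc)
          show ?thesis using 1 2 by (simp add: ac_simps)
        next
          case False
          then show ?thesis using \<phi>1_out f_out \<nu> B(1) nonneg by simp
        qed
      qed
      also have "\<dots> = (3 * B * \<nu>) * ((LBINT x. (V1 x)\<^sup>2) + (LBINT x. (H1 x)\<^sup>2)) + (3 * B) * (LBINT x. V1 x ^ 3)"
        using i by simp
      also have "\<dots> \<le> (3 * B * \<nu>) * (2 * \<alpha>\<^sup>2 * \<beta> + \<Delta>\<^sup>2) + (3 * B) * \<alpha> ^ 3"
        using V1_sq H1_sq V1_cube B(1) \<nu> by (intro add_mono mult_left_mono) auto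
      finally show ?thesis .
    qed
    finally have main: "\<nu> * (c * (LBINT x. indicator (cball 0 (1 - \<epsilon>)) x * (grad_abs v' x)\<^sup>2)) \<le>
        3 * B * \<nu> * (2 * \<alpha>\<^sup>2 * \<beta> + \<Delta>\<^sup>2) + 3 * B * \<alpha> ^ 3 + M * (\<nu> * \<alpha>\<^sup>2 + \<alpha> ^ 3) +
        P * \<alpha>\<^sup>2 * (sqrt s0 * \<Delta>f + s0 powr (1 - 3 / p) * (3 * B * \<Lambda>))"
      using pressure by linarith
    have \<alpha>2: "\<alpha>\<^sup>2 \<le> A\<^sup>2 * Y\<^sup>2" "\<alpha> ^ 3 \<le> A ^ 3 * Y ^ 3"
      using power_mono[OF \<alpha>Y \<alpha>(1), of 2] power_mono[OF \<alpha>Y \<alpha>(1), of 3] by (simp_all add: power_mult_distrib)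
    have last: "sqrt s0 * \<Delta>f + s0 powr (1 - 3 / p) * (3 * B * \<Lambda>) \<le> (13 * B * (sqrt (2 * \<beta>) * A + 1) + 3 * B) * Y"
    proof -
      \<comment> \<open>Here \<open>s0 \<le> \<epsilon> < 1\<close> allows \<open>sqrt s0\<close> to
        be replaced by 1; the lower-order part of the gradient of \<open>f\<close> is then a
        multiple of \<open>Y\<close>.\<close>
      have "sqrt s0 * (sqrt (2 * \<beta>) * \<alpha>) \<le> 1 * (sqrt (2 * \<beta>) * (A * Y))"
        using s0 \<epsilon> \<alpha>Y \<alpha>(1) \<beta>(1) by (intro mult_mono mult_left_mono) auto
      moreover have "sqrt s0 * \<Delta> \<le> Y" "s0 powr (1 - 3 / p) * \<Lambda> \<le> Y" using s0 \<Lambda>0 \<Delta>0 by (simp_all add: Y_def)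
      ultimately have "13 * B * (sqrt s0 * (sqrt (2 * \<beta>) * \<alpha>) + sqrt s0 * \<Delta>) + 3 * B * (s0 powr (1 - 3 / p) * \<Lambda>) \<le>
        13 * B * (sqrt (2 * \<beta>) * (A * Y) + Y) + 3 * B * Y"
        using B(1) by (intro add_mono mult_left_mono) auto
      then show ?thesis by (simp add: \<Delta>f_def algebra_simps)
    qed
    define K3 where "K3 = 13 * B * (sqrt (2 * \<beta>) * A + 1) + 3 * B"
    have K3: "K3 \<ge> 0" using B(1) \<beta>(1) A by (simp add: K3_def)
    have t4: "P * \<alpha>\<^sup>2 * (sqrt s0 * \<Delta>f + s0 powr (1 - 3 / p) * (3 * B * \<Lambda>)) \<le> P * (A\<^sup>2 * Y\<^sup>2) * (K3 * Y)"
      using last P \<alpha>2(1) s0 \<Delta>f B(1) \<Lambda>0 unfolding K3_def[symmetric] by (intro mult_mono mult_left_mono) auto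
    have t1: "3 * B * \<nu> * (2 * \<alpha>\<^sup>2 * \<beta> + \<Delta>\<^sup>2) \<le> 3 * B * \<nu> * (2 * (A\<^sup>2 * Y\<^sup>2) * \<beta> + \<Delta>\<^sup>2)"
      using \<alpha>2(1) B(1) \<nu> \<beta>(1) by (intro mult_left_mono add_mono mult_right_mono) auto
    have t2: "3 * B * \<alpha> ^ 3 \<le> 3 * B * (A ^ 3 * Y ^ 3)"
      using \<alpha>2(2) B(1) by (intro mult_left_mono) auto
    have t3: "M * (\<nu> * \<alpha>\<^sup>2 + \<alpha> ^ 3) \<le> M * (\<nu> * (A\<^sup>2 * Y\<^sup>2) + A ^ 3 * Y ^ 3)"
      using \<alpha>2 \<nu> M by (intro mult_left_mono add_mono) auto
    have fin: "3 * B * \<nu> * (2 * (A\<^sup>2 * Y\<^sup>2) * \<beta> + \<Delta>\<^sup>2) + 3 * B * (A ^ 3 * Y ^ 3) + M * (\<nu> * (A\<^sup>2 * Y\<^sup>2) + A ^ 3 * Y ^ 3) +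
        P * (A\<^sup>2 * Y\<^sup>2) * (K3 * Y) \<le>
      (3 * B * (2 * \<beta> * A\<^sup>2 + 1) + 3 * B * A ^ 3 + M * A\<^sup>2 + M * A ^ 3 + P * A\<^sup>2 * K3) * (\<nu> * \<Delta>\<^sup>2 + \<nu> * Y\<^sup>2 + Y ^ 3)"
    proof -
      \<comment> \<open>With six nonnegative coefficients and three nonnegative quantities, the
        wanted products are among those in the expanded product of sums.\<close>
      define a1 a2 a3 a4 a5 a6 where "a1 = 3 * B * (2 * \<beta> * A\<^sup>2)" and "a2 = 3 * B" and "a3 = 3 * B * A ^ 3"
        and "a4 = M * A\<^sup>2" and "a5 = M * A ^ 3" and "a6 = P * A\<^sup>2 * K3"
      define X1 X2 X3 where "X1 = \<nu> * \<Delta>\<^sup>2" and "X2 = \<nu> * Y\<^sup>2" and "X3 = Y ^ 3"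
      have nn: "a1 \<ge> 0" "a2 \<ge> 0" "a3 \<ge> 0" "a4 \<ge> 0" "a5 \<ge> 0" "a6 \<ge> 0" "X1 \<ge> 0" "X2 \<ge> 0" "X3 \<ge> 0"
        using B(1) \<beta>(1) A M P K3 \<nu> Y
        by (simp_all add: a1_def a2_def a3_def a4_def a5_def a6_def X1_def X2_def X3_def)
      have "a1 * X2 + a2 * X1 + a3 * X3 + a4 * X2 + a5 * X3 + a6 * X3 \<le> (a1 + a2 + a3 + a4 + a5 + a6) * (X1 + X2 + X3)"
        using nn by (simp add: distrib_left distrib_right)
      moreover have "3 * B * \<nu> * (2 * (A\<^sup>2 * Y\<^sup>2) * \<beta> + \<Delta>\<^sup>2) + 3 * B * (A ^ 3 * Y ^ 3) + M * (\<nu> * (A\<^sup>2 * Y\<^sup>2) + A ^ 3 * Y ^ 3) +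
        P * (A\<^sup>2 * Y\<^sup>2) * (K3 * Y) = a1 * X2 + a2 * X1 + a3 * X3 + a4 * X2 + a5 * X3 + a6 * X3"
        by (simp add: a1_def a2_def a3_def a4_def a5_def a6_def X1_def X2_def X3_def power2_eq_square power3_eq_cube algebra_simps)
      moreover have "3 * B * (2 * \<beta> * A\<^sup>2 + 1) + 3 * B * A ^ 3 + M * A\<^sup>2 + M * A ^ 3 + P * A\<^sup>2 * K3 = a1 + a2 + a3 + a4 + a5 + a6"
        by (simp add: a1_def a2_def a3_def a4_def a5_def a6_def algebra_simps)
      ultimately show ?thesis by (simp add: X1_def X2_def X3_def)
    qed
    let ?E = "LBINT x. indicator (cball 0 (1 - \<epsilon>)) x * (grad_abs v' x)\<^sup>2"
    let ?R = "\<nu> * \<Delta>\<^sup>2 + \<nu> * Y\<^sup>2 + Y ^ 3"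
    have R: "?R \<ge> 0" using \<nu> Y by simp
    have "c * (\<nu> * ?E) \<le> (c * (C - 1)) * ?R"
      using main t1 t2 t3 t4 fin c by (simp add: C_def K3_def mult.left_commute[of c])
    then have "c * (\<nu> * ?E) \<le> c * ((C - 1) * ?R)" by (simp add: mult.assoc)
    then have "\<nu> * ?E \<le> (C - 1) * ?R" using c by simp
    also have "\<dots> \<le> C * ?R" using R by (intro mult_right_mono) auto
    finally show "\<nu> * ?E \<le> C * (\<nu> * \<Delta>\<^sup>2 + \<nu> * (s0 powr (1 - 3 / p) * \<Lambda> + sqrt s0 * \<Delta>)\<^sup>2 + (s0 powr (1 - 3 / p) * \<Lambda> + sqrt s0 * \<Delta>) ^ 3)"
      by (simp add: Y_def)
  qed
qed

section \<open>Dilation and annular energies\<close>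

lemma smooth_partial: "smooth f \<Longrightarrow> smooth (partial f j)"
  unfolding smooth_def by (metis Ck.simps(2))

text \<open>Links the \<open>frechet_derivative\<close> of the definitions with the explicit
  partials, by expanding the direction in the coordinate basis.\<close>

lemma C1_grad_smooth:
  assumes "smooth f" shows "C1_grad f (partial f)"
proof (rule C1_gradI)
  have Ck: "Ck (Suc 0) f" using assms by (simp add: smooth_def del: Ck.simps)
  then have diff: "f differentiable (at x)" for x
    by (simp add: differentiable_on_eq_differentiable_at)
  show der: "(f has_derivative frechet_derivative f (at x)) (at x)" for x
    using diff frechet_derivative_works by blast
  show "frechet_derivative f (at x) h = (\<Sum>j\<in>UNIV. h $ j *\<^sub>R partial f j x)" for x h
  proof -
    have lin: "linear (frechet_derivative f (at x))" using der by (rule has_derivative_linear)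
    have "h = (\<Sum>j\<in>UNIV. h $ j *\<^sub>R axis j 1)"
      by (simp add: vec_eq_iff axis_def if_distrib cong: if_cong)
    then have "frechet_derivative f (at x) h = frechet_derivative f (at x) (\<Sum>j\<in>UNIV. h $ j *\<^sub>R axis j 1)" by simp
    also have "\<dots> = (\<Sum>j\<in>UNIV. h $ j *\<^sub>R partial f j x)"
      by (simp add: linear_sum[OF lin] linear_cmul[OF lin] partial_def)
    finally show ?thesis .
  qed
  show "continuous_on UNIV (partial f j)" for j using Ck by simp
qed

lemma C1_grad_dilation:
  assumes "C1_grad f f'" shows "C1_grad (\<lambda>x. f (r *\<^sub>R x)) (\<lambda>j x. r *\<^sub>R f' j (r *\<^sub>R x))"
  using C1_grad_affine[OF assms, of 0 r] by simp

lemma C1_grad_scaleR: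
  assumes "C1_grad f f'" shows "C1_grad (\<lambda>x. r *\<^sub>R f x) (\<lambda>j x. r *\<^sub>R f' j x)"
  by (rule C1_grad_linear[OF bounded_linear_scaleR_right assms])

lemma bbs_dilation:
  fixes h :: "real^3 \<Rightarrow> real"
  assumes "bbs h" "r > 0" shows "bbs (\<lambda>x. h (r *\<^sub>R x))"
proof -
  obtain B R where h: "R > 0" "\<And>x. \<bar>h x\<bar> \<le> B" "\<And>x. norm x > R \<Longrightarrow> h x = 0"
    by (rule bbsE[OF assms(1)]) blast
  have "h (r *\<^sub>R x) = 0" if "norm x > R / r" for x
    by (rule h(3)) (use that assms(2) in \<open>simp add: field_simps\<close>)
  moreover have "(\<lambda>x. h (r *\<^sub>R x)) \<in> borel_measurable borel"
    by (rule lbb_measurable[OF lbb_compose[OF bbs_imp_lbb[OF assms(1)]]]) (intro continuous_intros)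
  ultimately show ?thesis using h(2) unfolding bbs_def by blast
qed

lemma integral_dilation:
  fixes f :: "real^3 \<Rightarrow> real"
  assumes "r > 0" "f \<in> borel_measurable borel"
  shows "(LBINT x. f (r *\<^sub>R x)) = (LBINT x. f x) / r ^ 3"
  using integral_lborel_affine[of r f 0] assms by simp

text \<open>The velocity is dilated without an amplitude factor: transport and pressure gradient
  pick up \<open>r\<close>, the Laplacian \<open>r\<close> squared, and the mismatch is the
  viscosity \<open>1 / r\<close>.\<close>

lemma navier_stokes_dilation:
  assumes u: "smooth u" and \<pi>: "smooth \<pi>"
    and NS: "\<forall>x. - laplacian u x + convective u x + grad \<pi> x = 0"
    and div: "\<forall>x. divergence u x = 0" and r: "r > 0"
  shows "navier_stokes (1 / r) (\<lambda>x. u (r *\<^sub>R x)) (\<lambda>j x. r *\<^sub>R partial u j (r *\<^sub>R x))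
    (\<lambda>j k x. r *\<^sub>R r *\<^sub>R partial (partial u j) k (r *\<^sub>R x)) (\<lambda>x. \<pi> (r *\<^sub>R x)) (\<lambda>j x. r *\<^sub>R partial \<pi> j (r *\<^sub>R x))"
proof
  show "C1_grad (\<lambda>x. u (r *\<^sub>R x)) (\<lambda>j x. r *\<^sub>R partial u j (r *\<^sub>R x))"
    by (intro C1_grad_dilation C1_grad_smooth u)
  show "C1_grad (\<lambda>x. r *\<^sub>R partial u j (r *\<^sub>R x)) (\<lambda>k x. r *\<^sub>R r *\<^sub>R partial (partial u j) k (r *\<^sub>R x))" for j
    by (intro C1_grad_scaleR C1_grad_dilation C1_grad_smooth smooth_partial u)
  show "C1_grad (\<lambda>x. \<pi> (r *\<^sub>R x)) (\<lambda>j x. r *\<^sub>R partial \<pi> j (r *\<^sub>R x))"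
    by (intro C1_grad_dilation C1_grad_smooth \<pi>)
  show "(\<Sum>j\<in>UNIV. (r *\<^sub>R partial u j (r *\<^sub>R x)) $ j) = 0" for x
    using div[rule_format, of "r *\<^sub>R x"] by (simp add: divergence_def sum_distrib_left[symmetric])
  show "r *\<^sub>R partial \<pi> j (r *\<^sub>R x) =
      1 / r * (\<Sum>k\<in>UNIV. (r *\<^sub>R r *\<^sub>R partial (partial u k) k (r *\<^sub>R x)) $ j) -
      (\<Sum>k\<in>UNIV. u (r *\<^sub>R x) $ k * (r *\<^sub>R partial u k (r *\<^sub>R x)) $ j)" for x j
  proof -
    have "(- laplacian u (r *\<^sub>R x) + convective u (r *\<^sub>R x) + grad \<pi> (r *\<^sub>R x)) $ j = 0"
      using NS by simp
    then have "partial \<pi> j (r *\<^sub>R x) = (\<Sum>k\<in>UNIV. partial (partial u k) k (r *\<^sub>R x) $ j) -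
        (\<Sum>k\<in>UNIV. u (r *\<^sub>R x) $ k * partial u k (r *\<^sub>R x) $ j)"
      by (simp add: laplacian_def convective_def grad_def)
    then have "r * partial \<pi> j (r *\<^sub>R x) = r * (\<Sum>k\<in>UNIV. partial (partial u k) k (r *\<^sub>R x) $ j) -
        r * (\<Sum>k\<in>UNIV. u (r *\<^sub>R x) $ k * partial u k (r *\<^sub>R x) $ j)"
      by (simp add: right_diff_distrib)
    then show ?thesis using r by (simp add: sum_distrib_left mult.left_commute)
  qed
qed

section \<open>Annuli and the energy estimate in the original variables\<close>

lemma borel_annulus [measurable]: "annulus a b \<in> sets borel"
  unfolding annulus_def by measurable

lemma bounded_annulus: "bounded (annulus a b)"
  unfolding bounded_iff annulus_def by (intro exI[of _ b]) auto

text \<open>With \<open>\<epsilon> = (1 - \<theta>) / 4\<close> the widest shell has half-width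
  below \<open>1 - \<theta>\<close>. Its outer radius is then below \<open>2 - \<theta>\<close>, and
  \<open>2 - \<theta> \<le> 1 / \<theta>\<close> because the square of \<open>1 - \<theta>\<close>
  is nonnegative.\<close>

lemma shell_dilation:
  assumes "x \<in> shell (3 * ((1 - \<theta>) / 4))" "0 < \<theta>" "\<theta> < 1" "r > 0"
  shows "r *\<^sub>R x \<in> annulus (\<theta> * r) (r / \<theta>)"
proof -
  have x: "\<theta> \<le> norm x" "norm x < 1 + (1 - \<theta>)"
  proof -
    have "\<bar>norm x - 1\<bar> \<le> 3 * ((1 - \<theta>) / 4)" using assms(1) by (simp add: shell_def)
    then have "norm x - 1 \<le> 3 * ((1 - \<theta>) / 4)" "- (norm x - 1) \<le> 3 * ((1 - \<theta>) / 4)"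
      unfolding abs_le_iff by blast+
    then show "\<theta> \<le> norm x" "norm x < 1 + (1 - \<theta>)" using assms(3) by (simp_all add: field_simps)
  qed
  have "\<theta> * (1 + (1 - \<theta>)) \<le> 1"
    using zero_le_power2[of "1 - \<theta>"] by (simp add: power2_eq_square algebra_simps)
  then have "1 + (1 - \<theta>) \<le> 1 / \<theta>" using assms by (simp add: field_simps)
  then have "norm x < 1 / \<theta>" using x by linarith
  then have "r * norm x < r * (1 / \<theta>)" using assms by (intro mult_strict_left_mono) auto
  moreover have "\<theta> * r \<le> r * norm x" using x assms by (simp add: mult.commute)
  ultimately show ?thesis using assms by (simp add: annulus_def)
qed

lemma grad_norm_sq_eq: "grad_norm_sq u x = (grad_abs (partial u) x)\<^sup>2"
  by (simp add: grad_norm_sq_def grad_abs_square)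

text \<open>Undoing the dilation: the \<open>L^p\<close> norm scales by
  \<open>r powr (- 3 / p)\<close>, and the squared gradient gains \<open>r\<close> squared while the
  volume loses \<open>r ^ 3\<close>, so \<open>D / r\<close> appears. Multiplying by
  \<open>r\<close> squared restores the energy on the left.\<close>

lemma energy_growth:
  assumes u: "smooth u" and \<pi>: "smooth \<pi>"
    and NS: "\<forall>x. - laplacian u x + convective u x + grad \<pi> x = 0"
    and div: "\<forall>x. divergence u x = 0"
    and \<theta>: "0 < \<theta>" "\<theta> < 1" and p: "1 \<le> p" "p < 3"
  defines "\<epsilon> \<equiv> (1 - \<theta>) / 4"
  obtains C where "C > 0"
    "\<And>r s D L Y. r > 0 \<Longrightarrow> 0 < s \<Longrightarrow> s \<le> \<epsilon> \<Longrightarrow>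
      D = (LBINT x. indicator (annulus (\<theta> * r) (r / \<theta>)) x * grad_norm_sq u x) \<Longrightarrow>
      L = Lp_norm_on (annulus (\<theta> * r) (r / \<theta>)) p u \<Longrightarrow>
      Y = s powr (1 - 3 / p) * (r powr (- 3 / p) * L) + sqrt s * sqrt (D / r) \<Longrightarrow>
      (LBINT x. indicator (cball 0 (r * (1 - \<epsilon>))) x * grad_norm_sq u x) \<le> C * (D + r * Y\<^sup>2 + r\<^sup>2 * Y ^ 3)"
proof -
  have \<epsilon>: "0 < \<epsilon>" "\<epsilon> < 1" using \<theta> by (auto simp: \<epsilon>_def)
  show ?thesis
  proof (rule local_energy_estimate[OF \<epsilon> p])
    fix C :: real
    assume C: "C > 0"
      "\<And>\<nu> v v' v'' q q' s0 \<Lambda> \<Delta>. navier_stokes \<nu> v v' v'' q q' \<Longrightarrow> \<nu> > 0 \<Longrightarrow> 0 < s0 \<Longrightarrow> s0 \<le> \<epsilon> \<Longrightarrow>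
        \<Lambda> \<ge> 0 \<Longrightarrow> \<Delta> \<ge> 0 \<Longrightarrow>
        (LBINT x. (indicator (shell (3 * \<epsilon>)) x * norm (v x)) powr p) \<le> \<Lambda> powr p \<Longrightarrow>
        (LBINT x. (indicator (shell (3 * \<epsilon>)) x * grad_abs v' x)\<^sup>2) \<le> \<Delta>\<^sup>2 \<Longrightarrow>
        \<nu> * (LBINT x. indicator (cball 0 (1 - \<epsilon>)) x * (grad_abs v' x)\<^sup>2) \<le>
          C * (\<nu> * \<Delta>\<^sup>2 + \<nu> * (s0 powr (1 - 3 / p) * \<Lambda> + sqrt s0 * \<Delta>)\<^sup>2 + (s0 powr (1 - 3 / p) * \<Lambda> + sqrt s0 * \<Delta>) ^ 3)"
    show ?thesis
    proof (rule that[OF C(1)])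
    fix r s D L Y
    assume r: "r > 0" and s: "0 < s" "s \<le> \<epsilon>"
      and D: "D = (LBINT x. indicator (annulus (\<theta> * r) (r / \<theta>)) x * grad_norm_sq u x)"
      and L: "L = Lp_norm_on (annulus (\<theta> * r) (r / \<theta>)) p u"
      and Y: "Y = s powr (1 - 3 / p) * (r powr (- 3 / p) * L) + sqrt s * sqrt (D / r)"
    let ?A = "annulus (\<theta> * r) (r / \<theta>)"
    let ?v = "\<lambda>x. u (r *\<^sub>R x)" and ?v' = "\<lambda>j x. r *\<^sub>R partial u j (r *\<^sub>R x)"
    have cu: "continuous_on UNIV (\<lambda>x. norm (u x))"
      by (intro continuous_on_norm C1_grad_continuous[OF C1_grad_smooth[OF u]])
    have lu: "lbb (\<lambda>x. grad_norm_sq u x)" "lbb (\<lambda>x. norm (u x) powr p)"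
    proof -
      show "lbb (\<lambda>x. grad_norm_sq u x)" unfolding grad_norm_sq_eq
        by (intro lbb_continuous continuous_on_power continuous_grad_abs[OF C1_grad_smooth[OF u]])
      show "lbb (\<lambda>x. norm (u x) powr p)"
        by (rule lbb_continuous, rule continuous_on_powr'[OF cu continuous_on_const]) (use p in auto)
    qed
    have bA: "bbs (indicator ?A)" by (intro bbs_indicator bounded_annulus) measurable
    have bA_int: "bbs (\<lambda>x. indicator ?A x * norm (u x) powr p)" "bbs (\<lambda>x. indicator ?A x * grad_norm_sq u x)"
      by (intro bbs_mult_lbb bA lu)+
    have ga: "(grad_abs ?v' x)\<^sup>2 = r\<^sup>2 * grad_norm_sq u (r *\<^sub>R x)" for x
      by (simp add: grad_abs_square grad_norm_sq_def power_mult_distrib sum_distrib_left)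
    have D0: "D \<ge> 0" unfolding D by (intro integral_nonneg_AE) (simp add: grad_norm_sq_eq)
    have L0: "L \<ge> 0" unfolding L Lp_norm_on_def by simp
    have Lp: "L powr p = (LBINT x. indicator ?A x * norm (u x) powr p)"
    proof -
      have "(LBINT x. indicator ?A x * norm (u x) powr p) \<ge> 0" by (intro integral_nonneg_AE) simp
      then show ?thesis using p unfolding L Lp_norm_on_def by (simp add: set_lebesgue_integral_def powr_powr)
    qed
    have nsD: "navier_stokes (1 / r) ?v ?v' (\<lambda>j k x. r *\<^sub>R r *\<^sub>R partial (partial u j) k (r *\<^sub>R x))
      (\<lambda>x. \<pi> (r *\<^sub>R x)) (\<lambda>j x. r *\<^sub>R partial \<pi> j (r *\<^sub>R x))"
      by (rule navier_stokes_dilation[OF u \<pi> NS div r])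
    have cv: "continuous_on UNIV ?v" "continuous_on UNIV (grad_abs ?v')"
      using C1_grad_dilation[OF C1_grad_smooth[OF u], of r]
      by (auto intro: C1_grad_continuous continuous_grad_abs)
    have sub: "indicator (shell (3 * \<epsilon>)) x \<le> (indicator ?A (r *\<^sub>R x) :: real)" for x
      using shell_dilation[of x \<theta> r] \<theta> r by (auto simp: indicator_def \<epsilon>_def)
    have bsv: "bbs (\<lambda>x. indicator (shell (3 * \<epsilon>)) x * norm (?v x))" "bbs (\<lambda>x. indicator (shell (3 * \<epsilon>)) x * grad_abs ?v' x)"
      by (intro bbs_mult_lbb bbs_indicator_shell lbb_continuous continuous_intros cv)+
    have bdil: "integrable lborel (\<lambda>x. h (r *\<^sub>R x))" if "bbs h" for h :: "real^3 \<Rightarrow> real"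
      by (rule bbs_integrable[OF bbs_dilation[OF that r]])
    have 1: "(LBINT x. (indicator (shell (3 * \<epsilon>)) x * norm (?v x)) powr p) \<le> (r powr (- 3 / p) * L) powr p"
    proof -
      have "(LBINT x. (indicator (shell (3 * \<epsilon>)) x * norm (?v x)) powr p) \<le>
          (LBINT x. indicator ?A (r *\<^sub>R x) * norm (u (r *\<^sub>R x)) powr p)"
      proof (rule integral_mono)
        show "integrable lborel (\<lambda>x. (indicator (shell (3 * \<epsilon>)) x * norm (?v x)) powr p)"
          using p by (intro bbs_integrable bbs_powr bsv) auto
        show "integrable lborel (\<lambda>x. indicator ?A (r *\<^sub>R x) * norm (u (r *\<^sub>R x)) powr p)"
          by (rule bdil[OF bA_int(1)])
        show "(indicator (shell (3 * \<epsilon>)) x * norm (?v x)) powr p \<le> indicator ?A (r *\<^sub>R x) * norm (u (r *\<^sub>R x)) powr p" for x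
          using sub[of x] by (auto simp: indicator_def split: if_splits)
      qed
      also have "\<dots> = L powr p / r ^ 3"
        unfolding Lp by (rule integral_dilation[OF r bbs_measurable[OF bA_int(1)]])
      also have "\<dots> = (r powr (- 3 / p) * L) powr p"
      proof -
        have "(r powr (- 3 / p)) powr p = r powr (- 3)" using p by (simp add: powr_powr)
        also have "\<dots> = 1 / r ^ 3" using r by (simp add: powr_minus powr_numeral divide_inverse)
        finally show ?thesis using r L0 by (simp add: powr_mult)
      qed
      finally show ?thesis .
    qed
    have 2: "(LBINT x. (indicator (shell (3 * \<epsilon>)) x * grad_abs ?v' x)\<^sup>2) \<le> (sqrt (D / r))\<^sup>2"
    proof -
      have "(LBINT x. (indicator (shell (3 * \<epsilon>)) x * grad_abs ?v' x)\<^sup>2) \<le>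
          (LBINT x. r\<^sup>2 * (indicator ?A (r *\<^sub>R x) * grad_norm_sq u (r *\<^sub>R x)))"
      proof (rule integral_mono)
        show "integrable lborel (\<lambda>x. (indicator (shell (3 * \<epsilon>)) x * grad_abs ?v' x)\<^sup>2)"
          by (intro bbs_integrable bbs_power bsv) simp
        show "integrable lborel (\<lambda>x. r\<^sup>2 * (indicator ?A (r *\<^sub>R x) * grad_norm_sq u (r *\<^sub>R x)))"
          by (intro integrable_mult_right bdil[OF bA_int(2)])
        show "(indicator (shell (3 * \<epsilon>)) x * grad_abs ?v' x)\<^sup>2 \<le> r\<^sup>2 * (indicator ?A (r *\<^sub>R x) * grad_norm_sq u (r *\<^sub>R x))" for x
          using sub[of x] by (auto simp: power_mult_distrib ga indicator_def grad_norm_sq_eq split: if_splits)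
      qed
      also have "\<dots> = r\<^sup>2 * (D / r ^ 3)"
        unfolding D using integral_dilation[OF r bbs_measurable[OF bA_int(2)]] by simp
      also have "\<dots> = (sqrt (D / r))\<^sup>2" using D0 r by (simp add: power2_eq_square power3_eq_cube)
      finally show ?thesis .
    qed
    have E: "(LBINT x. indicator (cball 0 (1 - \<epsilon>)) x * (grad_abs ?v' x)\<^sup>2) =
        (LBINT x. indicator (cball 0 (r * (1 - \<epsilon>))) x * grad_norm_sq u x) / r"
    proof -
      have "indicator (cball 0 (1 - \<epsilon>)) x * (grad_abs ?v' x)\<^sup>2 =
          r\<^sup>2 * (indicator (cball 0 (r * (1 - \<epsilon>))) (r *\<^sub>R x) * grad_norm_sq u (r *\<^sub>R x))" for x
        using r by (auto simp: ga indicator_def)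
      moreover have "bbs (\<lambda>x. indicator (cball 0 (r * (1 - \<epsilon>))) x * grad_norm_sq u x)"
        by (intro bbs_mult_lbb bbs_indicator lu) auto
      ultimately show ?thesis
        using integral_dilation[OF r bbs_measurable, of "\<lambda>x. indicator (cball 0 (r * (1 - \<epsilon>))) x * grad_norm_sq u x"] r
        by (simp add: power2_eq_square power3_eq_cube)
    qed
    have "1 / r * ((LBINT x. indicator (cball 0 (r * (1 - \<epsilon>))) x * grad_norm_sq u x) / r) \<le>
        C * (1 / r * (sqrt (D / r))\<^sup>2 + 1 / r * Y\<^sup>2 + Y ^ 3)"
      using C(2)[OF nsD _ s _ _ 1 2] r L0 D0 unfolding E Y by simp
    then have "r\<^sup>2 * (1 / r * ((LBINT x. indicator (cball 0 (r * (1 - \<epsilon>))) x * grad_norm_sq u x) / r)) \<le>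
        r\<^sup>2 * (C * (1 / r * (sqrt (D / r))\<^sup>2 + 1 / r * Y\<^sup>2 + Y ^ 3))"
      by (intro mult_left_mono) auto
    then show "(LBINT x. indicator (cball 0 (r * (1 - \<epsilon>))) x * grad_norm_sq u x) \<le> C * (D + r * Y\<^sup>2 + r\<^sup>2 * Y ^ 3)"
      using r D0 by (simp add: power2_eq_square algebra_simps)
    qed
  qed
qed

text \<open>Integrating the annular energies against \<open>d\<rho>/\<rho>\<close> gives a finite quantity by Tonelli,
  so they cannot dominate a multiple of \<open>1/g\<close>.\<close>

lemma exists_small_annular_energy:
  fixes g :: "real \<Rightarrow> real" and G :: "real^3 \<Rightarrow> real"
  assumes g: "\<forall>\<rho>\<ge>1. g \<rho> \<ge> 1"
    and g_int: "\<forall>a\<ge>1. (\<integral>\<^sup>+\<rho>\<in>{a..}. ennreal (1 / (g \<rho> * \<rho>)) \<partial>lborel) = \<infinity>"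
    and G: "integrable lborel G" "\<And>x. G x \<ge> 0" and \<theta>: "0 < \<theta>" "\<theta> < 1" and \<eta>: "\<eta> > 0"
  shows "\<exists>\<rho>\<ge>R. g \<rho> * (LBINT x. indicator (annulus (\<theta> * \<rho>) (\<rho> / \<theta>)) x * G x) \<le> \<eta>"
proof (rule ccontr)
  define D where "D \<rho> = (LBINT x. indicator (annulus (\<theta> * \<rho>) (\<rho> / \<theta>)) x * G x)" for \<rho>
  assume "\<not> ?thesis"
  then have *: "g \<rho> * D \<rho> > \<eta>" if "\<rho> \<ge> R" for \<rho> using that unfolding D_def by force
  \<comment> \<open>Beyond 1 the lower bound on \<open>g\<close> and the divergence hypothesis are
    available, and \<open>\<rho>\<close> is positive.\<close>
  define a where "a = max R 1"
  define F where "F \<rho> x = ennreal (if a \<le> \<rho> \<and> \<theta> * \<rho> \<le> norm x \<and> norm x < \<rho> / \<theta> then G x / \<rho> else 0)"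
    for \<rho> and x :: "real^3"
  have [measurable]: "G \<in> borel_measurable borel" using G(1) by (auto dest: borel_measurable_integrable)
  have F_meas: "case_prod F \<in> borel_measurable (lborel \<Otimes>\<^sub>M lborel)"
    unfolding F_def[abs_def] case_prod_unfold by measurable
  have "ennreal (1 / (g \<rho> * \<rho>)) * indicator {a..} \<rho> \<le> ennreal (1 / \<eta>) * (\<integral>\<^sup>+x. F \<rho> x \<partial>lborel)" for \<rho>
  proof (cases "a \<le> \<rho>")
    case True
    then have \<rho>: "\<rho> \<ge> R" "\<rho> \<ge> 1" by (auto simp: a_def)
    have "(\<integral>\<^sup>+x. F \<rho> x \<partial>lborel) = (\<integral>\<^sup>+x. ennreal (indicator (annulus (\<theta> * \<rho>) (\<rho> / \<theta>)) x * G x / \<rho>) \<partial>lborel)"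
      using True by (intro nn_integral_cong) (auto simp: F_def annulus_def indicator_def)
    also have "\<dots> = ennreal (LBINT x. indicator (annulus (\<theta> * \<rho>) (\<rho> / \<theta>)) x * G x / \<rho>)"
    proof (rule nn_integral_eq_integral)
      have "integrable lborel (\<lambda>x. indicator (annulus (\<theta> * \<rho>) (\<rho> / \<theta>)) x *\<^sub>R G x)"
        by (rule integrable_mult_indicator[OF _ G(1)]) simp
      then show "integrable lborel (\<lambda>x. indicator (annulus (\<theta> * \<rho>) (\<rho> / \<theta>)) x * G x / \<rho>)" by simp
    qed (use \<rho> G(2) in auto)
    also have "\<dots> = ennreal (D \<rho> / \<rho>)" by (simp add: D_def)
    finally have "ennreal (1 / \<eta>) * (\<integral>\<^sup>+x. F \<rho> x \<partial>lborel) = ennreal (1 / \<eta> * (D \<rho> / \<rho>))"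
      using \<eta> by (simp add: ennreal_mult'[symmetric])
    moreover have "1 / (g \<rho> * \<rho>) \<le> 1 / \<eta> * (D \<rho> / \<rho>)"
    proof -
      have "g \<rho> > 0" using g \<rho>(2) by force
      then have "1 / g \<rho> \<le> D \<rho> / \<eta>"
        using *[OF \<rho>(1)] \<eta> by (simp add: divide_le_eq le_divide_eq mult.commute)
      from divide_right_mono[OF this, of \<rho>] show ?thesis using \<rho>(2) by simp
    qed
    ultimately show ?thesis using True by (simp add: ennreal_leI)
  qed simp
  then have "(\<integral>\<^sup>+\<rho>\<in>{a..}. ennreal (1 / (g \<rho> * \<rho>)) \<partial>lborel) \<le> (\<integral>\<^sup>+\<rho>. ennreal (1 / \<eta>) * (\<integral>\<^sup>+x. F \<rho> x \<partial>lborel) \<partial>lborel)"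
    by (intro nn_integral_mono) auto
  also have "\<dots> = ennreal (1 / \<eta>) * (\<integral>\<^sup>+\<rho>. (\<integral>\<^sup>+x. F \<rho> x \<partial>lborel) \<partial>lborel)"
    using F_meas by (intro nn_integral_cmult lborel.borel_measurable_nn_integral)
  also have "(\<integral>\<^sup>+\<rho>. (\<integral>\<^sup>+x. F \<rho> x \<partial>lborel) \<partial>lborel) = (\<integral>\<^sup>+x. (\<integral>\<^sup>+\<rho>. F \<rho> x \<partial>lborel) \<partial>lborel)"
    using lborel_pair.Fubini'[OF F_meas] by simp
  also have "\<dots> \<le> (\<integral>\<^sup>+x. ennreal (1 / \<theta>\<^sup>2 * G x) \<partial>lborel)"
  proof (rule nn_integral_mono)
    fix x :: "real^3"
    show "(\<integral>\<^sup>+\<rho>. F \<rho> x \<partial>lborel) \<le> ennreal (1 / \<theta>\<^sup>2 * G x)"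
    proof (cases "x = 0")
      case True
      \<comment> \<open>The origin lies in none of the annuli considered, because
        \<open>\<theta> * \<rho>\<close> is positive.\<close>
      have "F \<rho> x = 0" for \<rho> using True \<theta> by (auto simp: F_def a_def mult_le_0_iff)
      then show ?thesis by simp
    next
      case False
      define n where "n = norm x"
      have n: "n > 0" using False by (simp add: n_def)
      \<comment> \<open>A fixed point is met by radii between \<open>\<theta> * n\<close> and
        \<open>n / \<theta>\<close>. There \<open>1 / \<rho>\<close> is at most
        \<open>1 / (\<theta> * n)\<close> and the interval is shorter than
        \<open>n / \<theta>\<close>, so \<open>n\<close> cancels.\<close>
      have "(\<integral>\<^sup>+\<rho>. F \<rho> x \<partial>lborel) \<le> (\<integral>\<^sup>+\<rho>. ennreal (G x / (\<theta> * n)) * indicator {\<theta> * n..n / \<theta>} \<rho> \<partial>lborel)"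
      proof (rule nn_integral_mono)
        fix \<rho>
        show "F \<rho> x \<le> ennreal (G x / (\<theta> * n)) * indicator {\<theta> * n..n / \<theta>} \<rho>"
        proof (cases "a \<le> \<rho> \<and> \<theta> * \<rho> \<le> norm x \<and> norm x < \<rho> / \<theta>")
          case True
          then have "\<rho> \<in> {\<theta> * n..n / \<theta>}" using \<theta> by (auto simp: n_def field_simps)
          moreover from this have "G x / \<rho> \<le> G x / (\<theta> * n)"
            using n \<theta> G(2)[of x] True by (intro divide_left_mono mult_pos_pos) (auto simp: a_def)
          ultimately show ?thesis using True by (simp add: F_def ennreal_leI)
        next
          case False
          then have "F \<rho> x = 0" unfolding F_def by (simp only: if_False ennreal_0)
          then show ?thesis by simp
        qed
      qed
      also have "\<dots> = ennreal (G x / (\<theta> * n)) * ennreal (n / \<theta> - \<theta> * n)"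
      proof -
        have "\<theta> * n \<le> n / \<theta>"
        proof -
          have "\<theta> * \<theta> * n \<le> 1 * n" using \<theta> n by (intro mult_right_mono) (auto simp: mult_le_one)
          then show ?thesis using \<theta> by (simp add: field_simps)
        qed
        then show ?thesis by (simp add: nn_integral_cmult_indicator)
      qed
      also have "\<dots> \<le> ennreal (G x / (\<theta> * n)) * ennreal (n / \<theta>)"
        using \<theta> n by (intro mult_left_mono ennreal_leI) auto
      also have "\<dots> = ennreal (1 / \<theta>\<^sup>2 * G x)"
        using \<theta> n G(2)[of x] by (simp add: ennreal_mult[symmetric] power2_eq_square)
      finally show ?thesis .
    qed
  qed
  also have "\<dots> = ennreal (LBINT x. 1 / \<theta>\<^sup>2 * G x)"
    using G by (intro nn_integral_eq_integral integrable_mult_right) auto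
  finally have "(\<integral>\<^sup>+\<rho>\<in>{a..}. ennreal (1 / (g \<rho> * \<rho>)) \<partial>lborel) \<le> ennreal (1 / \<eta>) * ennreal (LBINT x. 1 / \<theta>\<^sup>2 * G x)"
    by (simp add: mult_left_mono)
  moreover have "(\<integral>\<^sup>+\<rho>\<in>{a..}. ennreal (1 / (g \<rho> * \<rho>)) \<partial>lborel) = \<infinity>"
    using g_int by (simp add: a_def)
  moreover have "ennreal (1 / \<eta>) * ennreal (LBINT x. 1 / \<theta>\<^sup>2 * G x) < \<infinity>"
    by (simp add: ennreal_mult_less_top)
  ultimately show False by auto
qed

section \<open>The Liouville theorem\<close>

lemma energy_eq_0:
  assumes u: "smooth u" and \<pi>: "smooth \<pi>"
    and NS: "\<forall>x. - laplacian u x + convective u x + grad \<pi> x = 0"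
    and div: "\<forall>x. divergence u x = 0"
    and G: "integrable lborel (grad_norm_sq u)"
    and \<theta>: "0 < \<theta>" "\<theta> < 1" and p: "1 \<le> p" "p < 3"
    and g: "\<forall>\<rho>\<ge>1. g \<rho> \<ge> 1" and g_lim: "((\<lambda>\<rho>. \<rho> powr (-1/3) * g \<rho>) \<longlongrightarrow> 0) at_top"
    and g_int: "\<forall>a\<ge>1. (\<integral>\<^sup>+\<rho>\<in>{a..}. ennreal (1 / (g \<rho> * \<rho>)) \<partial>lborel) = \<infinity>"
    and C0: "C0 \<ge> 0" "\<And>\<rho>. \<rho> \<ge> R0 \<Longrightarrow> Lp_norm_on (annulus (\<theta> * \<rho>) (\<rho> / \<theta>)) p u \<le>
      C0 * (\<rho> powr (2 / p - 1 / 3) * g \<rho> powr (3 / p - 1))"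
  shows "(LBINT x. indicator (cball 0 r) x * grad_norm_sq u x) = 0"
proof -
  define a where "a = 3 / p - 1"
  have a: "a > 0" using p by (simp add: a_def field_simps)
  define \<epsilon> where "\<epsilon> = (1 - \<theta>) / 4"
  have \<epsilon>: "0 < \<epsilon>" "\<epsilon> < 1" using \<theta> by (auto simp: \<epsilon>_def)
  have G0: "grad_norm_sq u x \<ge> 0" for x by (simp add: grad_norm_sq_eq)
  define E where "E r = (LBINT x. indicator (cball 0 r) x * grad_norm_sq u x)" for r
  have intE: "integrable lborel (\<lambda>x. indicator (cball 0 r) x * grad_norm_sq u x)" for r
    using integrable_mult_indicator[OF _ G, of "cball 0 r"] by simp
  have E_mono: "E s \<le> E t" if "s \<le> t" for s t
    unfolding E_def by (rule integral_mono[OF intE intE]) (use that G0 in \<open>auto simp: indicator_def\<close>)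
  have E0: "E r \<ge> 0" unfolding E_def by (intro integral_nonneg_AE) (simp add: G0)
  show ?thesis
  proof (rule energy_growth[OF u \<pi> NS div \<theta> p, folded \<epsilon>_def])
    fix C :: real
    assume C: "C > 0" "\<And>r s D L Y. r > 0 \<Longrightarrow> 0 < s \<Longrightarrow> s \<le> \<epsilon> \<Longrightarrow>
      D = (LBINT x. indicator (annulus (\<theta> * r) (r / \<theta>)) x * grad_norm_sq u x) \<Longrightarrow>
      L = Lp_norm_on (annulus (\<theta> * r) (r / \<theta>)) p u \<Longrightarrow>
      Y = s powr (1 - 3 / p) * (r powr (- 3 / p) * L) + sqrt s * sqrt (D / r) \<Longrightarrow>
      (LBINT x. indicator (cball 0 (r * (1 - \<epsilon>))) x * grad_norm_sq u x) \<le> C * (D + r * Y\<^sup>2 + r\<^sup>2 * Y ^ 3)"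
    have small: "E r \<le> 13 * C * \<eta>" if \<eta>: "0 < \<eta>" "\<eta> \<le> 1" for \<eta>
    proof -
      \<comment> \<open>Large enough that \<open>C0 * \<kappa> powr (- a)\<close> is at most
        \<open>\<eta>\<close>; it depends on \<open>C0\<close> and \<open>\<eta>\<close>, not on the
        radius.\<close>
      define \<kappa> where "\<kappa> = max 1 ((C0 / \<eta>) powr (1 / a))"
      have \<kappa>: "\<kappa> \<ge> 1" by (simp add: \<kappa>_def)
      have "C0 / \<eta> = ((C0 / \<eta>) powr (1 / a)) powr a" using a C0(1) \<eta> by (simp add: powr_powr)
      also have "\<dots> \<le> \<kappa> powr a" using a by (intro powr_mono2) (auto simp: \<kappa>_def)
      finally have C0\<kappa>: "C0 * \<kappa> powr (- a) \<le> \<eta>"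
        using \<eta> \<kappa> by (simp add: powr_minus field_simps)
      have "\<epsilon> / \<kappa> > 0" using \<epsilon> \<kappa> by simp
      then have "eventually (\<lambda>\<rho>. \<rho> powr (-1/3) * g \<rho> < \<epsilon> / \<kappa>) at_top" by (rule order_tendstoD(2)[OF g_lim])
      then obtain R1 where R1: "\<And>\<rho>. \<rho> \<ge> R1 \<Longrightarrow> \<rho> powr (-1/3) * g \<rho> < \<epsilon> / \<kappa>"
        by (auto simp: eventually_at_top_linorder)
      \<comment> \<open>Asking for \<open>g * D\<close> below this value makes
        \<open>\<kappa> * g * D\<close> at most \<open>\<eta>\<^sup>2\<close>, whose root enters
        \<open>Y\<close>.\<close>
      have "\<eta>\<^sup>2 / \<kappa> > 0" using \<eta> \<kappa> by simp
      \<comment> \<open>The four thresholds serve the \<open>L^p\<close> growth bound, the size of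
        the splitting scale, \<open>\<rho> \<ge> 1\<close>, and the inclusion of the ball of radius
        \<open>r\<close> in the inner ball.\<close>
      from exists_small_annular_energy[OF g g_int G G0 \<theta> this, of "Max {R0, R1, 1, r / (1 - \<epsilon>)}"]
      obtain \<rho> where \<rho>: "\<rho> \<ge> R0" "\<rho> \<ge> R1" "\<rho> \<ge> 1" "\<rho> \<ge> r / (1 - \<epsilon>)"
        and gD: "g \<rho> * (LBINT x. indicator (annulus (\<theta> * \<rho>) (\<rho> / \<theta>)) x * grad_norm_sq u x) \<le> \<eta>\<^sup>2 / \<kappa>"
        by auto
      define D where "D = (LBINT x. indicator (annulus (\<theta> * \<rho>) (\<rho> / \<theta>)) x * grad_norm_sq u x)"
      define L where "L = Lp_norm_on (annulus (\<theta> * \<rho>) (\<rho> / \<theta>)) p u"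
      \<comment> \<open>The splitting scale divided by \<open>\<rho>\<close>; the choice of
        \<open>R1\<close> keeps it below \<open>\<epsilon>\<close>.\<close>
      define s where "s = \<kappa> * (\<rho> powr (-1/3) * g \<rho>)"
      define Y where "Y = s powr (1 - 3 / p) * (\<rho> powr (- 3 / p) * L) + sqrt s * sqrt (D / \<rho>)"
      have g1: "g \<rho> \<ge> 1" using g \<rho> by simp
      have D0: "D \<ge> 0" unfolding D_def by (intro integral_nonneg_AE) (simp add: G0)
      have L0: "L \<ge> 0" unfolding L_def Lp_norm_on_def by simp
      have s: "0 < s" "s \<le> \<epsilon>"
        using R1[OF \<rho>(2)] \<kappa> \<rho>(3) g1 by (auto simp: s_def field_simps)
      have gD': "g \<rho> * D \<le> \<eta>\<^sup>2 / \<kappa>" using gD by (simp add: D_def)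
      \<comment> \<open>The powers of \<open>g\<close> cancel, and those of \<open>\<rho>\<close>
        add up to -2/3.\<close>
      have term1: "s powr (1 - 3 / p) * (\<rho> powr (- 3 / p) * L) \<le> \<eta> * \<rho> powr (-2/3)"
      proof -
        have "s powr (1 - 3 / p) * (\<rho> powr (- 3 / p) * L) \<le>
            s powr (- a) * (\<rho> powr (- 3 / p) * (C0 * (\<rho> powr (2 / p - 1 / 3) * g \<rho> powr a)))"
          using C0(2)[OF \<rho>(1)] by (auto simp: a_def L_def intro!: mult_left_mono)
        also have "\<dots> = C0 * \<kappa> powr (- a) * ((\<rho> powr (a / 3) * \<rho> powr (- 3 / p) * \<rho> powr (2 / p - 1 / 3)) *
            (g \<rho> powr (- a) * g \<rho> powr a))"
          using \<kappa> \<rho>(3) g1 by (simp add: s_def powr_mult powr_powr ac_simps)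
        also have "\<rho> powr (a / 3) * \<rho> powr (- 3 / p) * \<rho> powr (2 / p - 1 / 3) = \<rho> powr (-2/3)"
        proof -
          have "a / 3 + - 3 / p + (2 / p - 1 / 3) = -2/3" using p by (simp add: a_def field_simps)
          then show ?thesis by (simp only: powr_add[symmetric])
        qed
        also have "g \<rho> powr (- a) * g \<rho> powr a = 1" using g1 by (simp add: powr_add[symmetric])
        also have "C0 * \<kappa> powr (- a) * (\<rho> powr (-2/3) * 1) \<le> \<eta> * \<rho> powr (-2/3)"
          using C0\<kappa> by (simp add: mult_right_mono)
        finally show ?thesis .
      qed
      \<comment> \<open>Squared, the term is \<open>\<kappa> * g \<rho> * D\<close> times
        \<open>\<rho> powr (-4/3)\<close>.\<close>
      have term2: "sqrt s * sqrt (D / \<rho>) \<le> \<eta> * \<rho> powr (-2/3)"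
      proof -
        have "s * (D / \<rho>) = \<kappa> * (g \<rho> * D) * (\<rho> powr (-1/3) * \<rho> powr (- 1))"
          using \<rho>(3) by (simp add: s_def powr_minus field_simps)
        also have "\<rho> powr (-1/3) * \<rho> powr (- 1) = (\<rho> powr (-2/3))\<^sup>2"
          by (simp only: power2_eq_square powr_add[symmetric]) simp
        also have "\<kappa> * (g \<rho> * D) * (\<rho> powr (-2/3))\<^sup>2 \<le> \<kappa> * (\<eta>\<^sup>2 / \<kappa>) * (\<rho> powr (-2/3))\<^sup>2"
          using gD' \<kappa> by (intro mult_right_mono mult_left_mono) auto
        also have "\<dots> = (\<eta> * \<rho> powr (-2/3))\<^sup>2" using \<kappa> by (simp add: power_mult_distrib)
        finally have "sqrt (s * (D / \<rho>)) \<le> sqrt ((\<eta> * \<rho> powr (-2/3))\<^sup>2)" by (rule real_sqrt_le_mono)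
        also have "\<dots> = \<eta> * \<rho> powr (-2/3)" using \<eta> by (intro real_sqrt_unique) auto
        finally show ?thesis by (simp only: real_sqrt_mult)
      qed
      have Y0: "Y \<ge> 0" unfolding Y_def using L0 D0 s \<rho>(3) by (intro add_nonneg_nonneg mult_nonneg_nonneg) auto
      have Y: "Y \<le> 2 * \<eta> * \<rho> powr (-2/3)" using term1 term2 by (simp add: Y_def)
      have 1: "\<rho> * Y\<^sup>2 \<le> 4 * \<eta>"
      proof -
        have "\<rho> * Y\<^sup>2 \<le> \<rho> * (2 * \<eta> * \<rho> powr (-2/3))\<^sup>2"
          using Y Y0 \<rho>(3) by (intro mult_left_mono power_mono) auto
        also have "\<dots> = 4 * \<eta>\<^sup>2 * (\<rho> powr 1 * \<rho> powr (-2/3) * \<rho> powr (-2/3))"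
          using \<rho>(3) by (simp add: power2_eq_square)
        also have "\<rho> powr 1 * \<rho> powr (-2/3) * \<rho> powr (-2/3) = \<rho> powr (-1/3)"
          by (simp only: powr_add[symmetric]) simp
        also have "4 * \<eta>\<^sup>2 * \<rho> powr (-1/3) \<le> 4 * \<eta>\<^sup>2 * 1"
          using \<rho>(3) powr_mono[of "-1/3" 0 \<rho>] by (intro mult_left_mono) auto
        also have "\<dots> \<le> 4 * \<eta>" using \<eta> by (simp add: power2_eq_square mult_left_le)
        finally show ?thesis .
      qed
      \<comment> \<open>The critical term: the power of \<open>\<rho>\<close> is exactly 0, so
        smallness comes from \<open>\<eta>\<close> alone.\<close>
      have 2: "\<rho>\<^sup>2 * Y ^ 3 \<le> 8 * \<eta>"
      proof -
        have "\<rho>\<^sup>2 * Y ^ 3 \<le> \<rho>\<^sup>2 * (2 * \<eta> * \<rho> powr (-2/3)) ^ 3"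
          using Y Y0 by (intro mult_left_mono power_mono) auto
        also have "\<dots> = 8 * \<eta> ^ 3 * (\<rho> powr 2 * \<rho> powr (-2/3) * \<rho> powr (-2/3) * \<rho> powr (-2/3))"
          using \<rho>(3) by (simp add: power3_eq_cube powr_numeral)
        also have "\<rho> powr 2 * \<rho> powr (-2/3) * \<rho> powr (-2/3) * \<rho> powr (-2/3) = 1"
          using \<rho>(3) by (simp only: powr_add[symmetric]) simp
        also have "8 * \<eta> ^ 3 * 1 \<le> 8 * \<eta>"
          using \<eta> power_decreasing[of 1 3 \<eta>] by simp
        finally show ?thesis .
      qed
      have 3: "D \<le> \<eta>"
      proof -
        have "D \<le> g \<rho> * D" using g1 D0 by (simp add: mult_le_cancel_right1)
        also have "\<dots> \<le> \<eta>\<^sup>2 / \<kappa>" by (rule gD')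
        also have "\<dots> \<le> \<eta>\<^sup>2 / 1" using \<kappa> by (intro divide_left_mono) auto
        also have "\<dots> \<le> \<eta>" using \<eta> by (simp add: power2_eq_square mult_left_le)
        finally show ?thesis .
      qed
      have "E r \<le> E (\<rho> * (1 - \<epsilon>))" using \<rho>(4) \<epsilon> by (intro E_mono) (simp add: field_simps)
      also have "\<dots> \<le> C * (D + \<rho> * Y\<^sup>2 + \<rho>\<^sup>2 * Y ^ 3)"
        unfolding E_def by (rule C(2)[OF _ s D_def L_def Y_def]) (use \<rho>(3) in simp)
      \<comment> \<open>\<open>13 = 1 + 4 + 8\<close>, one summand for each of the three
        terms.\<close>
      also have "\<dots> \<le> C * (13 * \<eta>)" using 1 2 3 C(1) by (intro mult_left_mono) auto
      finally show ?thesis by simp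
    qed
    have "E r \<le> 0"
    proof (rule field_le_epsilon)
      fix e :: real assume e: "e > 0"
      have "E r \<le> 13 * C * min 1 (e / (13 * C))" using e C(1) by (intro small) auto
      also have "\<dots> \<le> 13 * C * (e / (13 * C))" using C(1) by (intro mult_left_mono) auto
      also have "\<dots> = e" using C(1) by simp
      finally show "E r \<le> 0 + e" by simp
    qed
    then show ?thesis using E0 by (simp add: E_def)
  qed
qed

text \<open>Vanishing energy leaves the constants, and this lower bound excludes the nonzero ones.
  The annulus contains a ball of radius \<open>r * (1 - \<theta>)\<close> centred at distance
  \<open>r\<close>, so its volume is at least of order \<open>r ^ 3\<close>.\<close>

lemma constant_Lp_norm_annulus_ge:
  assumes \<theta>: "0 < \<theta>" "\<theta> < 1" and p: "1 \<le> p" and r: "r > 0"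
  shows "norm c * (unit_ball_vol 3 * (1 - \<theta>) ^ 3) powr (1 / p) * r powr (3 / p) \<le>
    Lp_norm_on (annulus (\<theta> * r) (r / \<theta>)) p (\<lambda>x. c)"
proof -
  let ?A = "annulus (\<theta> * r) (r / \<theta>)"
  let ?B = "ball (r *\<^sub>R axis 1 1 :: real^3) (r * (1 - \<theta>))"
  have "?B \<subseteq> ?A"
  proof
    fix x assume "x \<in> ?B"
    then have "norm (r *\<^sub>R axis 1 1 - x) < r * (1 - \<theta>)" by (simp add: dist_norm)
    moreover have "\<bar>norm (r *\<^sub>R axis 1 1 :: real^3) - norm x\<bar> \<le> norm (r *\<^sub>R axis 1 1 - x)" by (rule norm_triangle_ineq3)
    ultimately have "\<bar>r - norm x\<bar> < r * (1 - \<theta>)" using r by simp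
    then have x: "\<theta> * r \<le> norm x" "norm x < r * (2 - \<theta>)" by (auto simp: abs_less_iff algebra_simps)
    have "\<theta> * (2 - \<theta>) \<le> 1"
      using zero_le_power2[of "1 - \<theta>"] by (simp add: power2_eq_square algebra_simps)
    then have "r * (\<theta> * (2 - \<theta>)) \<le> r * 1" using r by (intro mult_left_mono) auto
    then have "r * (2 - \<theta>) \<le> r / \<theta>" using \<theta> by (simp add: field_simps)
    then show "x \<in> ?A" using x by (simp add: annulus_def)
  qed
  then have "measure lborel ?B \<le> measure lborel ?A"
    using emeasure_bounded_finite[OF bounded_annulus] by (intro measure_mono_fmeasurable) (auto simp: fmeasurable_def)
  moreover have "measure lborel ?B = unit_ball_vol 3 * (1 - \<theta>) ^ 3 * r ^ 3"
    using r \<theta> content_ball[of "r * (1 - \<theta>)" "r *\<^sub>R axis 1 1 :: real^3"] by (simp add: power_mult_distrib)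
  ultimately have vol: "unit_ball_vol 3 * (1 - \<theta>) ^ 3 * r ^ 3 \<le> measure lborel ?A" by simp
  have "norm c * (unit_ball_vol 3 * (1 - \<theta>) ^ 3) powr (1 / p) * r powr (3 / p) =
      (norm c powr p * (unit_ball_vol 3 * (1 - \<theta>) ^ 3 * r ^ 3)) powr (1 / p)"
  proof -
    have "norm c * V powr (1 / p) * r powr (3 / p) = (norm c powr p * (V * r ^ 3)) powr (1 / p)" if "V \<ge> 0" for V
    proof -
      have "(r ^ 3) powr (1 / p) = r powr (3 / p)" using powr_powr[of r 3 "1 / p"] r by simp
      then show ?thesis using p r that by (simp add: powr_mult powr_powr mult.assoc)
    qed
    moreover have "unit_ball_vol 3 * (1 - \<theta>) ^ 3 \<ge> 0" using \<theta> by (simp add: unit_ball_vol_nonneg)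
    ultimately show ?thesis by blast
  qed
  also have "\<dots> \<le> (norm c powr p * measure lborel ?A) powr (1 / p)"
    using vol p r \<theta> by (intro powr_mono2 mult_left_mono mult_nonneg_nonneg unit_ball_vol_nonneg) auto
  also have "\<dots> = Lp_norm_on ?A p (\<lambda>x. c)"
    by (simp add: Lp_norm_on_def set_lebesgue_integral_def mult.commute)
  finally show ?thesis .
qed

theorem theorem1:
  fixes g :: "real \<Rightarrow> real" and u :: "real^3 \<Rightarrow> real^3" and \<pi> :: "real^3 \<Rightarrow> real"
  assumes g_range: "\<forall>\<rho>\<ge>1. g \<rho> \<ge> 1"
    and g_mono: "mono_on {1..} g"
    and g_lim: "((\<lambda>\<rho>. \<rho> powr (-1/3) * g \<rho>) \<longlongrightarrow> 0) at_top"
    and g_int: "\<forall>a\<ge>1. (\<integral>\<^sup>+\<rho>\<in>{a..}. ennreal (1 / (g \<rho> * \<rho>)) \<partial>lborel) = \<infinity>"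
    and u_smooth: "smooth u" and pi_smooth: "smooth \<pi>"
    and NS: "\<forall>x. - laplacian u x + convective u x + grad \<pi> x = 0"
    and div_free: "\<forall>x. divergence u x = 0"
    and grad_L2: "integrable lborel (grad_norm_sq u)"
    and decay: "\<exists>\<theta> p. 0 < \<theta> \<and> \<theta> < 1 \<and> 1 \<le> p \<and> p < 3 \<and>
       Limsup at_top (\<lambda>\<rho>. ereal (Lp_norm_on (annulus (\<theta> * \<rho>) (\<rho> / \<theta>)) p u /
          (\<rho> powr (2 / p - 1 / 3) * g \<rho> powr (3 / p - 1)))) < \<infinity>"
  shows "u = (\<lambda>x. 0)"
proof -
  obtain \<theta> p where \<theta>: "0 < \<theta>" "\<theta> < 1" and p: "1 \<le> p" "p < 3" and
    Lim: "Limsup at_top (\<lambda>\<rho>. ereal (Lp_norm_on (annulus (\<theta> * \<rho>) (\<rho> / \<theta>)) p u /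
          (\<rho> powr (2 / p - 1 / 3) * g \<rho> powr (3 / p - 1)))) < \<infinity>"
    using decay by blast
  \<comment> \<open>A finite natural number above the limit superior turns the decay hypothesis into
    an inequality for all large radii.\<close>
  obtain n :: nat where n: "Limsup at_top (\<lambda>\<rho>. ereal (Lp_norm_on (annulus (\<theta> * \<rho>) (\<rho> / \<theta>)) p u /
          (\<rho> powr (2 / p - 1 / 3) * g \<rho> powr (3 / p - 1)))) < ereal (real n)"
    using Lim[THEN less_imp_neq, THEN less_PInf_Ex_of_nat[THEN iffD1]] by blast
  define C0 where "C0 = real n"
  have "eventually (\<lambda>\<rho>. ereal (Lp_norm_on (annulus (\<theta> * \<rho>) (\<rho> / \<theta>)) p u /
          (\<rho> powr (2 / p - 1 / 3) * g \<rho> powr (3 / p - 1))) < ereal C0) at_top"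
    using Limsup_lessD[OF n] by (simp add: C0_def)
  then obtain R where R: "\<And>\<rho>. \<rho> \<ge> R \<Longrightarrow> Lp_norm_on (annulus (\<theta> * \<rho>) (\<rho> / \<theta>)) p u /
          (\<rho> powr (2 / p - 1 / 3) * g \<rho> powr (3 / p - 1)) < C0"
    by (auto simp: eventually_at_top_linorder)
  define R0 where "R0 = max R 1"
  have C0: "Lp_norm_on (annulus (\<theta> * \<rho>) (\<rho> / \<theta>)) p u \<le> C0 * (\<rho> powr (2 / p - 1 / 3) * g \<rho> powr (3 / p - 1))"
    if "\<rho> \<ge> R0" for \<rho>
  proof -
    have \<rho>: "\<rho> \<ge> R" "\<rho> \<ge> 1" using that by (auto simp: R0_def)
    have "g \<rho> \<ge> 1" using g_range \<rho> by simp
    then have "\<rho> powr (2 / p - 1 / 3) * g \<rho> powr (3 / p - 1) > 0" using \<rho> by simp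
    then show ?thesis using R[OF \<rho>(1)] by (simp add: pos_divide_less_eq)
  qed
  have E0: "(LBINT x. indicator (cball 0 r) x * grad_norm_sq u x) = 0" for r
    by (rule energy_eq_0[OF u_smooth pi_smooth NS div_free grad_L2 \<theta> p g_range g_lim g_int _ C0])
      (auto simp: C0_def)
  have G0: "grad_norm_sq u x \<ge> 0" for x by (simp add: grad_norm_sq_eq)
  have contG: "continuous_on UNIV (grad_norm_sq u)"
    unfolding grad_norm_sq_eq[abs_def]
    by (intro continuous_on_power continuous_grad_abs[OF C1_grad_smooth[OF u_smooth]])
  \<comment> \<open>Balls exhaust space, so the whole Dirichlet integral vanishes; by continuity the
    gradient then vanishes everywhere and \<open>u\<close> is constant.\<close>
  have "(\<lambda>n. LBINT x. indicator (cball 0 (real n)) x * grad_norm_sq u x) \<longlonglongrightarrow> (LBINT x. grad_norm_sq u x)"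
  proof (rule integral_dominated_convergence[where w = "grad_norm_sq u"])
    show "AE x in lborel. (\<lambda>n. indicator (cball 0 (real n)) x * grad_norm_sq u x) \<longlonglongrightarrow> grad_norm_sq u x"
    proof (intro AE_I2 tendsto_eventually)
      fix x :: "real^3"
      obtain N :: nat where N: "norm x \<le> real N" using real_arch_simple by blast
      show "eventually (\<lambda>n. indicator (cball 0 (real n)) x * grad_norm_sq u x = grad_norm_sq u x) sequentially"
        unfolding eventually_sequentially by (intro exI[of _ N]) (use N in auto)
    qed
    show "AE x in lborel. norm (indicator (cball 0 (real n)) x * grad_norm_sq u x) \<le> grad_norm_sq u x" for n
      using G0 by (auto simp: indicator_def)
    show "(\<lambda>x. indicator (cball 0 (real n)) x * grad_norm_sq u x) \<in> borel_measurable lborel" for n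
      using bbs_measurable[OF bbs_mult_lbb[OF bbs_indicator lbb_continuous[OF contG]], of "cball 0 (real n)"] by simp
  qed (use grad_L2 in \<open>auto dest: borel_measurable_integrable\<close>)
  then have "(LBINT x. grad_norm_sq u x) = 0" by (simp add: E0 LIMSEQ_const_iff)
  then have "grad_norm_sq u x = 0" for x
    by (rule integral_eq_0_continuous[OF grad_L2 _ contG G0])
  then have "partial u j x = 0" for j x
    using norm_le_grad_abs[of "partial u" j x] by (simp add: grad_norm_sq_eq)
  then have "(u has_derivative (\<lambda>h. 0)) (at x within UNIV)" for x
    using C1_gradD[OF C1_grad_smooth[OF u_smooth], of x] by simp
  then obtain c where c: "\<And>x. u x = c"
    using has_derivative_zero_constant[of UNIV u] by auto
  have "c = 0"
  proof (rule ccontr)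
    assume "c \<noteq> 0"
    define K where "K = norm c * (unit_ball_vol 3 * (1 - \<theta>) ^ 3) powr (1 / p)"
    have "unit_ball_vol 3 * (1 - \<theta>) ^ 3 > 0" using unit_ball_vol_pos[of 3] \<theta> by (intro mult_pos_pos) auto
    then have K: "K > 0" using \<open>c \<noteq> 0\<close> unfolding K_def by (intro mult_pos_pos) auto
    have uc: "u = (\<lambda>x. c)" using c by auto
    have "eventually (\<lambda>\<rho>. \<rho> powr (-1/3) * g \<rho> < 1) at_top" by (rule order_tendstoD(2)[OF g_lim]) simp
    moreover have "eventually (\<lambda>\<rho>. \<rho> \<ge> R0) at_top" by (rule eventually_ge_at_top)
    \<comment> \<open>A constant has norm of order \<open>\<rho> powr (3 / p)\<close>, while
      \<open>g \<rho> \<le> \<rho> powr (1/3)\<close> limits the permitted growth to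
      \<open>\<rho> powr (3 / p - 2 / 3)\<close>; the quotient tends to 0.\<close>
    ultimately have "eventually (\<lambda>\<rho>. K \<le> C0 * \<rho> powr (-2/3)) at_top"
    proof eventually_elim
      case (elim \<rho>)
      have \<rho>: "\<rho> \<ge> 1" using elim(2) by (simp add: R0_def)
      have g1: "g \<rho> \<ge> 1" using g_range \<rho> by simp
      have "g \<rho> \<le> \<rho> powr (1/3)" using elim(1) \<rho> by (simp add: powr_minus field_simps)
      then have "g \<rho> powr (3 / p - 1) \<le> (\<rho> powr (1/3)) powr (3 / p - 1)"
        using g1 p by (intro powr_mono2) (auto simp: field_simps)
      also have "\<dots> = \<rho> powr (1 / p - 1 / 3)" using p by (simp add: powr_powr field_simps)
      finally have gp: "g \<rho> powr (3 / p - 1) \<le> \<rho> powr (1 / p - 1 / 3)" .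
      have "K * \<rho> powr (3 / p) \<le> Lp_norm_on (annulus (\<theta> * \<rho>) (\<rho> / \<theta>)) p u"
        unfolding K_def uc by (rule constant_Lp_norm_annulus_ge[OF \<theta> p(1)]) (use \<rho> in simp)
      also have "\<dots> \<le> C0 * (\<rho> powr (2 / p - 1 / 3) * g \<rho> powr (3 / p - 1))" by (rule C0[OF elim(2)])
      also have "\<dots> \<le> C0 * (\<rho> powr (2 / p - 1 / 3) * \<rho> powr (1 / p - 1 / 3))"
        using gp by (intro mult_left_mono) (auto simp: C0_def)
      also have "\<rho> powr (2 / p - 1 / 3) * \<rho> powr (1 / p - 1 / 3) = \<rho> powr (-2/3) * \<rho> powr (3 / p)"
      proof -
        have "2 / p - 1 / 3 + (1 / p - 1 / 3) = -2/3 + 3 / p" by (simp add: field_simps)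
        then show ?thesis by (simp only: powr_add[symmetric])
      qed
      finally have "K * \<rho> powr (3 / p) \<le> (C0 * \<rho> powr (-2/3)) * \<rho> powr (3 / p)" by (simp only: mult.assoc)
      then show ?case using \<rho> by (simp add: mult_le_cancel_right)
    qed
    moreover have "((\<lambda>\<rho>::real. C0 * \<rho> powr (-2/3)) \<longlongrightarrow> C0 * 0) at_top"
      by (intro tendsto_mult tendsto_const tendsto_neg_powr filterlim_ident) simp
    ultimately have "K \<le> 0" by (intro tendsto_lowerbound[where F = "at_top :: real filter"]) auto
    then show False using K by simp
  qed
  then show ?thesis using c by auto
qed

end
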